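(* Let $\sigma\in L^\infty(\mathbb{T})$ with $\operatorname{ess\,inf}\sigma>0$, and let $u,v\in C([0,\infty);L^2(\mathbb{T}))$ be real-valued mild solutions of $$\partial_t u(x,t)+\partial_x v(x,t)=0,\qquad \partial_t v(x,t)+\partial_x u(x,t)=-\sigma(x)v(x,t)\qquad\text{on }\mathbb{T}\times(0,\infty),$$ with initial data $u_0,v_0\in L^2(\mathbb{T})$. Put $u_{\mathrm{avg}}=(u_0)_{\mathrm{avg}}$, $f_\infty=\frac{u_{\mathrm{avg}}}{2}$, $f_\pm=\frac{u\pm v}{2}$, $f_{\pm,0}=\frac{u_0\pm v_0}{2}$, $f(t)=\binom{f_+(t)}{f_-(t)}$ and $f_0=\binom{f_{+,0}}{f_{-,0}}$. Then the following hold. (a) Suppose $\sigma(x)=\sigma>0$ is constant. If $\sigma\neq 2$, then for all $t\ge 0$ $$E_{\theta(\sigma)}(u(t)-u_{\mathrm{avg}},v(t))\le E_{\theta(\sigma)}(u_0-u_{\mathrm{avg}},v_0)\,e^{-2\mu(\sigma)t},$$ where $$\theta(\sigma)=\begin{cases}\sigma,&0<\sigma<2\\ \frac4\sigma,&\sigma>2\end{cases},\qquad \mu(\sigma)=\begin{cases}\frac\sigma2,&0<\sigma<2\\ \frac\sigma2-\sqrt{\frac{\sigma^2}{4}-1},&\sigma>2\end{cases}.$$ Consequently, if $\sigma\ne2$, for all $t\ge0$ $$\Big\|f(t)-\binom{f_\infty}{f_\infty}\Big\|\le C_\sigma\Big\|f_0-\binom{f_\infty}{f_\infty}\Big\|e^{-\mu(\sigma)t},\qquad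 C_\sigma=\begin{cases}\sqrt{\frac{2+\sigma}{2-\sigma}},&0<\sigma<2\\ \sqrt{\frac{\sigma+2}{\sigma-2}},&\sigma>2\end{cases},$$ and the decay rate $\mu(\sigma)$ is sharp, i.e. there are no $\lambda>\mu(\sigma)$ and $C>0$ such that $\big\|f(t)-\binom{f_\infty}{f_\infty}\big\|\le C\big\|f_0-\binom{f_\infty}{f_\infty}\big\|e^{-\lambda t}$ holds for all $t\ge0$ and all initial data. If $\sigma=2$, then for every $0<\epsilon<1$ and all $t\ge0$ $$E_{\frac{2(2-\epsilon^2)}{2+\epsilon^2}}(u(t)-u_{\mathrm{avg}},v(t))\le E_{\frac{2(2-\epsilon^2)}{2+\epsilon^2}}(u_0-u_{\mathrm{avg}},v_0)\,e^{-2(1-\epsilon)t}$$ and $$\Big\|f(t)-\binom{f_\infty}{f_\infty}\Big\|\le\frac{\sqrt2}{\epsilon}\Big\|f_0-\binom{f_\infty}{f_\infty}\Big\|e^{-(1-\epsilon)t}.$$ (b) Suppose $\sigma(x)$ is non-constant with $0<\sigma_{\min}:=\inf_{x\in\mathbb{T}}\sigma(x)<\sup_{x\in\mathbb{T}}\sigma(x)=:\sigma_{\max}<\infty$. Define $$\theta^*:=\min\Big(\sigma_{\min},\frac{4}{\sigma_{\max}}\Big),\qquad \alpha^*:=\begin{cases}\dfrac{\sigma_{\min}\big(4+2\sqrt{4-\sigma_{\min}^2}-\sigma_{\min}\sigma_{\max}\big)}{4+2\sqrt{4-\sigma_{\min}^2}-\sigma_{\min}^2},&\sigma_{\min}<\frac{4}{\sigma_{\max}}\\[2mm]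 \sigma_{\max}-\sqrt{\sigma_{\max}^2-4},&\sigma_{\min}\ge\frac{4}{\sigma_{\max}}\end{cases}.$$ Then for all $t\ge0$ $$E_{\theta^*}(u(t)-u_{\mathrm{avg}},v(t))\le E_{\theta^*}(u_0-u_{\mathrm{avg}},v_0)\,e^{-\alpha^* t},$$ and as a result $$\Big\|f(t)-\binom{f_\infty}{f_\infty}\Big\|\le\sqrt{\frac{2+\theta^*}{2-\theta^*}}\,\Big\|f_0-\binom{f_\infty}{f_\infty}\Big\|\,e^{-\frac{\alpha^*}{2}t}.$$
   Context: $\mathbb{T}$ is the one-dimensional torus, i.e. $[0,2\pi]$ with periodic boundary conditions. For $h\in L^1(\mathbb{T})$, $h_{\mathrm{avg}}:=\frac1{2\pi}\int_0^{2\pi}h(x)\,dx$. On $L^2(\mathbb{T})$ the inner product is $\langle f_1,f_2\rangle=\frac1{2\pi}\int_0^{2\pi}f_1(x)\overline{f_2(x)}\,dx$ with norm $\|\cdot\|$; for vectors, $\big\|\binom{f_1}{f_2}\big\|^2=\|f_1\|^2+\|f_2\|^2$. The anti-derivative of $f$ is $\partial_x^{-1}f(x):=\int_0^xf(y)\,dy-\Big(\int_0^xf(y)\,dy\Big)_{\mathrm{avg}}$ (the second term is the average over $x\in[0,2\pi]$ of $x\mapsto\int_0^xf(y)\,dy$). For $f,g\in L^2(\mathbb{T})$ and $\theta>0$, $$E_\theta(f,g):=\|f\|^2+\|g\|^2-\frac{\theta}{2\pi}\int_0^{2\pi}\operatorname{Re}\big(\partial_x^{-1}f(x)\,\overline{g(x)}\big)\,dx.$$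 Mild solution is meant in the sense of semigroup theory: $(u(t),v(t))=e^{tA}(u_0,v_0)$, where $e^{tA}$ is the $C_0$-semigroup on $L^2(\mathbb{T})\times L^2(\mathbb{T})$ generated by $A(u,v)=(-\partial_xv,\,-\partial_xu-\sigma v)$ with domain $H^1(\mathbb{T})\times H^1(\mathbb{T})$ ($H^1(\mathbb{T})$ the periodic Sobolev space). Infima and suprema of $\sigma\in L^\infty(\mathbb{T})$ over $x\in\mathbb{T}$ are essential infima and suprema. *)

theory Defs
  imports "HOL-Analysis.Analysis" "HOL-Probability.Essential_Supremum"
begin

section \<open>The Hilbert space of square-integrable functions on the torus\<close>

abbreviation torus :: "real measure" where
  "torus \<equiv> lebesgue_on {0..2 * pi}"

definition sq_integrable :: "(real \<Rightarrow> complex) \<Rightarrow> bool" where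
  "sq_integrable f \<longleftrightarrow>
     f \<in> borel_measurable torus \<and> integrable torus (\<lambda>x. (cmod (f x))\<^sup>2)"

lemma sq_integrable_zero: "sq_integrable (\<lambda>_. 0)"
  by (simp add: sq_integrable_def)

lemma sq_integrable_const: "sq_integrable (\<lambda>_. c)"
  by (simp add: sq_integrable_def)

lemma sq_integrable_mult:
  assumes "sq_integrable f" "sq_integrable g"
  shows "integrable torus (\<lambda>x. f x * cnj (g x))"
proof (rule Bochner_Integration.integrable_bound)
  show "integrable torus (\<lambda>x. (cmod (f x))\<^sup>2 + (cmod (g x))\<^sup>2)"
    using assms by (simp add: sq_integrable_def)
  show "(\<lambda>x. f x * cnj (g x)) \<in> borel_measurable torus"
    using assms by (auto simp: sq_integrable_def intro!: borel_measurable_times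
        measurable_compose[OF _ borel_measurable_continuous_onI[OF continuous_on_cnj[OF continuous_on_id]]])
  have "a * b \<le> a\<^sup>2 + b\<^sup>2" if "a \<ge> 0" "b \<ge> 0" for a b :: real
    using sum_squares_bound[of a b] that mult_nonneg_nonneg[OF that] by linarith
  then show "AE x in torus. norm (f x * cnj (g x)) \<le> norm ((cmod (f x))\<^sup>2 + (cmod (g x))\<^sup>2)"
    by (auto simp: norm_mult)
qed

lemma sq_integrable_add:
  assumes "sq_integrable f" "sq_integrable g"
  shows "sq_integrable (\<lambda>x. f x + g x)"
proof -
  have m: "(\<lambda>x. f x + g x) \<in> borel_measurable torus"
    using assms by (auto simp: sq_integrable_def)
  have "integrable torus (\<lambda>x. (cmod (f x + g x))\<^sup>2)"
  proof (rule Bochner_Integration.integrable_bound)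
    show "integrable torus (\<lambda>x. 2 * ((cmod (f x))\<^sup>2 + (cmod (g x))\<^sup>2))"
      using assms by (simp add: sq_integrable_def)
    show "(\<lambda>x. (cmod (f x + g x))\<^sup>2) \<in> borel_measurable torus"
      using m by measurable
    have "(cmod (a + b))\<^sup>2 \<le> 2 * ((cmod a)\<^sup>2 + (cmod b)\<^sup>2)" for a b
    proof -
      have "(cmod (a + b))\<^sup>2 \<le> (cmod a + cmod b)\<^sup>2"
        by (intro power_mono norm_triangle_ineq norm_ge_zero)
      also have "\<dots> \<le> 2 * ((cmod a)\<^sup>2 + (cmod b)\<^sup>2)"
        using sum_squares_bound[of "cmod a" "cmod b"] by (simp add: power2_sum)
      finally show ?thesis .
    qed
    then show "AE x in torus. norm ((cmod (f x + g x))\<^sup>2)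
        \<le> norm (2 * ((cmod (f x))\<^sup>2 + (cmod (g x))\<^sup>2))"
      by simp
  qed
  with m show ?thesis by (simp add: sq_integrable_def)
qed

lemma sq_integrable_scaleR:
  "sq_integrable f \<Longrightarrow> sq_integrable (\<lambda>x. r *\<^sub>R f x)"
  by (auto simp: sq_integrable_def power_mult_distrib intro!: borel_measurable_scaleR)

lemma sq_integrable_uminus: "sq_integrable f \<Longrightarrow> sq_integrable (\<lambda>x. - f x)"
  using sq_integrable_scaleR[of f "-1"] by simp

lemma sq_integrable_diff:
  "sq_integrable f \<Longrightarrow> sq_integrable g \<Longrightarrow> sq_integrable (\<lambda>x. f x - g x)"
  using sq_integrable_add[OF _ sq_integrable_uminus] by simp

quotient_type L2 = "real \<Rightarrow> complex" / partial:
  "\<lambda>f g. sq_integrable f \<and> sq_integrable g \<and> (AE x in torus. f x = g x)"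
  morphisms rep_L2 abs_L2
proof (rule part_equivpI)
  show "\<exists>f. sq_integrable f \<and> sq_integrable f \<and> (AE x in torus. f x = f x)"
    using sq_integrable_zero by auto
  show "symp (\<lambda>f g. sq_integrable f \<and> sq_integrable g \<and> (AE x in torus. f x = g x))"
    by (auto intro!: sympI elim: eventually_mono)
  show "transp (\<lambda>f g. sq_integrable f \<and> sq_integrable g \<and> (AE x in torus. f x = g x))"
    by (auto intro!: transpI elim: eventually_elim2)
qed

lift_definition const_L2 :: "complex \<Rightarrow> L2" is "\<lambda>c _. c"
  by (simp add: sq_integrable_const)

instantiation L2 :: real_vector
begin

lift_definition zero_L2 :: L2 is "\<lambda>_. 0"
  by (simp add: sq_integrable_zero)

lift_definition plus_L2 :: "L2 \<Rightarrow> L2 \<Rightarrow> L2" is "\<lambda>f g x. f x + g x"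
  by (auto intro: sq_integrable_add elim: eventually_elim2)

lift_definition uminus_L2 :: "L2 \<Rightarrow> L2" is "\<lambda>f x. - f x"
  by (auto intro: sq_integrable_uminus)

lift_definition minus_L2 :: "L2 \<Rightarrow> L2 \<Rightarrow> L2" is "\<lambda>f g x. f x - g x"
  by (auto intro: sq_integrable_diff elim: eventually_elim2)

lift_definition scaleR_L2 :: "real \<Rightarrow> L2 \<Rightarrow> L2" is "\<lambda>r f x. r *\<^sub>R f x"
  by (auto intro: sq_integrable_scaleR elim: eventually_mono)

instance
proof
  fix a b c :: L2 and r s :: real
  show "a + b + c = a + (b + c)"
    by transfer (auto simp: add.assoc intro!: sq_integrable_add)
  show "a + b = b + a"
    by transfer (auto simp: add.commute intro!: sq_integrable_add)
  show "0 + a = a"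
    by transfer auto
  show "- a + a = 0"
    by transfer (auto simp: sq_integrable_zero)
  show "a - b = a + - b"
    by transfer (auto intro: sq_integrable_diff)
  show "r *\<^sub>R (a + b) = r *\<^sub>R a + r *\<^sub>R b"
    by transfer (simp add: scaleR_add_right sq_integrable_add sq_integrable_scaleR)
  show "(r + s) *\<^sub>R a = r *\<^sub>R a + s *\<^sub>R a"
    by transfer (auto simp: scaleR_add_left intro!: sq_integrable_add sq_integrable_scaleR)
  show "r *\<^sub>R s *\<^sub>R a = (r * s) *\<^sub>R a"
    by transfer (auto intro!: sq_integrable_scaleR simp flip: scaleR_scaleR)
  show "1 *\<^sub>R a = a"
    by transfer auto
qed

end

instantiation L2 :: real_inner
begin

text \<open>The real part of the complex inner product; it induces the same norm.\<close>

lift_definition inner_L2 :: "L2 \<Rightarrow> L2 \<Rightarrow> real" is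
  "\<lambda>f g. 1 / (2 * pi) * Re (\<integral>x. f x * cnj (g x) \<partial>torus)"
proof -
  fix f1 f2 g1 g2
  assume f: "sq_integrable f1 \<and> sq_integrable f2 \<and> (AE x in torus. f1 x = f2 x)"
    and g: "sq_integrable g1 \<and> sq_integrable g2 \<and> (AE x in torus. g1 x = g2 x)"
  have "(\<integral>x. f1 x * cnj (g1 x) \<partial>torus) = (\<integral>x. f2 x * cnj (g2 x) \<partial>torus)"
  proof (rule integral_cong_AE)
    show "AE x in torus. f1 x * cnj (g1 x) = f2 x * cnj (g2 x)"
      using f g by (auto elim: eventually_elim2)
  qed (use f g sq_integrable_mult in \<open>auto dest: borel_measurable_integrable\<close>)
  then show "1 / (2 * pi) * Re (\<integral>x. f1 x * cnj (g1 x) \<partial>torus)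
      = 1 / (2 * pi) * Re (\<integral>x. f2 x * cnj (g2 x) \<partial>torus)"
    by simp
qed

definition norm_L2 :: "L2 \<Rightarrow> real" where
  "norm_L2 f = sqrt (inner f f)"

definition dist_L2 :: "L2 \<Rightarrow> L2 \<Rightarrow> real" where
  "dist_L2 f g = norm (f - g)"

definition sgn_L2 :: "L2 \<Rightarrow> L2" where
  "sgn_L2 f = f /\<^sub>R norm f"

definition uniformity_L2 :: "(L2 \<times> L2) filter" where
  "uniformity_L2 = (INF e\<in>{0<..}. principal {(f, g). dist f g < e})"

definition open_L2 :: "L2 set \<Rightarrow> bool" where
  "open_L2 U \<longleftrightarrow> (\<forall>f\<in>U. eventually (\<lambda>(f', g). f' = f \<longrightarrow> g \<in> U) uniformity)"

instance
proof
  fix a b c :: L2 and r :: real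
  show "dist a b = norm (a - b)"
    by (rule dist_L2_def)
  show "sgn a = a /\<^sub>R norm a"
    by (rule sgn_L2_def)
  show "uniformity = (INF e\<in>{0<..}. principal {(f, g :: L2). dist f g < e})"
    by (rule uniformity_L2_def)
  show "open U \<longleftrightarrow> (\<forall>f\<in>U. eventually (\<lambda>(f', g). f' = f \<longrightarrow> g \<in> U) uniformity)" for U :: "L2 set"
    by (rule open_L2_def)
  show "norm a = sqrt (inner a a)"
    by (rule norm_L2_def)
  show "inner a b = inner b a"
  proof transfer
    fix f g
    assume "sq_integrable f \<and> sq_integrable f \<and> (AE x in torus. f x = f x)"
      and "sq_integrable g \<and> sq_integrable g \<and> (AE x in torus. g x = g x)"
    have "(\<integral>x. g x * cnj (f x) \<partial>torus) = (\<integral>x. cnj (f x * cnj (g x)) \<partial>torus)"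
      by (simp add: mult.commute)
    also have "\<dots> = cnj (\<integral>x. f x * cnj (g x) \<partial>torus)"
      by (rule Bochner_Integration.integral_cnj)
    finally show "1 / (2 * pi) * Re (\<integral>x. f x * cnj (g x) \<partial>torus)
        = 1 / (2 * pi) * Re (\<integral>x. g x * cnj (f x) \<partial>torus)"
      by simp
  qed
  show "inner (a + b) c = inner a c + inner b c"
    by transfer (simp add: distrib_right sq_integrable_mult add_divide_distrib)
  show "inner (r *\<^sub>R a) b = r * inner a b"
    by transfer simp
  have sq: "(\<integral>x. f x * cnj (f x) \<partial>torus) = of_real (\<integral>x. (cmod (f x))\<^sup>2 \<partial>torus)"
    for f :: "real \<Rightarrow> complex"
    unfolding complex_norm_square[symmetric] by (rule integral_complex_of_real)
  show "0 \<le> inner a a"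
    by transfer (simp only: sq Re_complex_of_real, simp)
  show "inner a a = 0 \<longleftrightarrow> a = 0"
  proof transfer
    fix f
    assume "sq_integrable f \<and> sq_integrable f \<and> (AE x in torus. f x = f x)"
    then have f: "sq_integrable f" by simp
    have "(\<integral>x. (cmod (f x))\<^sup>2 \<partial>torus) = 0 \<longleftrightarrow> (AE x in torus. (cmod (f x))\<^sup>2 = 0)"
      by (rule integral_nonneg_eq_0_iff_AE) (use f in \<open>auto simp: sq_integrable_def\<close>)
    then show "1 / (2 * pi) * Re (\<integral>x. f x * cnj (f x) \<partial>torus) = 0 \<longleftrightarrow>
        sq_integrable f \<and> sq_integrable (\<lambda>_. 0) \<and> (AE x in torus. f x = 0)"
      using f by (simp only: sq Re_complex_of_real) (simp add: sq_integrable_zero)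
  qed
qed

end

text \<open>
  The library's norm on \<^typ>\<open>L2 \<times> L2\<close> satisfies
  \<open>norm (f, g) = sqrt ((norm f)\<^sup>2 + (norm g)\<^sup>2)\<close>, the norm used for pairs below.
\<close>

definition real_valued :: "L2 \<Rightarrow> bool" where
  "real_valued f \<longleftrightarrow> (AE x in torus. rep_L2 f x \<in> \<real>)"


section \<open>Semigroups and their generators\<close>

definition C0_semigroup :: "(real \<Rightarrow> 'a::real_normed_vector \<Rightarrow> 'a) \<Rightarrow> bool" where
  "C0_semigroup T \<longleftrightarrow>
     (\<forall>t\<ge>0. bounded_linear (T t)) \<and>
     T 0 = id \<and>
     (\<forall>s\<ge>0. \<forall>t\<ge>0. T (s + t) = T s \<circ> T t) \<and>
     (\<forall>x. ((\<lambda>t. T t x) \<longlongrightarrow> x) (at_right 0))"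

text \<open>
  Unbounded operators are represented by their graphs, so that an equation between two of them
  includes the equality of their domains.
\<close>

definition generator :: "(real \<Rightarrow> 'a::real_normed_vector \<Rightarrow> 'a) \<Rightarrow> ('a \<times> 'a) set" where
  "generator T = {(x, y). ((\<lambda>h. (T h x - x) /\<^sub>R h) \<longlongrightarrow> y) (at_right 0)}"


section \<open>The operator of the damped system\<close>

definition smooth_periodic :: "(real \<Rightarrow> real) \<Rightarrow> bool" where
  "smooth_periodic \<phi> \<longleftrightarrow>
     (\<forall>k x. (deriv ^^ k) \<phi> differentiable (at x)) \<and> (\<forall>x. \<phi> (x + 2 * pi) = \<phi> x)"

text \<open>
  Weak derivatives on the torus: since the test functions are periodic and need not vanish at the
  end points of \<open>[0, 2\<pi>]\<close>, the functions that have a weak derivative in \<^typ>\<open>L2\<close> form the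
  \<^emph>\<open>periodic\<close> Sobolev space.
\<close>

definition has_weak_derivative :: "L2 \<Rightarrow> L2 \<Rightarrow> bool" where
  "has_weak_derivative f g \<longleftrightarrow>
     (\<forall>\<phi>. smooth_periodic \<phi> \<longrightarrow>
        (\<integral>x. rep_L2 f x * of_real (deriv \<phi> x) \<partial>torus)
          = - (\<integral>x. rep_L2 g x * of_real (\<phi> x) \<partial>torus))"

definition H1 :: "L2 set" where
  "H1 = {f. \<exists>g. has_weak_derivative f g}"

definition Linfty :: "(real \<Rightarrow> real) set" where
  "Linfty = {\<sigma>. \<sigma> \<in> borel_measurable torus \<and> esssup torus (\<lambda>x. ereal \<bar>\<sigma> x\<bar>) < \<infinity>}"

text \<open>
  Both essential bounds are finite for \<open>\<sigma> \<in> Linfty\<close>, so that the conversion to \<^typ>\<open>real\<close>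
  loses nothing there.
\<close>

definition ess_sup :: "(real \<Rightarrow> real) \<Rightarrow> real" where
  "ess_sup \<sigma> = real_of_ereal (esssup torus (\<lambda>x. ereal (\<sigma> x)))"

definition ess_inf :: "(real \<Rightarrow> real) \<Rightarrow> real" where
  "ess_inf \<sigma> = real_of_ereal (- esssup torus (\<lambda>x. ereal (- \<sigma> x)))"

definition multiply :: "(real \<Rightarrow> real) \<Rightarrow> L2 \<Rightarrow> L2" where
  "multiply \<sigma> f = abs_L2 (\<lambda>x. of_real (\<sigma> x) * rep_L2 f x)"

definition system_operator :: "(real \<Rightarrow> real) \<Rightarrow> ((L2 \<times> L2) \<times> (L2 \<times> L2)) set" where
  "system_operator \<sigma> =
     {((u, v), (- v', - u' - multiply \<sigma> v)) | u v u' v'.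
        u \<in> H1 \<and> v \<in> H1 \<and> has_weak_derivative u u' \<and> has_weak_derivative v v'}"

text \<open>
  Only real-linearity is demanded of a \<^const>\<open>C0_semigroup\<close>; as the generator is complex-linear,
  the semigroup it generates is complex-linear automatically.
\<close>

definition system_semigroup :: "(real \<Rightarrow> real) \<Rightarrow> (real \<Rightarrow> L2 \<times> L2 \<Rightarrow> L2 \<times> L2) \<Rightarrow> bool" where
  "system_semigroup \<sigma> S \<longleftrightarrow> C0_semigroup S \<and> generator S = system_operator \<sigma>"

definition real_mild_solution ::
  "(real \<Rightarrow> L2 \<times> L2 \<Rightarrow> L2 \<times> L2) \<Rightarrow> L2 \<Rightarrow> L2 \<Rightarrow> (real \<Rightarrow> L2) \<Rightarrow> (real \<Rightarrow> L2) \<Rightarrow> bool" where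
  "real_mild_solution S u0 v0 u v \<longleftrightarrow>
     real_valued u0 \<and> real_valued v0 \<and>
     continuous_on {0..} u \<and> continuous_on {0..} v \<and>
     (\<forall>t\<ge>0. real_valued (u t) \<and> real_valued (v t) \<and> (u t, v t) = S t (u0, v0))"


section \<open>Averages, the energy functional, and the constants\<close>

definition mean :: "(real \<Rightarrow> complex) \<Rightarrow> complex" where
  "mean h = complex_of_real (1 / (2 * pi)) * (\<integral>x. h x \<partial>torus)"

definition antiderivative :: "(real \<Rightarrow> complex) \<Rightarrow> real \<Rightarrow> complex" where
  "antiderivative h x =
     (\<integral>y. h y \<partial>lebesgue_on {0..x}) - mean (\<lambda>x. \<integral>y. h y \<partial>lebesgue_on {0..x})"

definition energy :: "real \<Rightarrow> L2 \<Rightarrow> L2 \<Rightarrow> real" where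
  "energy \<theta> f g = (norm f)\<^sup>2 + (norm g)\<^sup>2
     - \<theta> / (2 * pi) * (\<integral>x. Re (antiderivative (rep_L2 f) x * cnj (rep_L2 g x)) \<partial>torus)"

definition avg :: "L2 \<Rightarrow> complex" where
  "avg f = mean (rep_L2 f)"

definition f_vec :: "L2 \<Rightarrow> L2 \<Rightarrow> L2 \<times> L2" where
  "f_vec u v = ((1 / 2) *\<^sub>R (u + v), (1 / 2) *\<^sub>R (u - v))"

definition f_equil :: "L2 \<Rightarrow> L2 \<times> L2" where
  "f_equil u0 = (const_L2 (avg u0 / 2), const_L2 (avg u0 / 2))"

definition \<theta>_of :: "real \<Rightarrow> real" where
  "\<theta>_of s = (if s < 2 then s else 4 / s)"

definition \<mu>_of :: "real \<Rightarrow> real" where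
  "\<mu>_of s = (if s < 2 then s / 2 else s / 2 - sqrt (s\<^sup>2 / 4 - 1))"

definition C_of :: "real \<Rightarrow> real" where
  "C_of s = (if s < 2 then sqrt ((2 + s) / (2 - s)) else sqrt ((s + 2) / (s - 2)))"

definition \<theta>_star :: "real \<Rightarrow> real \<Rightarrow> real" where
  "\<theta>_star smin smax = min smin (4 / smax)"

definition \<alpha>_star :: "real \<Rightarrow> real \<Rightarrow> real" where
  "\<alpha>_star smin smax =
     (if smin < 4 / smax
      then smin * (4 + 2 * sqrt (4 - smin\<^sup>2) - smin * smax) / (4 + 2 * sqrt (4 - smin\<^sup>2) - smin\<^sup>2)
      else smax - sqrt (smax\<^sup>2 - 4))"

end

theory Submission
  imports Defs
begin

text \<open>
  Along a solution with initial data in the domain of the generator, write \<open>U = u - u\<^sub>a\<^sub>v\<^sub>g\<close>.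
  Since \<open>\<partial>\<^sub>x\<^sup>-\<^sup>1\<close> is skew on mean-zero functions and inverts \<open>\<partial>\<^sub>x\<close> there,
  \<open>d/dt E\<^sub>\<theta> = - 2 \<langle>v, \<sigma> v\<rangle> + \<theta> (\<parallel>v\<parallel>\<^sup>2 - |v\<^sub>a\<^sub>v\<^sub>g|\<^sup>2 - \<parallel>U\<parallel>\<^sup>2 + \<langle>\<partial>\<^sub>x\<^sup>-\<^sup>1 U, \<sigma> v\<rangle>)\<close>.
  By Wirtinger's inequality \<open>\<parallel>\<partial>\<^sub>x\<^sup>-\<^sup>1 U\<parallel> \<le> \<parallel>U\<parallel>\<close>, the bound \<open>d/dt E\<^sub>\<theta> \<le> - \<alpha> E\<^sub>\<theta>\<close> follows from
  nonnegativity, at almost every \<open>x\<close>, of a quadratic form in \<open>(|v|, |\<partial>\<^sub>x\<^sup>-\<^sup>1 U|)\<close>. Its discriminant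
  condition is convex in \<open>\<sigma>(x)\<close>, so it needs checking only at two values of \<open>\<sigma>\<close>. General data are
  reached by density of trigonometric polynomials. The mode
  \<open>(a(t) cos x, b(t) sin x)\<close> with \<open>a' = - b\<close>, \<open>b' = a - \<sigma> b\<close> attains the rate for constant \<open>\<sigma> \<noteq> 2\<close>.
\<close>

section \<open>The Hilbert space of square-integrable functions\<close>

text \<open>With \<beta> = s - \<alpha>, the discriminant condition at damping value s reads (4 -
  \<theta>^2) \<beta>^2 \<ge> 4 (s - \<theta>)^2. For \<alpha> \<le> \<theta> \<le> s and \<theta> <
  2 the largest rate is therefore s - 2 (s - \<theta>) / sqrt (4 - \<theta>^2). As a function of
  \<theta> this peaks at 4 / s, the origin of that constant, taken at the upper bound of \<sigma>.
  At s = \<theta> the condition holds for every \<theta> \<le> 2; this is the second checking point,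
  and it leads to capping \<theta> by the lower bound of \<sigma>. The energy controls the norm only
  for \<theta> < 2, with ratio (2 + \<theta>) / (2 - \<theta>), so at \<sigma> = 2 some rate is
  given up for a finite constant. Two analytic obstacles shape the rest. \<open>generator\<close> is
  a limit from the right, so orbits are differentiated from the right only and monotonicity is
  proved without the mean value theorem. Continuity of orbits rests on local boundedness, hence on
  Baire's theorem, which is why \<open>L2\<close> is first shown to be complete. Fourier analysis is
  confined to finite sums; limits are taken by continuity of bounded operators.\<close>

lemma sq_integrable_rep_L2: "sq_integrable (rep_L2 f)"
  using Quotient_rep_reflp[OF Quotient_L2, of f] by simp

lemma abs_L2_rep_L2: "abs_L2 (rep_L2 f) = f"
  by (rule Quotient_abs_rep[OF Quotient_L2])

lemma rep_L2_abs_L2: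
  assumes "sq_integrable f"
  shows "AE x in torus. rep_L2 (abs_L2 f) x = f x"
proof -
  have "(\<lambda>f g. sq_integrable f \<and> sq_integrable g \<and> (AE x in torus. f x = g x)) (rep_L2 (abs_L2 f)) f"
    by (rule Quotient_rep_abs[OF Quotient_L2]) (use assms in simp)
  then show ?thesis by simp
qed

lemma abs_L2_eqI:
  assumes "sq_integrable f" "sq_integrable g" "AE x in torus. f x = g x"
  shows "abs_L2 f = abs_L2 g"
  using Quotient_rel_abs[OF Quotient_L2, of f g] assms by simp

lemma L2_eqI:
  assumes "AE x in torus. rep_L2 f x = rep_L2 g x"
  shows "f = g"
  using abs_L2_eqI[OF sq_integrable_rep_L2 sq_integrable_rep_L2 assms] by (simp add: abs_L2_rep_L2)

lemma abs_L2_add: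
  "sq_integrable f \<Longrightarrow> sq_integrable g \<Longrightarrow> abs_L2 (\<lambda>x. f x + g x) = abs_L2 f + abs_L2 g"
  by (rule plus_L2.abs_eq[symmetric]) auto

lemma abs_L2_diff:
  "sq_integrable f \<Longrightarrow> sq_integrable g \<Longrightarrow> abs_L2 (\<lambda>x. f x - g x) = abs_L2 f - abs_L2 g"
  by (rule minus_L2.abs_eq[symmetric]) auto

lemma abs_L2_scaleR:
  "sq_integrable f \<Longrightarrow> abs_L2 (\<lambda>x. r *\<^sub>R f x) = r *\<^sub>R abs_L2 f"
  by (rule scaleR_L2.abs_eq[symmetric]) auto

lemma abs_L2_const: "abs_L2 (\<lambda>_. c) = const_L2 c"
  by (simp add: const_L2_def)

lemma rep_L2_add: "AE x in torus. rep_L2 (f + g) x = rep_L2 f x + rep_L2 g x"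
  using rep_L2_abs_L2[OF sq_integrable_add[OF sq_integrable_rep_L2 sq_integrable_rep_L2], of f g]
  by (simp add: abs_L2_add sq_integrable_rep_L2 abs_L2_rep_L2)

lemma rep_L2_diff: "AE x in torus. rep_L2 (f - g) x = rep_L2 f x - rep_L2 g x"
  using rep_L2_abs_L2[OF sq_integrable_diff[OF sq_integrable_rep_L2 sq_integrable_rep_L2], of f g]
  by (simp add: abs_L2_diff sq_integrable_rep_L2 abs_L2_rep_L2)

lemma rep_L2_scaleR: "AE x in torus. rep_L2 (r *\<^sub>R f) x = r *\<^sub>R rep_L2 f x"
  using rep_L2_abs_L2[OF sq_integrable_scaleR[OF sq_integrable_rep_L2], of r f]
  by (simp add: abs_L2_scaleR sq_integrable_rep_L2 abs_L2_rep_L2)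

lemma rep_L2_const: "AE x in torus. rep_L2 (const_L2 c) x = c"
  using rep_L2_abs_L2[OF sq_integrable_const] by (simp add: abs_L2_const)

lemma borel_measurable_sq_integrable [dest]:
  "sq_integrable f \<Longrightarrow> f \<in> borel_measurable torus"
  by (simp add: sq_integrable_def)

lemma borel_measurable_rep_L2 [measurable]: "rep_L2 f \<in> borel_measurable torus"
  using sq_integrable_rep_L2 by auto

lemma integrable_rep_L2_mult: "integrable torus (\<lambda>x. rep_L2 f x * cnj (rep_L2 g x))"
  by (intro sq_integrable_mult sq_integrable_rep_L2)

lemma sq_integrable_integrable:
  assumes "sq_integrable f"
  shows "integrable torus f"
  using sq_integrable_mult[OF assms sq_integrable_const[of 1]] by simp

lemma integrable_rep_L2: "integrable torus (rep_L2 f)"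
  by (rule sq_integrable_integrable[OF sq_integrable_rep_L2])

lemma integrable_rep_L2_norm_sq: "integrable torus (\<lambda>x. (cmod (rep_L2 f x))\<^sup>2)"
  using sq_integrable_rep_L2[of f] by (simp add: sq_integrable_def)

lemma inner_abs_L2:
  assumes "sq_integrable f" "sq_integrable g"
  shows "inner (abs_L2 f) (abs_L2 g) = 1 / (2 * pi) * Re (\<integral>x. f x * cnj (g x) \<partial>torus)"
  by (rule inner_L2.abs_eq) (use assms in auto)

lemma norm_abs_L2_sq:
  assumes "sq_integrable f"
  shows "(norm (abs_L2 f))\<^sup>2 = 1 / (2 * pi) * (\<integral>x. (cmod (f x))\<^sup>2 \<partial>torus)"
proof -
  have "(\<integral>x. f x * cnj (f x) \<partial>torus) = of_real (\<integral>x. (cmod (f x))\<^sup>2 \<partial>torus)"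
    unfolding complex_norm_square[symmetric] by (rule integral_complex_of_real)
  then show ?thesis
    by (simp add: power2_norm_eq_inner inner_abs_L2 assms)
qed

lemma norm_L2_sq: "(norm f)\<^sup>2 = 1 / (2 * pi) * (\<integral>x. (cmod (rep_L2 f x))\<^sup>2 \<partial>torus)"
  using norm_abs_L2_sq[OF sq_integrable_rep_L2[of f]] by (simp add: abs_L2_rep_L2)

lemma measure_torus: "measure torus {0..2 * pi} = 2 * pi"
  by (simp add: measure_restrict_space)

interpretation torus: finite_measure torus
  by (rule finite_measureI) (simp add: emeasure_restrict_space)

lemma norm_const_L2: "norm (const_L2 c) = cmod c"
proof -
  have "(norm (const_L2 c))\<^sup>2 = (cmod c)\<^sup>2"
    unfolding abs_L2_const[symmetric]
    by (subst norm_abs_L2_sq) (simp_all add: sq_integrable_const measure_torus)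
  then show ?thesis by simp
qed

lemma bounded_linear_const_L2: "bounded_linear const_L2"
proof (rule bounded_linear_intro[where K=1])
  show "norm (const_L2 c) \<le> norm c * 1" for c by (simp add: norm_const_L2)
qed (simp_all add: abs_L2_const[symmetric] abs_L2_add[symmetric]
      abs_L2_scaleR[symmetric] sq_integrable_const)

lemma sq_integrable_bounded:
  assumes "f \<in> borel_measurable torus" "AE x in torus. cmod (f x) \<le> K"
  shows "sq_integrable f"
proof -
  have "integrable torus (\<lambda>x. (cmod (f x))\<^sup>2)"
  proof (rule torus.integrable_const_bound[where B = "K\<^sup>2"])
    show "AE x in torus. norm ((cmod (f x))\<^sup>2) \<le> K\<^sup>2"
      using assms(2) by (auto elim!: eventually_mono intro: power_mono)
  qed (use assms in measurable)
  with assms show ?thesis by (simp add: sq_integrable_def)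
qed

lemma sq_integrable_dominated:
  assumes "f \<in> borel_measurable torus" "sq_integrable g" "AE x in torus. cmod (f x) \<le> K * cmod (g x)"
  shows "sq_integrable f"
proof -
  have "integrable torus (\<lambda>x. (cmod (f x))\<^sup>2)"
  proof (rule Bochner_Integration.integrable_bound)
    show "integrable torus (\<lambda>x. K\<^sup>2 * (cmod (g x))\<^sup>2)"
      using assms by (simp add: sq_integrable_def)
    show "AE x in torus. norm ((cmod (f x))\<^sup>2) \<le> norm (K\<^sup>2 * (cmod (g x))\<^sup>2)"
      using assms(3)
    proof (rule eventually_mono)
      fix x assume "cmod (f x) \<le> K * cmod (g x)"
      then have "(cmod (f x))\<^sup>2 \<le> (K * cmod (g x))\<^sup>2" by (intro power_mono) auto
      then show "norm ((cmod (f x))\<^sup>2) \<le> norm (K\<^sup>2 * (cmod (g x))\<^sup>2)"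
        by (simp add: power_mult_distrib)
    qed
  qed (use assms in measurable)
  with assms show ?thesis by (simp add: sq_integrable_def)
qed

lemma norm_abs_L2_le:
  assumes "sq_integrable f" "AE x in torus. cmod (f x) \<le> K" "0 \<le> K"
  shows "norm (abs_L2 f) \<le> K"
proof -
  have "(\<integral>x. (cmod (f x))\<^sup>2 \<partial>torus) \<le> (\<integral>x. K\<^sup>2 \<partial>torus)"
    by (rule integral_mono_AE) (use assms in \<open>auto simp: sq_integrable_def elim!: eventually_mono intro: power_mono\<close>)
  then have "(\<integral>x. (cmod (f x))\<^sup>2 \<partial>torus) / (2 * pi) \<le> K\<^sup>2"
    by (simp add: measure_torus) (simp add: measure_torus[simplified mult.commute[of 2]] divide_le_eq ac_simps)
  then have "(norm (abs_L2 f))\<^sup>2 \<le> K\<^sup>2"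
    by (simp add: norm_abs_L2_sq assms)
  then show ?thesis using assms(3) by (rule power2_le_imp_le)
qed

text \<open>Cauchy-Schwarz for |f| against the constant 1. It makes averages and primitives bounded
  on \<open>L2\<close>, and it gives the L^1 control of increments in the completeness
  proof.\<close>

lemma integral_cmod_le_norm: "(\<integral>x. cmod (rep_L2 f x) \<partial>torus) \<le> 2 * pi * norm f"
proof -
  have sq: "sq_integrable (\<lambda>x. complex_of_real (cmod (rep_L2 f x)))"
    using sq_integrable_rep_L2[of f] by (auto simp: sq_integrable_def)
  let ?a = "abs_L2 (\<lambda>x. complex_of_real (cmod (rep_L2 f x)))"
  have "(norm ?a)\<^sup>2 = (norm f)\<^sup>2"
    by (subst norm_abs_L2_sq[OF sq], subst norm_L2_sq) simp
  then have "norm ?a = norm f" by simp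
  moreover have "inner ?a (const_L2 1) = 1 / (2 * pi) * (\<integral>x. cmod (rep_L2 f x) \<partial>torus)"
    unfolding abs_L2_const[symmetric]
    by (subst inner_abs_L2[OF sq sq_integrable_const]) simp
  moreover have "inner ?a (const_L2 1) \<le> norm ?a * norm (const_L2 1)"
    by (rule norm_cauchy_schwarz)
  ultimately have "(\<integral>x. cmod (rep_L2 f x) \<partial>torus) / (2 * pi) \<le> norm f"
    by (simp add: norm_const_L2)
  then show ?thesis by (simp add: divide_le_eq mult.commute)
qed

section \<open>Dominated convergence and completeness\<close>

text \<open>Dominated convergence applied to |F n - f|^2, with majorant 4 |w|^2 because the limit
  inherits the bound |f| \<le> |w|. All approximation steps in the density proof that are not
  uniform go through this.\<close>

lemma tendsto_abs_L2:
  assumes F: "\<And>n. F n \<in> borel_measurable torus" and w: "sq_integrable w"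
    and le: "\<And>n. AE x in torus. cmod (F n x) \<le> cmod (w x)"
    and lim: "AE x in torus. (\<lambda>n. F n x) \<longlonglongrightarrow> f x"
    and f: "sq_integrable f"
  shows "(\<lambda>n. abs_L2 (F n)) \<longlonglongrightarrow> abs_L2 f"
proof -
  have sqF: "sq_integrable (F n)" for n
    by (rule sq_integrable_dominated[where K=1 and g=w]) (use assms in auto)
  have le2: "AE x in torus. cmod (f x) \<le> cmod (w x)"
  proof -
    have "AE x in torus. \<forall>n. cmod (F n x) \<le> cmod (w x)"
      using le by (simp add: AE_all_countable)
    with lim show ?thesis
      by eventually_elim (blast intro: LIMSEQ_le_const2 tendsto_norm)
  qed
  have "(\<lambda>n. \<integral>x. (cmod (F n x - f x))\<^sup>2 \<partial>torus) \<longlonglongrightarrow> (\<integral>x. 0 \<partial>torus)"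
  proof (rule integral_dominated_convergence[where w="\<lambda>x. 4 * (cmod (w x))\<^sup>2"])
    show "AE x in torus. (\<lambda>n. (cmod (F n x - f x))\<^sup>2) \<longlonglongrightarrow> 0"
      using lim
    proof eventually_elim
      case (elim x)
      have "(\<lambda>n. (cmod (F n x - f x))\<^sup>2) \<longlonglongrightarrow> (cmod (f x - f x))\<^sup>2"
        by (intro tendsto_intros elim)
      then show ?case by simp
    qed
    show "AE x in torus. norm ((cmod (F n x - f x))\<^sup>2) \<le> 4 * (cmod (w x))\<^sup>2" for n
      using le[of n] le2
    proof eventually_elim
      case (elim x)
      have "cmod (F n x - f x) \<le> 2 * cmod (w x)"
        using norm_triangle_ineq4[of "F n x" "f x"] elim by linarith
      then have "(cmod (F n x - f x))\<^sup>2 \<le> (2 * cmod (w x))\<^sup>2"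
        by (rule power_mono) simp
      then show ?case by (simp add: power_mult_distrib)
    qed
    show "(\<lambda>x. (cmod (F n x - f x))\<^sup>2) \<in> borel_measurable torus" for n
      using F[of n] f by (auto simp: sq_integrable_def intro!: borel_measurable_power)
  qed (use w in \<open>auto simp: sq_integrable_def\<close>)
  then have "(\<lambda>n. sqrt (1 / (2 * pi) * (\<integral>x. (cmod (F n x - f x))\<^sup>2 \<partial>torus))) \<longlonglongrightarrow> sqrt (1 / (2 * pi) * 0)"
    by (intro tendsto_intros) simp
  moreover have "norm (abs_L2 (F n) - abs_L2 f) = sqrt (1 / (2 * pi) * (\<integral>x. (cmod (F n x - f x))\<^sup>2 \<partial>torus))" for n
    by (simp only: abs_L2_diff[symmetric] sqF f norm_abs_L2_sq[OF sq_integrable_diff[OF sqF f], symmetric]) simp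
  ultimately show ?thesis
    by (subst tendsto_dist_iff) (simp add: dist_norm)
qed

text \<open>Riesz-Fischer: a subsequence with geometrically small increments converges almost
  everywhere, and Fatou's lemma upgrades its pointwise limit to the norm limit of the whole
  sequence.\<close>

instance L2 :: banach
proof
  fix X :: "nat \<Rightarrow> L2"
  assume X: "Cauchy X"
  have "\<exists>r. strict_mono r \<and> (\<forall>n. norm (X (r (Suc n)) - X (r n)) < (1/2) ^ n)"
  proof -
    have "\<exists>N. \<forall>m\<ge>N. \<forall>n\<ge>N. norm (X m - X n) < (1/2) ^ k" for k :: nat
      using CauchyD[OF X, of "(1/2) ^ k"] by simp
    then obtain N where N: "\<And>k m n. m \<ge> N k \<Longrightarrow> n \<ge> N k \<Longrightarrow> norm (X m - X n) < (1/2) ^ k"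
      by metis
    \<comment> \<open>The maximum keeps the indices strictly increasing while staying beyond the
      Cauchy threshold for (1/2)^k.\<close>
    define r where "r = rec_nat (N 0) (\<lambda>k rk. max (Suc rk) (N (Suc k)))"
    have r0: "r 0 = N 0" and rS: "r (Suc k) = max (Suc (r k)) (N (Suc k))" for k
      by (simp_all add: r_def)
    have mono: "strict_mono r"
      by (rule strict_monoI_Suc) (simp add: rS less_max_iff_disj)
    have ge: "r k \<ge> N k" for k by (cases k) (simp_all add: r0 rS)
    have "norm (X (r (Suc n)) - X (r n)) < (1/2) ^ n" for n
      by (rule N) (use ge[of n] strict_monoD[OF mono, of n "Suc n"] in auto)
    with mono show ?thesis by blast
  qed
  then obtain r where r: "strict_mono r" and d: "\<And>n. norm (X (r (Suc n)) - X (r n)) < (1/2) ^ n"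
    by blast
  define D where "D n = rep_L2 (X (r (Suc n)) - X (r n))" for n
  have Dm [measurable]: "D n \<in> borel_measurable torus" for n by (simp add: D_def)
  have D_eq: "AE x in torus. \<forall>n. D n x = rep_L2 (X (r (Suc n))) x - rep_L2 (X (r n)) x"
    unfolding AE_all_countable D_def by (intro allI rep_L2_diff)
  \<comment> \<open>The increments are summable in \<open>L\<^sup>1\<close>, hence absolutely summable at almost every point.\<close>
  have AEsum: "AE x in torus. summable (\<lambda>n. cmod (D n x))"
  proof -
    have "(\<integral>\<^sup>+ x. (\<Sum>n. ennreal (cmod (D n x))) \<partial>torus) = (\<Sum>n. \<integral>\<^sup>+ x. ennreal (cmod (D n x)) \<partial>torus)"
      by (rule nn_integral_suminf) measurable
    also have "\<dots> \<le> (\<Sum>n. ennreal (2 * pi * (1/2) ^ n))"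
    proof (intro suminf_le)
      fix n
      have "(\<integral>\<^sup>+ x. ennreal (cmod (D n x)) \<partial>torus) = ennreal (\<integral>x. cmod (D n x) \<partial>torus)"
        by (rule nn_integral_eq_integral) (simp_all add: D_def integrable_rep_L2)
      also have "\<dots> \<le> ennreal (2 * pi * (1/2) ^ n)"
        unfolding D_def using integral_cmod_le_norm[of "X (r (Suc n)) - X (r n)"] d[of n]
        by (intro ennreal_leI) (auto elim!: order_trans intro: less_imp_le)
      finally show "(\<integral>\<^sup>+ x. ennreal (cmod (D n x)) \<partial>torus) \<le> ennreal (2 * pi * (1/2) ^ n)" .
    qed auto
    also have "\<dots> = ennreal (\<Sum>n. 2 * pi * (1/2) ^ n)"
      by (rule suminf_ennreal2) (auto intro!: summable_mult)
    also have "\<dots> < \<infinity>" by simp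
    finally have "AE x in torus. (\<Sum>n. ennreal (cmod (D n x))) \<noteq> \<infinity>"
      by (intro nn_integral_PInf_AE) auto
    then show ?thesis
      by eventually_elim (rule summable_suminf_not_top, auto)
  qed
  define g where "g x = rep_L2 (X (r 0)) x + (\<Sum>n. D n x)" for x
  have gm [measurable]: "g \<in> borel_measurable torus"
    unfolding g_def by measurable
  have lim: "AE x in torus. (\<lambda>n. rep_L2 (X (r n)) x) \<longlonglongrightarrow> g x"
    using AEsum D_eq
  proof eventually_elim
    case (elim x)
    then have "summable (\<lambda>n. D n x)"
      by (auto intro: summable_norm_cancel)
    then have "(\<lambda>n. \<Sum>i<n. D i x) \<longlonglongrightarrow> (\<Sum>n. D n x)"
      by (rule summable_LIMSEQ)
    moreover have "(\<Sum>i<n. D i x) = rep_L2 (X (r n)) x - rep_L2 (X (r 0)) x" for n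
      using elim sum_lessThan_telescope[of "\<lambda>n. rep_L2 (X (r n)) x" n] by simp
    ultimately have "(\<lambda>n. rep_L2 (X (r 0)) x + (rep_L2 (X (r n)) x - rep_L2 (X (r 0)) x)) \<longlonglongrightarrow> g x"
      unfolding g_def by (intro tendsto_intros) simp
    then show ?case by simp
  qed
  \<comment> \<open>Fatou along the subsequence. With e = 1 this yields square-integrability of
    \<open>g\<close>, with e/2 in place of e the convergence.\<close>
  have fatou: "integrable torus (\<lambda>x. (cmod (rep_L2 (X k) x - g x))\<^sup>2) \<and>
      (\<integral>x. (cmod (rep_L2 (X k) x - g x))\<^sup>2 \<partial>torus) \<le> 2 * pi * e\<^sup>2"
    if e: "e > 0" and k: "\<And>m. m \<ge> k \<Longrightarrow> norm (X k - X m) < e" for k e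
  proof -
    have "(\<integral>\<^sup>+ x. ennreal ((cmod (rep_L2 (X k) x - g x))\<^sup>2) \<partial>torus)
        = (\<integral>\<^sup>+ x. liminf (\<lambda>n. ennreal ((cmod (rep_L2 (X k) x - rep_L2 (X (r n)) x))\<^sup>2)) \<partial>torus)"
    proof (rule nn_integral_cong_AE, use lim in eventually_elim)
      case (elim x)
      have "(\<lambda>n. ennreal ((cmod (rep_L2 (X k) x - rep_L2 (X (r n)) x))\<^sup>2)) \<longlonglongrightarrow> ennreal ((cmod (rep_L2 (X k) x - g x))\<^sup>2)"
        by (intro tendsto_intros elim tendsto_ennrealI)
      from lim_imp_Liminf[OF _ this] show ?case by simp
    qed
    also have "\<dots> \<le> liminf (\<lambda>n. \<integral>\<^sup>+ x. ennreal ((cmod (rep_L2 (X k) x - rep_L2 (X (r n)) x))\<^sup>2) \<partial>torus)"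
      by (rule nn_integral_liminf) measurable
    also have "\<dots> \<le> liminf (\<lambda>n. ennreal (2 * pi * e\<^sup>2))"
    proof (rule Liminf_mono)
      show "\<forall>\<^sub>F n in sequentially. (\<integral>\<^sup>+ x. ennreal ((cmod (rep_L2 (X k) x - rep_L2 (X (r n)) x))\<^sup>2) \<partial>torus) \<le> ennreal (2 * pi * e\<^sup>2)"
      proof (rule eventually_sequentiallyI[of k])
        fix n assume "k \<le> n"
        then have "k \<le> r n" using seq_suble[OF r, of n] by simp
        then have "norm (X k - X (r n)) \<le> e" using k[of "r n"] by simp
        then have le: "(norm (X k - X (r n)))\<^sup>2 \<le> e\<^sup>2" by (rule power_mono) simp
        have "(\<integral>\<^sup>+ x. ennreal ((cmod (rep_L2 (X k) x - rep_L2 (X (r n)) x))\<^sup>2) \<partial>torus)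
          = (\<integral>\<^sup>+ x. ennreal ((cmod (rep_L2 (X k - X (r n)) x))\<^sup>2) \<partial>torus)"
          by (rule nn_integral_cong_AE) (use rep_L2_diff[of "X k" "X (r n)"] in \<open>auto elim!: eventually_mono\<close>)
        also have "\<dots> = ennreal (\<integral>x. (cmod (rep_L2 (X k - X (r n)) x))\<^sup>2 \<partial>torus)"
          by (rule nn_integral_eq_integral) (simp_all add: integrable_rep_L2_norm_sq)
        also have "\<dots> \<le> ennreal (2 * pi * e\<^sup>2)"
          using le by (intro ennreal_leI) (simp add: norm_L2_sq divide_le_eq mult.commute)
        finally show "(\<integral>\<^sup>+ x. ennreal ((cmod (rep_L2 (X k) x - rep_L2 (X (r n)) x))\<^sup>2) \<partial>torus) \<le> ennreal (2 * pi * e\<^sup>2)" .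
      qed
    qed
    also have "\<dots> = ennreal (2 * pi * e\<^sup>2)" by (simp add: Liminf_const)
    finally have le: "(\<integral>\<^sup>+ x. ennreal ((cmod (rep_L2 (X k) x - g x))\<^sup>2) \<partial>torus) \<le> ennreal (2 * pi * e\<^sup>2)" .
    have int: "integrable torus (\<lambda>x. (cmod (rep_L2 (X k) x - g x))\<^sup>2)"
      by (rule integrableI_bounded) (use le in \<open>auto intro: le_less_trans\<close>)
    moreover have "(\<integral>x. (cmod (rep_L2 (X k) x - g x))\<^sup>2 \<partial>torus) \<le> 2 * pi * e\<^sup>2"
      using le by (subst (asm) nn_integral_eq_integral[OF int]) auto
    ultimately show ?thesis by simp
  qed
  have N: "\<exists>N. \<forall>k\<ge>N. \<forall>m\<ge>k. norm (X k - X m) < e" if "e > 0" for e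
    using CauchyD[OF X that] by (meson order_trans)
  have g: "sq_integrable g"
  proof -
    obtain k where "\<forall>m\<ge>k. norm (X k - X m) < 1" using N[of 1] by auto
    then have "sq_integrable (\<lambda>x. rep_L2 (X k) x - g x)"
      using fatou[of 1 k] by (simp add: sq_integrable_def)
    from sq_integrable_diff[OF sq_integrable_rep_L2[of "X k"] this] show ?thesis by simp
  qed
  have "X \<longlonglongrightarrow> abs_L2 g"
  proof (rule LIMSEQ_I)
    fix e :: real assume e: "e > 0"
    then obtain K where K: "\<forall>k\<ge>K. \<forall>m\<ge>k. norm (X k - X m) < e / 2" using N[of "e/2"] by auto
    have "norm (X k - abs_L2 g) < e" if "k \<ge> K" for k
    proof -
      have "(norm (X k - abs_L2 g))\<^sup>2 = (norm (abs_L2 (\<lambda>x. rep_L2 (X k) x - g x)))\<^sup>2"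
        by (simp add: abs_L2_diff g sq_integrable_rep_L2 abs_L2_rep_L2)
      also have "\<dots> \<le> (e/2)\<^sup>2"
        using fatou[of "e/2" k] K that e
        by (subst norm_abs_L2_sq) (auto intro!: sq_integrable_diff g sq_integrable_rep_L2 simp: divide_le_eq mult.commute)
      finally have "norm (X k - abs_L2 g) \<le> e/2" by (rule power2_le_imp_le) (use e in simp)
      then show ?thesis using e by simp
    qed
    then show "\<exists>no. \<forall>n\<ge>no. norm (X n - abs_L2 g) < e" by blast
  qed
  then show "convergent X" by (auto simp: convergent_def)
qed

section \<open>Density of trigonometric polynomials\<close>

lemma sq_integrable_continuous:
  assumes "continuous_on {0..2 * pi} f"
  shows "sq_integrable f"
proof -
  have "compact (f ` {0..2 * pi})"
    using assms by (intro compact_continuous_image) auto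
  then obtain K where "\<And>x. x \<in> {0..2 * pi} \<Longrightarrow> cmod (f x) \<le> K"
    by (metis compact_imp_bounded bounded_iff imageI)
  then show ?thesis
    by (intro sq_integrable_bounded[where K=K] continuous_imp_measurable_on_sets_lebesgue assms)
      (auto simp: AE_restrict_space_iff)
qed

lemma integral_torus_continuous:
  fixes f :: "real \<Rightarrow> complex"
  assumes "continuous_on {0..2 * pi} f"
  shows "(\<integral>x. f x \<partial>torus) = integral {0..2 * pi} f"
  by (rule lebesgue_integral_eq_integral)
    (use assms in \<open>auto intro: sq_integrable_integrable sq_integrable_continuous\<close>)

lemma integral_torus_derivative:
  fixes F :: "real \<Rightarrow> complex"
  assumes "\<And>x. (F has_vector_derivative F' x) (at x)" "continuous_on {0..2 * pi} F'"
  shows "(\<integral>x. F' x \<partial>torus) = F (2 * pi) - F 0"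
proof -
  have "(F' has_integral (F (2 * pi) - F 0)) {0..2 * pi}"
    by (rule fundamental_theorem_of_calculus) (use assms in \<open>auto intro: has_vector_derivative_at_within\<close>)
  then show ?thesis
    by (simp add: integral_torus_continuous assms integral_unique)
qed

lemma has_vector_derivative_cis:
  "((\<lambda>x. c * cis (a * x)) has_vector_derivative (\<i> * of_real a * c * cis (a * x))) (at x)"
proof -
  have "((\<lambda>z. c * exp (\<i> * (of_real a * z))) has_field_derivative
      (\<i> * of_real a * c * exp (\<i> * (of_real a * of_real x)))) (at (of_real x))"
    by (auto intro!: derivative_eq_intros)
  from has_vector_derivative_real_field[OF this] show ?thesis
    by (simp add: cis_conv_exp)
qed

lemma integral_cis: "(\<integral>x. cis (of_int k * x) \<partial>torus) = (if k = 0 then 2 * pi else 0)"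
proof (cases "k = 0")
  case True
  then show ?thesis by (simp add: measure_torus scaleR_conv_of_real)
next
  case False
  have "(\<integral>x. \<i> * of_real (of_int k) * 1 * cis (of_int k * x) \<partial>torus)
      = 1 * cis (of_int k * (2 * pi)) - 1 * cis (of_int k * 0)"
    by (rule integral_torus_derivative has_vector_derivative_cis)+ (intro continuous_intros)
  also have "\<dots> = 0"
    using cis_multiple_2pi[of "of_int k"] by (simp add: mult.commute)
  finally show ?thesis using False by simp
qed

text \<open>\<open>L2\<close> carries only a real vector space structure, so the complex coefficient
  is an argument of the mode instead of a scalar factor.\<close>

definition harmonic :: "int \<Rightarrow> complex \<Rightarrow> L2" where
  "harmonic k c = abs_L2 (\<lambda>x. c * cis (of_int k * x))"

lemma sq_integrable_cis: "sq_integrable (\<lambda>x. c * cis (of_int k * x))"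
  by (intro sq_integrable_continuous continuous_intros)

lemma inner_harmonic:
  "inner (harmonic k c) (harmonic l d) = (if k = l then Re (c * cnj d) else 0)"
proof -
  have "(\<integral>x. c * cis (of_int k * x) * cnj (d * cis (of_int l * x)) \<partial>torus)
      = (\<integral>x. (c * cnj d) * cis (of_int (k - l) * x) \<partial>torus)"
    by (intro Bochner_Integration.integral_cong refl)
      (simp add: cis_cnj cis_mult left_diff_distrib mult.assoc mult.left_commute)
  also have "\<dots> = (c * cnj d) * (\<integral>x. cis (of_int (k - l) * x) \<partial>torus)"
    by (rule integral_mult_right_zero)
  also have "\<dots> = (c * cnj d) * (if k = l then 2 * pi else 0)"
    by (simp only: integral_cis) simp
  finally have "(\<integral>x. c * cis (of_int k * x) * cnj (d * cis (of_int l * x)) \<partial>torus)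
      = (c * cnj d) * (if k = l then 2 * pi else 0)" .
  then show ?thesis
    unfolding harmonic_def inner_abs_L2[OF sq_integrable_cis sq_integrable_cis] by (simp only:) simp
qed

lemma norm_harmonic: "norm (harmonic k c) = cmod c"
proof -
  have "(norm (harmonic k c))\<^sup>2 = (cmod c)\<^sup>2"
    by (simp only: power2_norm_eq_inner inner_harmonic) (simp add: inner_complex_def)
  then show ?thesis by simp
qed

lemma harmonic_0: "harmonic 0 c = const_L2 c"
  by (simp add: harmonic_def abs_L2_const)

lemma bounded_linear_harmonic: "bounded_linear (harmonic k)"
proof (rule bounded_linear_intro[where K=1])
  fix c d and r :: real
  show "norm (harmonic k c) \<le> norm c * 1" by (simp add: norm_harmonic)
  show "harmonic k (c + d) = harmonic k c + harmonic k d"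
    unfolding harmonic_def by (subst abs_L2_add[symmetric]) (simp_all add: sq_integrable_cis distrib_right)
  show "harmonic k (r *\<^sub>R c) = r *\<^sub>R harmonic k c"
    unfolding harmonic_def by (subst abs_L2_scaleR[symmetric]) (simp_all add: sq_integrable_cis)
qed

lemma harmonic_add: "harmonic k (c + d) = harmonic k c + harmonic k d"
  using bounded_linear_harmonic by (rule linear_add[OF bounded_linear.linear])

lemma harmonic_zero: "harmonic k 0 = 0"
  using bounded_linear_harmonic by (rule linear_0[OF bounded_linear.linear])

definition trig_L2 :: "L2 set" where
  "trig_L2 = span {harmonic k c | k c. True}"

lemma harmonic_in_trig_L2: "harmonic k c \<in> trig_L2"
  unfolding trig_L2_def by (rule span_base) auto

text \<open>Equal frequencies are merged, with coefficient \<open>c'\<close> in the induction step,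
  so that the summands are pairwise orthogonal. The Pythagorean computation behind Wirtinger's
  inequality relies on this normal form.\<close>

lemma trig_L2_sum:
  assumes "f \<in> trig_L2"
  obtains K c where "finite K" "f = (\<Sum>k\<in>K. harmonic k (c k))"
proof -
  have "\<exists>K c. finite K \<and> f = (\<Sum>k\<in>K. harmonic k (c k))"
    using assms unfolding trig_L2_def
  proof (induction rule: span_induct_alt)
    case base
    then show ?case by (intro exI[of _ "{}"]) auto
  next
    case (step r x y)
    then obtain k a K c where *: "x = harmonic k a" "finite K" "y = (\<Sum>k\<in>K. harmonic k (c k))"
      by auto
    define c' where "c' j = (if j \<in> K then c j else 0) + (if j = k then r *\<^sub>R a else 0)" for j
    have "(\<Sum>j\<in>insert k K. harmonic j (c' j))
      = (\<Sum>j\<in>insert k K. harmonic j (if j \<in> K then c j else 0)) + (\<Sum>j\<in>insert k K. harmonic j (if j = k then r *\<^sub>R a else 0))"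
      by (simp add: c'_def harmonic_add sum.distrib del: sum.insert)
    also have "(\<Sum>j\<in>insert k K. harmonic j (if j \<in> K then c j else 0)) = y"
      unfolding *(3) by (rule sum.mono_neutral_cong_right) (use *(2) in \<open>auto simp: harmonic_zero\<close>)
    also have "(\<Sum>j\<in>insert k K. harmonic j (if j = k then r *\<^sub>R a else 0)) = harmonic k (r *\<^sub>R a)"
      using *(2) by (subst sum.mono_neutral_cong_right[of _ "{k}" _ "\<lambda>j. harmonic j (if j = k then r *\<^sub>R a else 0)"])
         (auto simp: harmonic_zero)
    also have "harmonic k (r *\<^sub>R a) = r *\<^sub>R x"
      using *(1) bounded_linear_harmonic by (simp add: linear_scale[OF bounded_linear.linear])
    finally show ?case using *(2) by (intro exI[of _ "insert k K"] exI[of _ c']) (simp add: add.commute)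
  qed
  then show ?thesis using that by blast
qed

section \<open>Stone-Weierstrass on the circle\<close>

text \<open>These are functions rather than classes in \<open>L2\<close>, because closure under
  products is what connects them with polynomials on the circle.\<close>

inductive_set trig_fun :: "(real \<Rightarrow> complex) set" where
  cis: "(\<lambda>x. c * cis (of_int k * x)) \<in> trig_fun"
| add: "f \<in> trig_fun \<Longrightarrow> g \<in> trig_fun \<Longrightarrow> (\<lambda>x. f x + g x) \<in> trig_fun"

lemma trig_fun_mult:
  assumes "f \<in> trig_fun" "g \<in> trig_fun"
  shows "(\<lambda>x. f x * g x) \<in> trig_fun"
  using assms
proof (induction f)
  case (cis c k)
  from cis show ?case
  proof (induction g)
    case (cis d l)
    have "(\<lambda>x. c * cis (of_int k * x) * (d * cis (of_int l * x))) = (\<lambda>x. (c * d) * cis (of_int (k + l) * x))"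
      by (simp add: fun_eq_iff distrib_right cis_mult mult.assoc mult.left_commute[of _ d])
    then show ?case by (simp only: trig_fun.cis)
  next
    case (add f g)
    then show ?case by (simp only: distrib_left trig_fun.add)
  qed
next
  case (add f1 f2)
  then show ?case by (simp only: distrib_right trig_fun.add)
qed

lemma trig_fun_const: "(\<lambda>x. c) \<in> trig_fun"
  using trig_fun.cis[of c 0] by simp

lemma trig_fun_trig_L2:
  assumes "f \<in> trig_fun"
  shows "sq_integrable f \<and> abs_L2 f \<in> trig_L2"
  using assms
proof induction
  case (cis c k)
  then show ?case using harmonic_in_trig_L2[of k c] by (simp add: sq_integrable_cis harmonic_def)
next
  case (add f g)
  then show ?case
    by (auto simp: abs_L2_add trig_L2_def intro: span_add sq_integrable_add)
qed

text \<open>A real-linear functional takes the value f(1) cos x + f(\<i>) sin x at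
  \<open>cis x\<close>. Euler's formulas turn this into frequencies 1 and -1 with the coefficients
  \<open>a\<close> and \<open>b\<close>; sums and products stay in the algebra.\<close>

lemma trig_fun_real_polynomial:
  assumes "real_polynomial_function p"
  shows "(\<lambda>x. complex_of_real (p (cis x))) \<in> trig_fun"
  using assms
proof induction
  case (linear f)
  define a where "a = (of_real (f 1) - \<i> * of_real (f \<i>)) / (2 :: complex)"
  define b where "b = (of_real (f 1) + \<i> * of_real (f \<i>)) / (2 :: complex)"
  have "f (cis x) = f (cos x *\<^sub>R 1 + sin x *\<^sub>R \<i>)" for x
    by (rule arg_cong[of _ _ f]) (simp add: complex_eq_iff)
  also have "\<dots> x = cos x * f 1 + sin x * f \<i>" for x
    using bounded_linear.linear[OF linear] by (simp add: linear_add linear_scale)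
  finally have "complex_of_real (f (cis x)) = a * cis (of_int 1 * x) + b * cis (of_int (-1) * x)" for x
    by (simp add: a_def b_def complex_eq_iff field_simps)
  then show ?case by (simp only: trig_fun.intros)
next
  case (const c)
  then show ?case by (simp add: trig_fun_const)
next
  case (add f g)
  then show ?case by (simp add: trig_fun.add)
next
  case (mult f g)
  then show ?case by (simp add: trig_fun_mult)
qed

lemma polynomial_function_cis_trig_fun:
  assumes "polynomial_function (p :: complex \<Rightarrow> complex)"
  shows "(\<lambda>x. p (cis x)) \<in> trig_fun"
proof -
  have "(\<lambda>x. complex_of_real (Re (p (cis x)))) \<in> trig_fun" "(\<lambda>x. complex_of_real (Im (p (cis x)))) \<in> trig_fun"
    using assms trig_fun_real_polynomial[of "Re \<circ> p"] trig_fun_real_polynomial[of "Im \<circ> p"] bounded_linear_Re bounded_linear_Im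
    by (auto simp: polynomial_function_def)
  then have "(\<lambda>x. of_real (Re (p (cis x))) + \<i> * of_real (Im (p (cis x)))) \<in> trig_fun"
    by (intro trig_fun.add trig_fun_mult trig_fun_const)
  moreover have "(\<lambda>x. of_real (Re (p (cis x))) + \<i> * of_real (Im (p (cis x)))) = (\<lambda>x. p (cis x))"
    by (simp add: fun_eq_iff flip: complex_eq)
  ultimately show ?thesis by simp
qed

text \<open>A continuous periodic function descends to the unit circle, where polynomials are
  uniformly dense. Since the norm is normalised by 2 \<pi>, a uniform error e is also an error e in
  \<open>L2\<close>.\<close>

lemma periodic_continuous_in_closure:
  assumes F: "continuous_on {0..2 * pi} F" and per: "F 0 = F (2 * pi)"
  shows "abs_L2 F \<in> closure trig_L2"
proof -
  define p where "p t = F (2 * pi * t)" for t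
  have "path p"
    unfolding path_def p_def
    by (intro continuous_on_compose2[OF F] continuous_intros) (auto simp: mult_le_cancel_left1)
  moreover have "pathfinish p = pathstart p"
    using per by (simp add: pathfinish_def pathstart_def p_def)
  ultimately have "homotopic_loops UNIV p p"
    by (simp add: homotopic_loops_refl)
  \<comment> \<open>Used only for the continuity on the circle of the reparametrised loop.\<close>
  from homotopic_loops_imp_homotopic_circlemaps[OF this]
  have "continuous_on (sphere 0 1) (p \<circ> (\<lambda>z. Arg2pi z / (2 * pi)))"
    using homotopic_with_imp_continuous by blast
  then have cont: "continuous_on (sphere 0 1) (\<lambda>z. F (Arg2pi z))"
    by (simp add: p_def o_def)
  \<comment> \<open>\<open>Arg2pi\<close> takes values in [0, 2 \<pi>), so the right end point is
    sent back to 0; this is where F 0 = F (2 \<pi>) enters.\<close>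
  have eq: "F (Arg2pi (cis x)) = F x" if "0 \<le> x" "x \<le> 2 * pi" for x
  proof (cases "x = 2 * pi")
    case True
    have "Arg2pi (cis (2 * pi)) = 0" by (simp add: Arg2pi_of_real[of 1, simplified])
    with True per show ?thesis by simp
  next
    case False
    then have "Arg2pi (cis x) = x"
      using that by (intro Arg2pi_unique[of 1]) (auto simp: cis_conv_exp)
    then show ?thesis by simp
  qed
  have sqF: "sq_integrable F" by (rule sq_integrable_continuous[OF F])
  have "\<exists>y\<in>trig_L2. dist y (abs_L2 F) \<le> e" if "e > 0" for e
  proof -
    from Stone_Weierstrass_polynomial_function[OF compact_sphere cont that]
    obtain g where g: "polynomial_function g" "\<forall>z\<in>sphere 0 1. cmod (F (Arg2pi z) - g z) < e"
      by (elim exE conjE)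
    define q where "q x = g (cis x)" for x
    have q: "sq_integrable q" "abs_L2 q \<in> trig_L2"
      using trig_fun_trig_L2[OF polynomial_function_cis_trig_fun[OF g(1)]] by (simp_all add: q_def[abs_def])
    have "norm (abs_L2 (\<lambda>x. F x - q x)) \<le> e"
    proof (rule norm_abs_L2_le)
      show "AE x in torus. cmod (F x - q x) \<le> e"
      proof (rule AE_I2)
        fix x assume "x \<in> space torus"
        then show "cmod (F x - q x) \<le> e"
          using bspec[OF g(2), of "cis x"] eq[of x] by (simp add: q_def)
      qed
    qed (use that sqF q in \<open>auto intro: sq_integrable_diff\<close>)
    then show ?thesis
      using q by (intro bexI[of _ "abs_L2 q"]) (simp_all add: dist_norm norm_minus_commute abs_L2_diff sqF)
  qed
  then show ?thesis by (simp add: closure_approachable_le)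
qed

lemma closed_seq_limit:
  assumes "\<And>n. x n \<in> closure A" "x \<longlonglongrightarrow> l"
  shows "l \<in> closure A"
  using assms closed_closure closed_sequentially by blast

text \<open>The cutoff \<open>1 - cos (x/2)\<^sup>2\<^sup>n\<close> vanishes at both end points, which makes the function periodic.\<close>

lemma continuous_in_closure:
  assumes g: "continuous_on {0..2 * pi} g"
  shows "abs_L2 g \<in> closure trig_L2"
proof -
  define F where "F n x = complex_of_real (1 - cos (x / 2) ^ (2 * n)) * g x" for n :: nat and x
  have le1: "\<bar>1 - cos (x / 2) ^ (2 * n)\<bar> \<le> 1" for n and x :: real
    using power_le_one[of "(cos (x/2))\<^sup>2" n] zero_le_power[of "(cos (x/2))\<^sup>2" n]
    by (simp add: power_mult abs_square_le_1)
  have F: "continuous_on {0..2 * pi} (F n)" for n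
    unfolding F_def by (intro continuous_intros g) auto
  have mem: "abs_L2 (F (Suc n)) \<in> closure trig_L2" for n
    by (rule periodic_continuous_in_closure[OF F]) (simp add: F_def)
  have "(\<lambda>n. abs_L2 (F (Suc n))) \<longlonglongrightarrow> abs_L2 g"
  proof (rule tendsto_abs_L2[where w=g])
    show "F (Suc n) \<in> borel_measurable torus" for n
      using sq_integrable_continuous[OF F] by auto
    show "AE x in torus. cmod (F (Suc n) x) \<le> cmod (g x)" for n
      using mult_left_le_one_le[OF norm_ge_zero abs_ge_zero le1]
      unfolding F_def norm_mult norm_of_real by (intro AE_I2) blast
    \<comment> \<open>On the interval |cos (x/2)| = 1 only at the two end points; everywhere else
      the powers tend to 0.\<close>
    have "AE x in lebesgue. x \<notin> {0, 2 * pi}"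
      by (rule AE_not_in) (simp add: negligible_iff_null_sets[symmetric])
    then have "AE x in lebesgue. x \<in> {0..2*pi} \<longrightarrow> (\<lambda>n. F (Suc n) x) \<longlonglongrightarrow> g x"
    proof eventually_elim
      case (elim x)
      show ?case
      proof
        assume "x \<in> {0..2*pi}"
        with elim have "0 < x / 2" "x / 2 < pi" by auto
        then have "sin (x / 2) > 0" by (rule sin_gt_zero)
        then have "(cos (x/2))\<^sup>2 < 1"
          using sin_cos_squared_add[of "x/2"] by (smt (verit) zero_less_power)
        then have "(\<lambda>n. ((cos (x/2))\<^sup>2) ^ Suc n) \<longlonglongrightarrow> 0"
          by (intro LIMSEQ_Suc LIMSEQ_realpow_zero) auto
        then have "(\<lambda>n. complex_of_real (1 - ((cos (x/2))\<^sup>2) ^ Suc n) * g x) \<longlonglongrightarrow> of_real (1 - 0) * g x"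
          by (intro tendsto_intros)
        then show "(\<lambda>n. F (Suc n) x) \<longlonglongrightarrow> g x"
          unfolding F_def power_mult by simp
      qed
    qed
    then show "AE x in torus. (\<lambda>n. F (Suc n) x) \<longlonglongrightarrow> g x"
      by (simp add: AE_restrict_space_iff)
  qed (use sq_integrable_continuous[OF g] in auto)
  then show ?thesis using closed_seq_limit[of "\<lambda>n. abs_L2 (F (Suc n))"] mem by blast
qed

section \<open>From continuous to square-integrable functions\<close>

text \<open>Radial projection onto the closed disc of radius C; the form with \<open>max\<close>
  makes its continuity immediate.\<close>

definition clip :: "real \<Rightarrow> complex \<Rightarrow> complex" where
  "clip C z = (C / max C (cmod z)) *\<^sub>R z"

lemma continuous_on_clip: "C > 0 \<Longrightarrow> continuous_on A (clip C)"
  unfolding clip_def[abs_def] by (intro continuous_intros) (auto simp: max_def)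

lemma norm_clip_le:
  assumes "C > 0"
  shows "cmod (clip C z) \<le> C" "cmod (clip C z) \<le> cmod z"
proof -
  have "C * cmod z \<le> C * max C (cmod z)" "C * cmod z \<le> max C (cmod z) * cmod z"
    using assms by (auto intro!: mult_left_mono mult_right_mono)
  then show "cmod (clip C z) \<le> C" "cmod (clip C z) \<le> cmod z"
    using assms by (simp_all add: clip_def divide_le_eq less_max_iff_disj mult.commute)
qed

lemma clip_id: "C > 0 \<Longrightarrow> cmod z \<le> C \<Longrightarrow> clip C z = z"
  by (simp add: clip_def max_def)

text \<open>A bounded measurable function is an almost everywhere limit of continuous ones. These
  need not be bounded uniformly, so they are clipped at the bound C, which leaves the limit
  unchanged and supplies a constant majorant. An unbounded function is reached by clipping it at
  increasing levels, dominated by itself.\<close>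

lemma closure_trig_L2: "closure trig_L2 = UNIV"
proof -
  have bdd: "abs_L2 f \<in> closure trig_L2"
    if f: "f \<in> borel_measurable torus" and C: "C > 0" "\<And>x. cmod (f x) \<le> C" for f C
  proof -
    have "f measurable_on {0..2*pi}"
      using f by (subst measurable_on_iff_borel_measurable) auto
    then obtain N g where N: "negligible N" and g: "\<And>n. continuous_on UNIV (g n)"
      and lim: "\<And>x. x \<notin> N \<Longrightarrow> (\<lambda>n. g n x) \<longlonglongrightarrow> (if x \<in> {0..2*pi} then f x else 0)"
      unfolding measurable_on_def by blast
    have sqf: "sq_integrable f"
      by (rule sq_integrable_bounded[OF f]) (use C in auto)
    have cont: "continuous_on {0..2*pi} (\<lambda>x. clip C (g n x))" for n
      by (rule continuous_on_compose2[OF continuous_on_clip[OF C(1), of UNIV]])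
        (auto intro: continuous_on_subset[OF g])
    have "(\<lambda>n. abs_L2 (\<lambda>x. clip C (g n x))) \<longlonglongrightarrow> abs_L2 f"
    proof (rule tendsto_abs_L2[where w="\<lambda>_. of_real C"])
      show "(\<lambda>x. clip C (g n x)) \<in> borel_measurable torus" for n
        using sq_integrable_continuous[OF cont] by auto
      show "AE x in torus. cmod (clip C (g n x)) \<le> cmod (complex_of_real C)" for n
        using norm_clip_le(1)[OF C(1)] C(1) by simp
      have "AE x in lebesgue. x \<notin> N"
        using N by (intro AE_not_in) (simp add: negligible_iff_null_sets)
      then have "AE x in lebesgue. x \<in> {0..2*pi} \<longrightarrow> (\<lambda>n. clip C (g n x)) \<longlonglongrightarrow> f x"
      proof eventually_elim
        case (elim x)
        have "(\<lambda>n. clip C (g n x)) \<longlonglongrightarrow> clip C (f x)" if "x \<in> {0..2*pi}"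
          using lim[OF elim] that
          by (intro continuous_on_tendsto_compose[OF continuous_on_clip[OF C(1), of UNIV]]) auto
        then show ?case using clip_id[OF C(1) C(2)] by simp
      qed
      then show "AE x in torus. (\<lambda>n. clip C (g n x)) \<longlonglongrightarrow> f x"
        by (simp add: AE_restrict_space_iff)
    qed (use sqf sq_integrable_const in auto)
    then show ?thesis
      using closed_seq_limit[of "\<lambda>n. abs_L2 (\<lambda>x. clip C (g n x))"] continuous_in_closure[OF cont] by blast
  qed
  have "f \<in> closure trig_L2" for f
  proof -
    have meas: "(\<lambda>x. clip (Suc n) (rep_L2 f x)) \<in> borel_measurable torus" for n
      using measurable_compose[OF borel_measurable_rep_L2 borel_measurable_continuous_onI[OF continuous_on_clip[of "Suc n" UNIV]]]
      by simp
    have "(\<lambda>n. abs_L2 (\<lambda>x. clip (Suc n) (rep_L2 f x))) \<longlonglongrightarrow> abs_L2 (rep_L2 f)"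
    proof (rule tendsto_abs_L2[where w="rep_L2 f"])
      show "AE x in torus. (\<lambda>n. clip (Suc n) (rep_L2 f x)) \<longlonglongrightarrow> rep_L2 f x"
      proof (rule AE_I2)
        fix x
        obtain N :: nat where N: "cmod (rep_L2 f x) \<le> N" using real_arch_simple by blast
        show "(\<lambda>n. clip (Suc n) (rep_L2 f x)) \<longlonglongrightarrow> rep_L2 f x"
          by (rule tendsto_eventually, rule eventually_sequentiallyI[of N], rule clip_id) (use N in auto)
      qed
    qed (use meas norm_clip_le(2) sq_integrable_rep_L2 in auto)
    moreover have "abs_L2 (\<lambda>x. clip (Suc n) (rep_L2 f x)) \<in> closure trig_L2" for n
      by (rule bdd[OF meas, of "real (Suc n)"]) (use norm_clip_le(1) in auto)
    ultimately show ?thesis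
      using closed_seq_limit[of "\<lambda>n. abs_L2 (\<lambda>x. clip (Suc n) (rep_L2 f x))"] by (simp add: abs_L2_rep_L2)
  qed
  then show ?thesis by auto
qed

section \<open>Means, antiderivatives and weak derivatives\<close>

definition mean_L2 :: "L2 \<Rightarrow> L2" where
  "mean_L2 f = const_L2 (avg f)"

lemma avg_eq: "avg f = of_real (1 / (2 * pi)) * (\<integral>x. rep_L2 f x \<partial>torus)"
  by (simp add: avg_def mean_def)

lemma bounded_linear_avg: "bounded_linear avg"
proof (rule bounded_linear_intro[where K=1])
  fix f g :: L2 and r :: real
  have "(\<integral>x. rep_L2 (f + g) x \<partial>torus) = (\<integral>x. rep_L2 f x + rep_L2 g x \<partial>torus)"
    by (rule integral_cong_AE) (use rep_L2_add[of f g] in auto)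
  then show "avg (f + g) = avg f + avg g"
    by (simp add: avg_eq integrable_rep_L2 distrib_left)
  have "(\<integral>x. rep_L2 (r *\<^sub>R f) x \<partial>torus) = (\<integral>x. r *\<^sub>R rep_L2 f x \<partial>torus)"
    by (rule integral_cong_AE) (use rep_L2_scaleR[of r f] in auto)
  then show "avg (r *\<^sub>R f) = r *\<^sub>R avg f"
    by (simp add: avg_eq)
  have "cmod (\<integral>x. rep_L2 f x \<partial>torus) \<le> (\<integral>x. cmod (rep_L2 f x) \<partial>torus)"
    by (rule integral_norm_bound)
  also have "\<dots> \<le> 2 * pi * norm f" by (rule integral_cmod_le_norm)
  finally have "cmod (\<integral>x. rep_L2 f x \<partial>torus) / (2 * pi) \<le> norm f"
    by (simp add: divide_le_eq mult.commute)
  then show "norm (avg f) \<le> norm f * 1"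
    by (simp add: avg_eq norm_mult norm_divide)
qed

lemma bounded_linear_mean_L2: "bounded_linear mean_L2"
  unfolding mean_L2_def[abs_def]
  by (rule bounded_linear_compose[OF bounded_linear_const_L2 bounded_linear_avg])

lemma avg_const: "avg (const_L2 c) = c"
proof -
  have "(\<integral>x. rep_L2 (const_L2 c) x \<partial>torus) = (\<integral>x. c \<partial>torus)"
    by (rule integral_cong_AE) (use rep_L2_const[of c] in auto)
  then show ?thesis
    by (simp add: avg_eq measure_torus) (simp add: scaleR_conv_of_real)
qed

lemma inner_const_L2: "inner (const_L2 c) f = Re (c * cnj (avg f))"
proof -
  have "(\<integral>x. c * cnj (rep_L2 f x) \<partial>torus) = c * (\<integral>x. cnj (rep_L2 f x) \<partial>torus)"
    by (rule integral_mult_right_zero)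
  moreover have "(\<integral>x. cnj (rep_L2 f x) \<partial>torus) = cnj (\<integral>x. rep_L2 f x \<partial>torus)"
    by (rule Bochner_Integration.integral_cnj)
  moreover have "inner (const_L2 c) f = 1 / (2 * pi) * Re (\<integral>x. c * cnj (rep_L2 f x) \<partial>torus)"
    using inner_abs_L2[OF sq_integrable_const sq_integrable_rep_L2, of c f]
    by (simp add: abs_L2_rep_L2 abs_L2_const)
  ultimately show ?thesis by (simp add: avg_eq)
qed

lemma mean_L2_idem: "mean_L2 (mean_L2 f) = mean_L2 f"
  by (simp add: mean_L2_def avg_const)

text \<open>\<open>mean_L2\<close> is the orthogonal projection onto the constants.\<close>

lemma inner_mean_L2: "inner (mean_L2 f) g = inner (mean_L2 f) (mean_L2 g)"
  by (simp add: mean_L2_def inner_const_L2 avg_const)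

definition prim :: "(real \<Rightarrow> complex) \<Rightarrow> real \<Rightarrow> complex" where
  "prim h x = (\<integral>y. h y \<partial>lebesgue_on {0..x})"

lemma antiderivative_eq: "antiderivative h x = prim h x - mean (prim h)"
  by (simp add: antiderivative_def prim_def[abs_def])

text \<open>Writing the primitive as an integral over one fixed measure space, with an indicator,
  gives access to linearity and to bounds uniform in x.\<close>

lemma prim_eq:
  assumes "x \<in> {0..2 * pi}"
  shows "prim h x = (\<integral>y. indicator {0..x} y *\<^sub>R h y \<partial>torus)"
proof -
  have "lebesgue_on {0..x} = restrict_space torus {0..x}"
    using assms by (subst restrict_restrict_space) (auto simp: Int_absorb1)
  then show ?thesis
    unfolding prim_def using assms
    by (simp add: integral_restrict_space[where M=torus] sets_restrict_space_iff)
qed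

lemma integrable_indicator_torus:
  fixes h :: "real \<Rightarrow> complex"
  assumes "integrable torus h" "x \<in> {0..2*pi}"
  shows "integrable torus (\<lambda>y. indicator {0..x} y *\<^sub>R h y)"
  by (rule integrable_mult_indicator) (use assms in \<open>auto simp: sets_restrict_space_iff\<close>)

lemma prim_cong_AE:
  assumes "AE x in torus. h x = g x" "h \<in> borel_measurable torus" "g \<in> borel_measurable torus" "x \<in> {0..2 * pi}"
  shows "prim h x = prim g x"
  unfolding prim_eq[OF assms(4)]
proof (rule integral_cong_AE)
  have "indicator {0..x} \<in> borel_measurable torus"
    using assms(4) by (intro borel_measurable_indicator) (auto simp: sets_restrict_space_iff)
  then show "(\<lambda>y. indicator {0..x} y *\<^sub>R h y) \<in> borel_measurable torus"
      "(\<lambda>y. indicator {0..x} y *\<^sub>R g y) \<in> borel_measurable torus"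
    using assms by (auto intro!: borel_measurable_scaleR)
  show "AE y in torus. indicator {0..x} y *\<^sub>R h y = indicator {0..x} y *\<^sub>R g y"
    using assms(1) by eventually_elim simp
qed

lemma continuous_prim:
  assumes "integrable torus h"
  shows "continuous_on {0..2 * pi} (prim h)"
  unfolding prim_def[abs_def] using assms by (rule indefinite_integral_continuous_real)

lemma norm_prim_le:
  assumes "integrable torus h" "x \<in> {0..2*pi}"
  shows "cmod (prim h x) \<le> (\<integral>y. cmod (h y) \<partial>torus)"
proof -
  have "cmod (prim h x) \<le> (\<integral>y. cmod (indicator {0..x} y *\<^sub>R h y) \<partial>torus)"
    unfolding prim_eq[OF assms(2)] by (rule integral_norm_bound)
  also have "\<dots> \<le> (\<integral>y. cmod (h y) \<partial>torus)"
    by (rule integral_mono)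
      (use integrable_norm[OF integrable_indicator_torus[OF assms]] assms in \<open>auto simp: indicator_def\<close>)
  finally show ?thesis .
qed

lemma sq_integrable_prim: "integrable torus h \<Longrightarrow> sq_integrable (prim h)"
  by (intro sq_integrable_continuous continuous_prim)

lemma sq_integrable_antiderivative: "integrable torus h \<Longrightarrow> sq_integrable (antiderivative h)"
  unfolding antiderivative_eq[abs_def]
  by (intro sq_integrable_diff sq_integrable_const sq_integrable_prim)

definition antideriv_L2 :: "L2 \<Rightarrow> L2" where
  "antideriv_L2 f = abs_L2 (antiderivative (rep_L2 f))"

lemma antideriv_L2_eq:
  "antideriv_L2 f = abs_L2 (prim (rep_L2 f)) - mean_L2 (abs_L2 (prim (rep_L2 f)))"
proof -
  have sq: "sq_integrable (prim (rep_L2 f))" by (intro sq_integrable_prim integrable_rep_L2)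
  have "avg (abs_L2 (prim (rep_L2 f))) = mean (prim (rep_L2 f))"
    unfolding avg_def mean_def
    using rep_L2_abs_L2[OF sq] sq by (intro arg_cong2[where f="(*)"] refl integral_cong_AE) auto
  then show ?thesis
    unfolding antideriv_L2_def antiderivative_eq[abs_def] mean_L2_def
    by (simp add: abs_L2_diff sq sq_integrable_const abs_L2_const)
qed

text \<open>Representatives of sums and multiples agree only almost everywhere, but the primitive
  does not see null sets and is therefore linear at every x. Boundedness comes from the uniform
  bound by the L^1 norm.\<close>

lemma bounded_linear_prim_L2: "bounded_linear (\<lambda>f. abs_L2 (prim (rep_L2 f)))"
proof (rule bounded_linear_intro[where K="2*pi"])
  fix f g :: L2 and r :: real
  have sq: "sq_integrable (prim (rep_L2 f))" for f
    by (intro sq_integrable_prim integrable_rep_L2)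
  show "abs_L2 (prim (rep_L2 (f + g))) = abs_L2 (prim (rep_L2 f)) + abs_L2 (prim (rep_L2 g))"
    unfolding abs_L2_add[OF sq sq, symmetric]
  proof (rule abs_L2_eqI[OF sq sq_integrable_add[OF sq sq]], rule AE_I2)
    fix x assume "x \<in> space torus"
    then have x: "x \<in> {0..2*pi}" by simp
    have "prim (rep_L2 (f + g)) x = prim (\<lambda>x. rep_L2 f x + rep_L2 g x) x"
      by (rule prim_cong_AE[OF rep_L2_add _ _ x]) auto
    also have "\<dots> = prim (rep_L2 f) x + prim (rep_L2 g) x"
      by (simp add: prim_eq[OF x] scaleR_add_right integrable_indicator_torus[OF integrable_rep_L2 x])
    finally show "prim (rep_L2 (f + g)) x = prim (rep_L2 f) x + prim (rep_L2 g) x" .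
  qed
  show "abs_L2 (prim (rep_L2 (r *\<^sub>R f))) = r *\<^sub>R abs_L2 (prim (rep_L2 f))"
    unfolding abs_L2_scaleR[OF sq, symmetric]
  proof (rule abs_L2_eqI[OF sq sq_integrable_scaleR[OF sq]], rule AE_I2)
    fix x assume "x \<in> space torus"
    then have x: "x \<in> {0..2*pi}" by simp
    have "prim (rep_L2 (r *\<^sub>R f)) x = prim (\<lambda>x. r *\<^sub>R rep_L2 f x) x"
      by (rule prim_cong_AE[OF rep_L2_scaleR _ _ x]) auto
    also have "\<dots> = r *\<^sub>R prim (rep_L2 f) x"
      by (simp only: prim_eq[OF x] scaleR_left_commute[of _ r] integral_scaleR_right)
    finally show "prim (rep_L2 (r *\<^sub>R f)) x = r *\<^sub>R prim (rep_L2 f) x" .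
  qed
  show "norm (abs_L2 (prim (rep_L2 f))) \<le> norm f * (2 * pi)"
  proof (rule norm_abs_L2_le[OF sq])
    show "AE x in torus. cmod (prim (rep_L2 f) x) \<le> norm f * (2 * pi)"
      using norm_prim_le[OF integrable_rep_L2, of _ f] integral_cmod_le_norm[of f]
      by (intro AE_I2) (fastforce simp: mult.commute intro: order_trans)
  qed simp
qed

lemma bounded_linear_antideriv_L2: "bounded_linear antideriv_L2"
  unfolding antideriv_L2_eq[abs_def]
  by (rule bounded_linear_sub[OF bounded_linear_prim_L2 bounded_linear_compose[OF bounded_linear_mean_L2 bounded_linear_prim_L2]])

lemma avg_harmonic: "avg (harmonic k c) = (if k = 0 then c else 0)"
proof -
  have "(\<integral>x. rep_L2 (harmonic k c) x \<partial>torus) = (\<integral>x. c * cis (of_int k * x) \<partial>torus)"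
    unfolding harmonic_def
    by (rule integral_cong_AE rep_L2_abs_L2 borel_measurable_sq_integrable borel_measurable_rep_L2 sq_integrable_cis)+
  also have "\<dots> = c * (\<integral>x. cis (of_int k * x) \<partial>torus)" by (rule integral_mult_right_zero)
  finally show ?thesis by (simp add: avg_eq integral_cis)
qed

text \<open>Integrating from 0 leaves the constant -c / (\<i> k) behind, and centring removes it
  because the mode itself has mean zero.\<close>

lemma antideriv_harmonic:
  assumes "k \<noteq> 0"
  shows "antideriv_L2 (harmonic k c) = harmonic k (c / (\<i> * of_int k))"
proof -
  let ?d = "c / (\<i> * of_int k)"
  have "prim (rep_L2 (harmonic k c)) x = ?d * cis (of_int k * x) - ?d" if x: "x \<in> {0..2*pi}" for x
  proof -
    have "prim (rep_L2 (harmonic k c)) x = prim (\<lambda>x. c * cis (of_int k * x)) x"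
      unfolding harmonic_def
      by (rule prim_cong_AE rep_L2_abs_L2 borel_measurable_sq_integrable borel_measurable_rep_L2 sq_integrable_cis x)+
    also have "\<dots> = integral {0..x} (\<lambda>x. c * cis (of_int k * x))"
    proof -
      have "integrable (lebesgue_on {0..x}) (\<lambda>x. c * cis (of_int k * x))"
        by (rule continuous_imp_integrable_real) (auto intro!: continuous_intros)
      then show ?thesis unfolding prim_def by (rule lebesgue_integral_eq_integral) auto
    qed
    also have "\<dots> = ?d * cis (of_int k * x) - ?d * cis (of_int k * 0)"
    proof (rule integral_unique, rule fundamental_theorem_of_calculus)
      fix y
      have "((\<lambda>x. ?d * cis (of_int k * x)) has_vector_derivative (\<i> * of_real (of_int k) * ?d * cis (of_int k * y))) (at y within {0..x})"
        by (rule has_vector_derivative_at_within[OF has_vector_derivative_cis])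
      then show "((\<lambda>x. ?d * cis (of_int k * x)) has_vector_derivative (c * cis (of_int k * y))) (at y within {0..x})"
        using assms by simp
    qed (use x in auto)
    finally show ?thesis by simp
  qed
  then have "abs_L2 (prim (rep_L2 (harmonic k c))) = abs_L2 (\<lambda>x. ?d * cis (of_int k * x) - ?d)"
    by (intro abs_L2_eqI sq_integrable_prim integrable_rep_L2 sq_integrable_diff sq_integrable_cis sq_integrable_const AE_I2) auto
  also have "\<dots> = harmonic k ?d - const_L2 ?d"
    unfolding harmonic_def abs_L2_const[symmetric] by (rule abs_L2_diff[OF sq_integrable_cis sq_integrable_const])
  finally show ?thesis
    using assms bounded_linear.linear[OF bounded_linear_mean_L2]
      linear_0[OF bounded_linear.linear[OF bounded_linear_const_L2]]
    by (simp add: antideriv_L2_eq linear_diff) (simp add: mean_L2_def avg_const avg_harmonic)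
qed

section \<open>The centred antiderivative and Wirtinger's inequality\<close>

text \<open>The antiderivative of a constant is a sawtooth, which destroys both skewness and the
  norm bound. Projecting away the mean of the argument first gives an operator with both properties
  on all of \<open>L2\<close>, so that density arguments apply without a side condition.\<close>

definition antideriv0 :: "L2 \<Rightarrow> L2" where
  "antideriv0 f = antideriv_L2 (f - mean_L2 f)"

lemma bounded_linear_antideriv0: "bounded_linear antideriv0"
  unfolding antideriv0_def[abs_def]
  by (rule bounded_linear_compose[OF bounded_linear_antideriv_L2 bounded_linear_sub[OF bounded_linear_ident bounded_linear_mean_L2]])

lemma antideriv0_harmonic:
  "antideriv0 (harmonic k c) = (if k = 0 then 0 else harmonic k (c / (\<i> * of_int k)))"
proof (cases "k = 0")
  case True
  then show ?thesis
    using linear_0[OF bounded_linear.linear[OF bounded_linear_antideriv_L2]]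
    by (simp add: antideriv0_def mean_L2_def avg_harmonic harmonic_0 avg_const)
next
  case False
  then show ?thesis
    using linear_0[OF bounded_linear.linear[OF bounded_linear_const_L2]]
    by (simp add: antideriv0_def mean_L2_def avg_harmonic antideriv_harmonic)
qed

lemma trig_L2_closed_induct:
  assumes "closed {f. P f}" "\<And>f. f \<in> trig_L2 \<Longrightarrow> P f"
  shows "P f"
proof -
  have "closure trig_L2 \<subseteq> {f. P f}" by (rule closure_minimal) (use assms in auto)
  then show ?thesis by (auto simp: closure_trig_L2)
qed

text \<open>Bilinear identities are reduced to modes by using this once in each argument.\<close>

lemma bounded_linear_eq_0_if_harmonic:
  fixes T :: "L2 \<Rightarrow> real"
  assumes "bounded_linear T" "\<And>k c. T (harmonic k c) = 0"
  shows "T f = 0"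
proof (rule trig_L2_closed_induct)
  show "closed {f. T f = 0}"
    by (intro closed_Collect_eq linear_continuous_on assms continuous_on_const)
  show "T f = 0" if "f \<in> trig_L2" for f
    using that unfolding trig_L2_def
  proof (induction rule: span_induct_alt)
    case base
    then show ?case by (rule linear_0[OF bounded_linear.linear[OF assms(1)]])
  next
    case (step r x y)
    then show ?case using assms bounded_linear.linear[OF assms(1)] by (auto simp: linear_add linear_scale)
  qed
qed

text \<open>Wirtinger's inequality with constant 1: every coefficient of nonzero frequency is
  divided by \<i> k with |k| \<ge> 1, and the inequality defines a closed set.\<close>

lemma norm_antideriv0_le: "norm (antideriv0 f) \<le> norm f"
proof (rule trig_L2_closed_induct)
  show "closed {f. norm (antideriv0 f) \<le> norm f}"
    by (intro closed_Collect_le continuous_on_norm linear_continuous_on bounded_linear_antideriv0 continuous_on_id)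
  fix f assume "f \<in> trig_L2"
  then obtain K c where K: "finite K" and f: "f = (\<Sum>k\<in>K. harmonic k (c k))"
    by (rule trig_L2_sum)
  define d where "d k = (if k = 0 then 0 else c k / (\<i> * of_int k))" for k
  have Pyth: "(norm (\<Sum>k\<in>K. harmonic k (c k)))\<^sup>2 = (\<Sum>k\<in>K. (cmod (c k))\<^sup>2)" for c
    by (subst norm_sum_Pythagorean[OF K])
      (simp_all add: pairwise_def orthogonal_def inner_harmonic norm_harmonic)
  have "antideriv0 f = (\<Sum>k\<in>K. antideriv0 (harmonic k (c k)))"
    unfolding f by (rule linear_sum[OF bounded_linear.linear[OF bounded_linear_antideriv0]])
  also have "\<dots> = (\<Sum>k\<in>K. harmonic k (d k))"
    by (intro sum.cong refl) (simp add: antideriv0_harmonic d_def harmonic_zero)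
  finally have "(norm (antideriv0 f))\<^sup>2 = (\<Sum>k\<in>K. (cmod (d k))\<^sup>2)" by (simp add: Pyth)
  also have "\<dots> \<le> (\<Sum>k\<in>K. (cmod (c k))\<^sup>2)"
  proof (intro sum_mono power_mono norm_ge_zero)
    fix k :: int
    have "1 \<le> \<bar>real_of_int k\<bar>" if "k \<noteq> 0" using that by linarith
    then show "cmod (d k) \<le> cmod (c k)"
      by (auto simp: d_def norm_divide norm_mult divide_le_eq mult_le_cancel_left1 intro: mult_right_le_one_le)
  qed
  also have "\<dots> = (norm f)\<^sup>2" by (simp add: f Pyth)
  finally show "norm (antideriv0 f) \<le> norm f" by (rule power2_le_imp_le) simp
qed

text \<open>On a mode the operator is multiplication by 1 / (\<i> k), which is purely imaginary and
  changes sign when moved across the inner product; different frequencies are orthogonal.\<close>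

lemma antideriv0_skew: "inner (antideriv0 f) g = - inner f (antideriv0 g)"
proof -
  have bl: "bounded_linear (\<lambda>f. inner (antideriv0 f) g + inner f (antideriv0 g))"
    "bounded_linear (\<lambda>g. inner (antideriv0 f) g + inner f (antideriv0 g))" for f g
  proof -
    have "bounded_linear (\<lambda>f. inner (antideriv0 f) g)" "bounded_linear (\<lambda>g. inner f (antideriv0 g))"
      by (rule bounded_linear_compose[OF bounded_linear_inner_left bounded_linear_antideriv0]
        bounded_linear_compose[OF bounded_linear_inner_right bounded_linear_antideriv0])+
    from bounded_linear_add[OF this(1) bounded_linear_inner_left]
      bounded_linear_add[OF bounded_linear_inner_right this(2)]
    show "bounded_linear (\<lambda>f. inner (antideriv0 f) g + inner f (antideriv0 g))"
      "bounded_linear (\<lambda>g. inner (antideriv0 f) g + inner f (antideriv0 g))" .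
  qed
  have "inner (antideriv0 f) g + inner f (antideriv0 g) = 0"
  proof (rule bounded_linear_eq_0_if_harmonic[OF bl(1)])
    fix k c
    show "inner (antideriv0 (harmonic k c)) g + inner (harmonic k c) (antideriv0 g) = 0"
    proof (rule bounded_linear_eq_0_if_harmonic[OF bl(2)])
      fix l d
      show "inner (antideriv0 (harmonic k c)) (harmonic l d) + inner (harmonic k c) (antideriv0 (harmonic l d)) = 0"
        by (simp add: antideriv0_harmonic inner_harmonic) 
    qed
  qed
  then show ?thesis by simp
qed

section \<open>Trigonometric test functions and weak derivatives\<close>

lemma deriv_cos_sin:
  "deriv (\<lambda>x::real. a * cos (k * x) + b * sin (k * x)) = (\<lambda>x. (k * b) * cos (k * x) + (- k * a) * sin (k * x))"
  by (rule ext, rule DERIV_imp_deriv) (auto intro!: derivative_eq_intros)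

text \<open>Combinations of cosine and sine of one frequency are closed under \<open>deriv\<close>;
  letting the coefficients vary makes the induction over iterated derivatives go through.\<close>

lemma smooth_periodic_cos_sin:
  "smooth_periodic (\<lambda>x. a * cos (of_int k * x) + b * sin (of_int k * x))"
proof -
  have "\<exists>a' b'. (deriv ^^ n) (\<lambda>x::real. a * cos (of_int k * x) + b * sin (of_int k * x))
      = (\<lambda>x. a' * cos (of_int k * x) + b' * sin (of_int k * x))" for n a b
  proof (induction n arbitrary: a b)
    case (Suc n)
    show ?case unfolding funpow_Suc_right o_apply deriv_cos_sin by (rule Suc)
  qed auto
  moreover have "(\<lambda>x::real. a * cos (of_int k * x) + b * sin (of_int k * x)) differentiable (at x)" for a b x
    unfolding real_differentiable_def by (rule exI) (auto intro!: derivative_eq_intros)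
  ultimately have "\<forall>n x. (deriv ^^ n) (\<lambda>x::real. a * cos (of_int k * x) + b * sin (of_int k * x)) differentiable (at x)"
    by metis
  moreover have "cos (of_int k * (x + 2 * pi)) = cos (of_int k * x)" "sin (of_int k * (x + 2 * pi)) = sin (of_int k * x)" for x :: real
    using cos_int_2pin[of k] sin_int_2pin[of k] by (simp_all add: distrib_left cos_add sin_add mult.commute mult.left_commute)
  ultimately show ?thesis by (simp add: smooth_periodic_def)
qed


lemma smooth_periodic_has_derivative:
  assumes "smooth_periodic \<phi>"
  shows "(\<phi> has_real_derivative deriv \<phi> x) (at x)"
proof -
  have "(deriv ^^ 0) \<phi> differentiable (at x)" using assms unfolding smooth_periodic_def by blast
  then show ?thesis by (simp add: DERIV_deriv_iff_real_differentiable)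
qed

lemma smooth_periodic_continuous:
  assumes "smooth_periodic \<phi>"
  shows "continuous_on A \<phi>" "continuous_on A (deriv \<phi>)"
proof -
  have "(deriv ^^ Suc 0) \<phi> differentiable (at x)" for x
    using assms unfolding smooth_periodic_def by blast
  then have "deriv \<phi> differentiable (at x)" for x by simp
  then show "continuous_on A (deriv \<phi>)"
    by (intro continuous_at_imp_continuous_on ballI differentiable_imp_continuous_within)
  show "continuous_on A \<phi>"
    by (intro continuous_at_imp_continuous_on ballI) (rule DERIV_isCont[OF smooth_periodic_has_derivative[OF assms]])
qed

lemma sq_integrable_of_real_continuous:
  "continuous_on {0..2*pi} \<phi> \<Longrightarrow> sq_integrable (\<lambda>x. complex_of_real (\<phi> x))"
  by (intro sq_integrable_continuous continuous_intros)

lemma integrable_rep_L2_continuous: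
  assumes "continuous_on {0..2*pi} \<phi>"
  shows "integrable torus (\<lambda>x. rep_L2 f x * complex_of_real (\<phi> x))"
  using sq_integrable_mult[OF sq_integrable_rep_L2 sq_integrable_of_real_continuous[OF assms]] by simp

lemma has_weak_derivative_zero: "has_weak_derivative 0 0"
proof -
  have "(\<integral>x. rep_L2 0 x * of_real (\<phi> x) \<partial>torus) = (\<integral>x. 0 \<partial>torus)" if "continuous_on {0..2*pi} \<phi>" for \<phi> :: "real \<Rightarrow> real"
  proof (rule integral_cong_AE)
    have "AE x in torus. rep_L2 0 x = 0"
      using rep_L2_abs_L2[OF sq_integrable_zero] by (simp add: zero_L2_def)
    then show "AE x in torus. rep_L2 0 x * of_real (\<phi> x) = 0" by eventually_elim simp
  qed (use borel_measurable_integrable[OF integrable_rep_L2_continuous[OF that]] in auto)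
  then show ?thesis
    by (simp add: has_weak_derivative_def smooth_periodic_continuous)
qed

lemma has_weak_derivative_add_scaleR:
  assumes "has_weak_derivative f f'" "has_weak_derivative g g'"
  shows "has_weak_derivative (r *\<^sub>R f + g) (r *\<^sub>R f' + g')"
proof -
  have "(\<integral>x. rep_L2 (r *\<^sub>R f + g) x * of_real (\<phi> x) \<partial>torus)
      = of_real r * (\<integral>x. rep_L2 f x * of_real (\<phi> x) \<partial>torus) + (\<integral>x. rep_L2 g x * of_real (\<phi> x) \<partial>torus)"
    if "continuous_on {0..2*pi} \<phi>" for \<phi> :: "real \<Rightarrow> real" and f g
  proof -
    have "(\<integral>x. rep_L2 (r *\<^sub>R f + g) x * of_real (\<phi> x) \<partial>torus)
      = (\<integral>x. r *\<^sub>R (rep_L2 f x * of_real (\<phi> x)) + rep_L2 g x * of_real (\<phi> x) \<partial>torus)"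
    proof (rule integral_cong_AE)
      show "AE x in torus. rep_L2 (r *\<^sub>R f + g) x * of_real (\<phi> x) = r *\<^sub>R (rep_L2 f x * of_real (\<phi> x)) + rep_L2 g x * of_real (\<phi> x)"
        using rep_L2_add[of "r *\<^sub>R f" g] rep_L2_scaleR[of r f]
        by eventually_elim (simp add: algebra_simps)
    qed (use borel_measurable_integrable[OF integrable_rep_L2_continuous[OF that]] in auto)
    also have "\<dots> = r *\<^sub>R (\<integral>x. rep_L2 f x * of_real (\<phi> x) \<partial>torus) + (\<integral>x. rep_L2 g x * of_real (\<phi> x) \<partial>torus)"
      by (subst Bochner_Integration.integral_add)
        (simp_all only: integrable_scaleR_right integrable_rep_L2_continuous[OF that] integral_scaleR_right)
    finally show ?thesis by (simp add: scaleR_conv_of_real)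
  qed
  with assms show ?thesis
    by (simp add: has_weak_derivative_def smooth_periodic_continuous)
qed

lemma has_weak_derivative_diff:
  "has_weak_derivative f f' \<Longrightarrow> has_weak_derivative g g' \<Longrightarrow> has_weak_derivative (f - g) (f' - g')"
  using has_weak_derivative_add_scaleR[of g g' f f' "-1"] by simp

text \<open>The derivative of F \<phi> is integrated over one period, and the boundary terms cancel
  by periodicity of both factors.\<close>

lemma has_weak_derivative_classical:
  assumes F: "\<And>x. (F has_vector_derivative F' x) (at x)" and F': "continuous_on {0..2*pi} F'"
    and per: "F 0 = F (2 * pi)"
  shows "has_weak_derivative (abs_L2 F) (abs_L2 F')"
  unfolding has_weak_derivative_def
proof (intro allI impI)
  fix \<phi> assume \<phi>: "smooth_periodic \<phi>"
  have F_cont: "continuous_on A F" for A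
    by (intro continuous_at_imp_continuous_on ballI) (rule has_vector_derivative_continuous[OF F])
  note cont = smooth_periodic_continuous[OF \<phi>]
  note sq = sq_integrable_continuous[OF F_cont] sq_integrable_continuous[OF F']
  have rep: "(\<integral>x. rep_L2 (abs_L2 G) x * of_real (\<psi> x) \<partial>torus) = (\<integral>x. G x * of_real (\<psi> x) \<partial>torus)"
    "integrable torus (\<lambda>x. G x * of_real (\<psi> x))"
    if "sq_integrable G" "continuous_on {0..2*pi} \<psi>" for G and \<psi> :: "real \<Rightarrow> real"
  proof -
    show int: "integrable torus (\<lambda>x. G x * of_real (\<psi> x))"
      using sq_integrable_mult[OF that(1) sq_integrable_of_real_continuous[OF that(2)]] by simp
    show "(\<integral>x. rep_L2 (abs_L2 G) x * of_real (\<psi> x) \<partial>torus) = (\<integral>x. G x * of_real (\<psi> x) \<partial>torus)"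
      by (rule integral_cong_AE)
        (use rep_L2_abs_L2[OF that(1)] borel_measurable_integrable[OF int]
          borel_measurable_integrable[OF integrable_rep_L2_continuous[OF that(2)]] in auto)
  qed
  have "(\<integral>x. F x * of_real (deriv \<phi> x) + F' x * of_real (\<phi> x) \<partial>torus)
      = F (2 * pi) * of_real (\<phi> (2 * pi)) - F 0 * of_real (\<phi> 0)"
  proof (rule integral_torus_derivative)
    fix x
    have "((\<lambda>x. complex_of_real (\<phi> x)) has_vector_derivative of_real (deriv \<phi> x)) (at x)"
      using smooth_periodic_has_derivative[OF \<phi>, of x]
      by (intro has_vector_derivative_of_real) (simp add: has_real_derivative_iff_has_vector_derivative)
    from has_vector_derivative_mult[OF F this]
    show "((\<lambda>x. F x * of_real (\<phi> x)) has_vector_derivative F x * of_real (deriv \<phi> x) + F' x * of_real (\<phi> x)) (at x)" .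
  qed (intro continuous_intros F_cont F' cont)
  also have "\<dots> = 0"
    using \<phi> per unfolding smooth_periodic_def by (metis add_0 diff_self)
  finally show "(\<integral>x. rep_L2 (abs_L2 F) x * of_real (deriv \<phi> x) \<partial>torus) = - (\<integral>x. rep_L2 (abs_L2 F') x * of_real (\<phi> x) \<partial>torus)"
    by (simp add: rep sq cont eq_neg_iff_add_eq_0)
qed

lemma has_weak_derivative_harmonic: "has_weak_derivative (harmonic k c) (harmonic k (\<i> * of_int k * c))"
proof -
  have "has_weak_derivative (harmonic k c) (abs_L2 (\<lambda>x. \<i> * of_real (of_int k) * c * cis (of_int k * x)))"
    unfolding harmonic_def
  proof (rule has_weak_derivative_classical)
    show "c * cis (real_of_int k * 0) = c * cis (real_of_int k * (2 * pi))"
      using cis_multiple_2pi[of "of_int k"] by (simp add: mult.commute)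
  qed (rule has_vector_derivative_cis, intro continuous_intros)
  then show ?thesis by (simp add: harmonic_def)
qed

lemma trig_L2_weak_derivative:
  assumes "f \<in> trig_L2"
  shows "\<exists>f'. has_weak_derivative f f'"
  using assms unfolding trig_L2_def
proof (induction rule: span_induct_alt)
  case base
  show ?case using has_weak_derivative_zero by blast
next
  case (step r x y)
  then show ?case using has_weak_derivative_add_scaleR has_weak_derivative_harmonic by blast
qed

text \<open>Test functions are real-valued, so the complex exponential is assembled from a cosine
  test and a sine test.\<close>

lemma has_weak_derivative_cis:
  assumes "has_weak_derivative f g"
  shows "(\<integral>x. rep_L2 f x * (\<i> * of_int k * cis (of_int k * x)) \<partial>torus) = - (\<integral>x. rep_L2 g x * cis (of_int k * x) \<partial>torus)"
proof -
  define \<phi> where "\<phi> x = cos (of_int k * x)" for x :: real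
  define \<psi> where "\<psi> x = sin (of_int k * x)" for x :: real
  have sm: "smooth_periodic \<phi>" "smooth_periodic \<psi>"
    using smooth_periodic_cos_sin[of 1 k 0] smooth_periodic_cos_sin[of 0 k 1]
    by (simp_all add: \<phi>_def[abs_def] \<psi>_def[abs_def])
  have d: "deriv \<phi> x = - of_int k * sin (of_int k * x)" "deriv \<psi> x = of_int k * cos (of_int k * x)" for x
    using deriv_cos_sin[of 1 "of_int k" 0] deriv_cos_sin[of 0 "of_int k" 1]
    by (simp_all add: \<phi>_def[abs_def] \<psi>_def[abs_def] fun_eq_iff)
  note int = integrable_rep_L2_continuous[OF smooth_periodic_continuous(1)] integrable_rep_L2_continuous[OF smooth_periodic_continuous(2)]
  have split: "(\<integral>x. rep_L2 h x * of_real (p x) \<partial>torus) + \<i> * (\<integral>x. rep_L2 h x * of_real (q x) \<partial>torus)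
      = (\<integral>x. rep_L2 h x * (of_real (p x) + \<i> * of_real (q x)) \<partial>torus)"
    if "integrable torus (\<lambda>x. rep_L2 h x * of_real (p x))" "integrable torus (\<lambda>x. rep_L2 h x * of_real (q x))" for h and p q :: "real \<Rightarrow> real"
    using that by (simp add: distrib_left mult.left_commute[of _ \<i>])
  have "(\<integral>x. rep_L2 f x * (\<i> * of_int k * cis (of_int k * x)) \<partial>torus)
      = (\<integral>x. rep_L2 f x * (of_real (deriv \<phi> x) + \<i> * of_real (deriv \<psi> x)) \<partial>torus)"
    by (intro Bochner_Integration.integral_cong refl) (simp add: d complex_eq_iff)
  also have "\<dots> = - ((\<integral>x. rep_L2 g x * of_real (\<phi> x) \<partial>torus) + \<i> * (\<integral>x. rep_L2 g x * of_real (\<psi> x) \<partial>torus))"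
    using assms sm by (simp add: split[symmetric] int has_weak_derivative_def)
  also have "\<dots> = - (\<integral>x. rep_L2 g x * (of_real (\<phi> x) + \<i> * of_real (\<psi> x)) \<partial>torus)"
    by (simp add: split int sm)
  also have "\<dots> = - (\<integral>x. rep_L2 g x * cis (of_int k * x) \<partial>torus)"
    by (intro arg_cong[where f=uminus] Bochner_Integration.integral_cong refl) (simp add: \<phi>_def \<psi>_def complex_eq_iff)
  finally show ?thesis .
qed

lemma inner_rep_harmonic:
  "inner f (harmonic k c) = 1 / (2 * pi) * Re (cnj c * (\<integral>x. rep_L2 f x * cis (of_int (- k) * x) \<partial>torus))"
proof -
  have "inner f (harmonic k c) = 1 / (2 * pi) * Re (\<integral>x. rep_L2 f x * cnj (c * cis (of_int k * x)) \<partial>torus)"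
    using inner_abs_L2[OF sq_integrable_rep_L2 sq_integrable_cis, of f c k]
    by (simp add: harmonic_def abs_L2_rep_L2)
  also have "(\<integral>x. rep_L2 f x * cnj (c * cis (of_int k * x)) \<partial>torus) = (\<integral>x. cnj c * (rep_L2 f x * cis (of_int (- k) * x)) \<partial>torus)"
    by (intro Bochner_Integration.integral_cong refl) (simp add: cis_cnj mult.left_commute)
  also have "\<dots> = cnj c * (\<integral>x. rep_L2 f x * cis (of_int (- k) * x) \<partial>torus)"
    by (rule integral_mult_right_zero)
  finally show ?thesis .
qed

lemma inner_weak_derivative_harmonic:
  assumes "has_weak_derivative f g"
  shows "inner g (harmonic k c) = - inner f (harmonic k (\<i> * of_int k * c))"
proof -
  have "(\<integral>x. rep_L2 f x * (\<i> * of_int (- k) * cis (of_int (- k) * x)) \<partial>torus)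
      = (\<integral>x. (\<i> * of_int (- k)) * (rep_L2 f x * cis (of_int (- k) * x)) \<partial>torus)"
    by (intro Bochner_Integration.integral_cong refl) (simp add: mult.left_commute)
  also have "\<dots> = (\<i> * of_int (- k)) * (\<integral>x. rep_L2 f x * cis (of_int (- k) * x) \<partial>torus)"
    by (rule integral_mult_right_zero)
  finally have "(\<integral>x. rep_L2 g x * cis (of_int (- k) * x) \<partial>torus) = (\<i> * of_int k) * (\<integral>x. rep_L2 f x * cis (of_int (- k) * x) \<partial>torus)"
    using has_weak_derivative_cis[OF assms, of "-k"] by simp
  then show ?thesis
    by (simp only: inner_rep_harmonic) (simp add: algebra_simps)
qed

lemma weak_derivative_mean:
  assumes "has_weak_derivative f g"
  shows "mean_L2 g = 0"
proof -
  have "(\<integral>x. rep_L2 g x \<partial>torus) = 0"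
    using has_weak_derivative_cis[OF assms, of 0] by simp
  then show ?thesis
    using linear_0[OF bounded_linear.linear[OF bounded_linear_const_L2]] by (simp add: mean_L2_def avg_eq)
qed

text \<open>The fundamental theorem of calculus, read off from Fourier coefficients: the difference
  of the two sides is orthogonal to the constants by centring and to the other modes by skewness and
  the weak derivative relation. By density it vanishes. No continuous representative of f is
  constructed.\<close>

lemma weak_derivative_antideriv0:
  assumes "has_weak_derivative f g"
  shows "f = mean_L2 f + antideriv0 g"
proof -
  define h where "h = f - mean_L2 f - antideriv0 g"
  have "inner h (harmonic k c) = 0" for k c
  proof (cases "k = 0")
    case True
    have "inner f (harmonic 0 c) = inner (mean_L2 f) (harmonic 0 c)"
      by (simp add: harmonic_0 mean_L2_def inner_const_L2 inner_commute[of f] avg_const)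
    moreover have "inner (antideriv0 g) (harmonic 0 c) = 0"
      by (simp add: antideriv0_skew antideriv0_harmonic)
    ultimately show ?thesis using True by (simp add: h_def inner_diff_left)
  next
    case False
    have "inner (antideriv0 g) (harmonic k c) = - inner g (harmonic k (c / (\<i> * of_int k)))"
      using False by (simp add: antideriv0_skew antideriv0_harmonic)
    also have "\<dots> = inner f (harmonic k c)"
      using False by (simp add: inner_weak_derivative_harmonic[OF assms])
    finally show ?thesis
      using False by (simp add: h_def inner_diff_left mean_L2_def inner_const_L2 avg_harmonic)
  qed
  from bounded_linear_eq_0_if_harmonic[OF bounded_linear_inner_right this]
  have "inner h h = 0" .
  then have "f - mean_L2 f = antideriv0 g" by (simp add: h_def)
  then show ?thesis by (simp add: diff_eq_eq add.commute)
qed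

section \<open>Decay of the energy along strict solutions\<close>

text \<open>If f(T) > f(0), take a line through (0, f(0)) of small positive slope that f(T) still
  exceeds. At the last time s where f is not above the line, the right derivative of f minus the
  line is negative, so f stays below it a little longer, contradicting the choice of s.\<close>

lemma right_derivative_nonincreasing:
  fixes f :: "real \<Rightarrow> real"
  assumes cont: "continuous_on {0..} f"
    and der: "\<And>t. t \<ge> 0 \<Longrightarrow> (f has_real_derivative f' t) (at t within {t..})"
    and le: "\<And>t. t \<ge> 0 \<Longrightarrow> f' t \<le> 0"
    and T: "T \<ge> 0"
  shows "f T \<le> f 0"
proof (rule ccontr)
  assume "\<not> f T \<le> f 0"
  then have "T > 0" "f T > f 0" using T by (cases "T = 0"; force)+
  \<comment> \<open>Half of the mean slope of f on [0, T].\<close>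
  define e where "e = (f T - f 0) / (2 * T)"
  have e: "e > 0" "f T - f 0 = 2 * e * T"
    using \<open>T > 0\<close> \<open>f T > f 0\<close> by (simp_all add: e_def)
  define g where "g t = f t - f 0 - e * t" for t
  have gT: "g T > 0" using e \<open>T > 0\<close> by (simp add: g_def)
  have gcont: "continuous_on {0..T} g"
    unfolding g_def by (intro continuous_intros continuous_on_subset[OF cont]) auto
  define A where "A = {t \<in> {0..T}. g t \<le> 0}"
  have "compact A"
    unfolding A_def compact_eq_bounded_closed
    using continuous_closed_preimage[OF gcont, of "{..0}"]
    by (auto simp: vimage_def Int_def intro: bounded_subset[of "{0..T}"])
  moreover have "0 \<in> A" using T by (simp add: A_def g_def)
  ultimately obtain s where s: "s \<in> A" "\<And>t. t \<in> A \<Longrightarrow> t \<le> s"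
    using compact_attains_sup[of A] by blast
  then have "0 \<le> s" "s < T" "g s \<le> 0" using gT by (auto simp: A_def less_le)
  have "(g has_real_derivative (f' s - e)) (at s within {s..})"
    unfolding g_def using der[OF \<open>0 \<le> s\<close>] by (auto intro!: derivative_eq_intros)
  moreover have "f' s - e < 0" using le[OF \<open>0 \<le> s\<close>] e by simp
  ultimately obtain d where d: "d > 0" "\<And>h. h > 0 \<Longrightarrow> s + h \<in> {s..} \<Longrightarrow> h < d \<Longrightarrow> g (s + h) < g s"
    using has_real_derivative_neg_dec_right by metis
  define h where "h = min (d / 2) (T - s)"
  have h: "h > 0" "h < d" "s + h \<le> T" using d \<open>s < T\<close> by (auto simp: h_def min_def)
  then have "s + h \<in> A" using d(2)[of h] \<open>g s \<le> 0\<close> \<open>0 \<le> s\<close> by (auto simp: A_def)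
  then show False using s(2)[of "s + h"] h by simp
qed

lemma right_derivative_exp_decay:
  fixes f :: "real \<Rightarrow> real"
  assumes cont: "continuous_on {0..} f"
    and der: "\<And>t. t \<ge> 0 \<Longrightarrow> (f has_real_derivative f' t) (at t within {t..})"
    and le: "\<And>t. t \<ge> 0 \<Longrightarrow> f' t \<le> - \<alpha> * f t"
    and t: "t \<ge> 0"
  shows "f t \<le> f 0 * exp (- \<alpha> * t)"
proof -
  have "f t * exp (\<alpha> * t) \<le> f 0 * exp (\<alpha> * 0)"
  proof (rule right_derivative_nonincreasing[where f = "\<lambda>t. f t * exp (\<alpha> * t)"])
    show "continuous_on {0..} (\<lambda>t. f t * exp (\<alpha> * t))" by (intro continuous_intros cont)
    fix t :: real assume t: "t \<ge> 0"
    show "((\<lambda>t. f t * exp (\<alpha> * t)) has_real_derivative (f' t + \<alpha> * f t) * exp (\<alpha> * t)) (at t within {t..})"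
      by (rule derivative_eq_intros der[OF t] refl)+ (simp add: algebra_simps)
    show "(f' t + \<alpha> * f t) * exp (\<alpha> * t) \<le> 0"
      using le[OF t] by (intro mult_nonpos_nonneg) auto
  qed (rule t)
  then show ?thesis by (simp add: exp_minus field_simps)
qed

section \<open>Multiplication by a bounded coefficient\<close>

lemma Linfty_bound:
  assumes "\<sigma> \<in> Linfty"
  obtains K where "AE x in torus. \<bar>\<sigma> x\<bar> \<le> K"
proof -
  let ?e = "esssup torus (\<lambda>x. ereal \<bar>\<sigma> x\<bar>)"
  have "AE x in torus. ereal \<bar>\<sigma> x\<bar> \<le> ?e" by (rule esssup_AE)
  moreover have "?e < \<infinity>" using assms by (simp add: Linfty_def)
  ultimately have "AE x in torus. \<bar>\<sigma> x\<bar> \<le> real_of_ereal ?e"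
    by (elim eventually_mono) (cases ?e; auto)
  then show ?thesis by (rule that)
qed

lemma sq_integrable_multiply:
  assumes "\<sigma> \<in> Linfty"
  shows "sq_integrable (\<lambda>x. of_real (\<sigma> x) * rep_L2 f x)"
proof -
  obtain K where K: "AE x in torus. \<bar>\<sigma> x\<bar> \<le> K" using Linfty_bound[OF assms] .
  show ?thesis
  proof (rule sq_integrable_dominated[OF _ sq_integrable_rep_L2])
    have "\<sigma> \<in> borel_measurable torus" using assms by (simp add: Linfty_def)
    then show "(\<lambda>x. of_real (\<sigma> x) * rep_L2 f x) \<in> borel_measurable torus"
      by (intro borel_measurable_times borel_measurable_of_real) auto
    show "AE x in torus. cmod (of_real (\<sigma> x) * rep_L2 f x) \<le> K * cmod (rep_L2 f x)"
      using K by eventually_elim (simp add: norm_mult mult_right_mono)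
  qed
qed

lemma rep_L2_multiply:
  assumes "\<sigma> \<in> Linfty"
  shows "AE x in torus. rep_L2 (multiply \<sigma> f) x = of_real (\<sigma> x) * rep_L2 f x"
  unfolding multiply_def by (rule rep_L2_abs_L2[OF sq_integrable_multiply[OF assms]])

lemma multiply_add_scaleR:
  assumes "\<sigma> \<in> Linfty"
  shows "multiply \<sigma> (r *\<^sub>R f + g) = r *\<^sub>R multiply \<sigma> f + multiply \<sigma> g"
proof (rule L2_eqI)
  show "AE x in torus. rep_L2 (multiply \<sigma> (r *\<^sub>R f + g)) x = rep_L2 (r *\<^sub>R multiply \<sigma> f + multiply \<sigma> g) x"
    using rep_L2_multiply[OF assms, of "r *\<^sub>R f + g"] rep_L2_multiply[OF assms, of f] rep_L2_multiply[OF assms, of g]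
      rep_L2_add[of "r *\<^sub>R f" g] rep_L2_scaleR[of r f]
      rep_L2_add[of "r *\<^sub>R multiply \<sigma> f" "multiply \<sigma> g"] rep_L2_scaleR[of r "multiply \<sigma> f"]
    by eventually_elim (simp add: algebra_simps)
qed

lemma multiply_const:
  assumes "\<sigma> \<in> Linfty" "AE x in torus. \<sigma> x = s"
  shows "multiply \<sigma> f = s *\<^sub>R f"
proof (rule L2_eqI)
  show "AE x in torus. rep_L2 (multiply \<sigma> f) x = rep_L2 (s *\<^sub>R f) x"
    using rep_L2_multiply[OF assms(1), of f] assms(2) rep_L2_scaleR[of s f]
    by eventually_elim (simp add: scaleR_conv_of_real)
qed

section \<open>The pointwise quadratic form\<close>

lemma integrable_Re_rep_L2: "integrable torus (\<lambda>x. Re (rep_L2 f x * cnj (rep_L2 g x)))"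
  by (rule integrable_Re[OF integrable_rep_L2_mult])

lemma inner_L2_Re: "inner f g = 1 / (2 * pi) * (\<integral>x. Re (rep_L2 f x * cnj (rep_L2 g x)) \<partial>torus)"
  unfolding inner_L2.rep_eq by (subst integral_Re[OF integrable_rep_L2_mult]) simp

text \<open>
  The second conjunct is the discriminant condition for the quadratic form
  \<open>(2 s - \<theta> - \<alpha>) |v|\<^sup>2 + (\<theta> - \<alpha>) |w|\<^sup>2 - \<theta> (s - \<alpha>) |v| |w|\<close>.
\<close>

definition rate_condition :: "real \<Rightarrow> real \<Rightarrow> real \<Rightarrow> bool" where
  "rate_condition \<theta> \<alpha> s \<longleftrightarrow>
     \<theta> + \<alpha> \<le> 2 * s \<and> (\<theta> * (s - \<alpha>))\<^sup>2 \<le> 4 * (\<theta> - \<alpha>) * (2 * s - \<theta> - \<alpha>)"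

text \<open>The discriminant condition gives |C| \<le> 2 sqrt A sqrt B for the mixed coefficient C,
  and the inequality between arithmetic and geometric means absorbs the mixed term. Complex values
  cost nothing, since |Re (w cnj v)| \<le> |w| |v|.\<close>

lemma rate_condition_pointwise:
  assumes "rate_condition \<theta> \<alpha> s" "\<alpha> \<le> \<theta>"
  shows "0 \<le> (2 * s - \<theta> - \<alpha>) * (cmod v)\<^sup>2 + (\<theta> - \<alpha>) * (cmod w)\<^sup>2 - \<theta> * (s - \<alpha>) * Re (w * cnj v)"
proof -
  define A where "A = 2 * s - \<theta> - \<alpha>"
  define B where "B = \<theta> - \<alpha>"
  define C where "C = \<theta> * (s - \<alpha>)"
  have *: "A \<ge> 0" "B \<ge> 0" "C\<^sup>2 \<le> 4 * B * A"
    using assms by (auto simp: A_def B_def C_def rate_condition_def)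
  have "\<bar>C\<bar> = sqrt (C\<^sup>2)" by simp
  also have "\<dots> \<le> sqrt (4 * B * A)" by (rule real_sqrt_le_mono[OF *(3)])
  also have "\<dots> = 2 * sqrt A * sqrt B" by (simp add: real_sqrt_mult)
  finally have C: "\<bar>C\<bar> \<le> 2 * sqrt A * sqrt B" .
  have "C * Re (w * cnj v) \<le> \<bar>C\<bar> * \<bar>Re (w * cnj v)\<bar>" by (simp flip: abs_mult)
  also have "\<dots> \<le> \<bar>C\<bar> * (cmod w * cmod v)"
    using abs_Re_le_cmod[of "w * cnj v"] by (intro mult_left_mono) (auto simp: norm_mult)
  also have "\<dots> \<le> 2 * sqrt A * sqrt B * (cmod w * cmod v)" by (intro mult_right_mono C) auto
  also have "\<dots> = 2 * (sqrt A * cmod v) * (sqrt B * cmod w)" by simp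
  also have "\<dots> \<le> (sqrt A * cmod v)\<^sup>2 + (sqrt B * cmod w)\<^sup>2" by (rule sum_squares_bound)
  also have "\<dots> = A * (cmod v)\<^sup>2 + B * (cmod w)\<^sup>2" using * by (simp add: power_mult_distrib)
  finally show ?thesis by (simp add: A_def B_def C_def)
qed

text \<open>The pointwise form is integrated over the torus, so that a non-constant \<sigma> enters
  only through its values almost everywhere. The function w will be the antiderivative of the
  centred first component.\<close>

lemma rate_condition_inner:
  assumes \<sigma>: "\<sigma> \<in> Linfty" and rate: "AE x in torus. rate_condition \<theta> \<alpha> (\<sigma> x)" and "\<alpha> \<le> \<theta>"
  shows "\<theta> * inner w (multiply \<sigma> v) - \<theta> * \<alpha> * inner w v
    \<le> 2 * inner v (multiply \<sigma> v) - (\<theta> + \<alpha>) * inner v v + (\<theta> - \<alpha>) * inner w w"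
proof -
  let ?m = "multiply \<sigma> v"
  define I where "I f g x = Re (rep_L2 f x * cnj (rep_L2 g x))" for f g x
  have int: "integrable torus (I f g)" and inner: "inner f g = 1 / (2 * pi) * (\<integral>x. I f g x \<partial>torus)" for f g
    unfolding I_def[abs_def] by (rule integrable_Re_rep_L2 inner_L2_Re)+
  have "0 \<le> (\<integral>x. 2 * I v ?m x - (\<theta> + \<alpha>) * I v v x + (\<theta> - \<alpha>) * I w w x - \<theta> * I w ?m x + \<theta> * \<alpha> * I w v x \<partial>torus)"
  proof (rule integral_nonneg_AE, use rate rep_L2_multiply[OF \<sigma>, of v] in eventually_elim)
    case (elim x)
    have "I f ?m x = \<sigma> x * I f v x" for f
      by (simp add: I_def elim(2) algebra_simps)
    moreover have "I f f x = (cmod (rep_L2 f x))\<^sup>2" for f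
      by (simp add: I_def cmod_power2) (simp add: power2_eq_square)
    moreover have "I w v x = Re (rep_L2 w x * cnj (rep_L2 v x))" by (rule I_def)
    ultimately show ?case
      using rate_condition_pointwise[OF elim(1) \<open>\<alpha> \<le> \<theta>\<close>, of "rep_L2 v x" "rep_L2 w x"]
      by (simp only:) (simp only: algebra_simps)
  qed
  also have "\<dots> = 2 * pi * (2 * inner v ?m - (\<theta> + \<alpha>) * inner v v + (\<theta> - \<alpha>) * inner w w - \<theta> * inner w ?m + \<theta> * \<alpha> * inner w v)"
    by (simp add: inner int) (simp add: field_simps)
  finally show ?thesis using pi_gt_zero by (auto simp: zero_le_mult_iff)
qed

section \<open>The energy along strict solutions\<close>

lemma energy_eq: "energy \<theta> f g = inner f f + inner g g - \<theta> * inner (antideriv_L2 f) g"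
proof -
  have sq: "sq_integrable (antiderivative (rep_L2 f))"
    by (rule sq_integrable_antiderivative[OF integrable_rep_L2])
  have "inner (antideriv_L2 f) g = 1 / (2 * pi) * Re (\<integral>x. antiderivative (rep_L2 f) x * cnj (rep_L2 g x) \<partial>torus)"
    using inner_abs_L2[OF sq sq_integrable_rep_L2, of g] by (simp add: antideriv_L2_def abs_L2_rep_L2)
  also have "Re (\<integral>x. antiderivative (rep_L2 f) x * cnj (rep_L2 g x) \<partial>torus)
      = (\<integral>x. Re (antiderivative (rep_L2 f) x * cnj (rep_L2 g x)) \<partial>torus)"
    by (rule integral_Re[symmetric, OF sq_integrable_mult[OF sq sq_integrable_rep_L2]])
  finally show ?thesis
    by (simp add: energy_def power2_norm_eq_inner)
qed

text \<open>No semigroup is mentioned, so the notion also covers an explicit mode and the difference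
  of two solutions. Continuity is part of it because a right derivative alone gives continuity only
  from the right.\<close>

definition strict_solution :: "(real \<Rightarrow> real) \<Rightarrow> (real \<Rightarrow> L2 \<times> L2) \<Rightarrow> bool" where
  "strict_solution \<sigma> y \<longleftrightarrow> continuous_on {0..} y \<and>
     (\<forall>t\<ge>0. \<exists>z. (y t, z) \<in> system_operator \<sigma> \<and> (y has_vector_derivative z) (at t within {t..}))"

lemma mean_zero_antideriv: "mean_L2 f = 0 \<Longrightarrow> antideriv_L2 f = antideriv0 f"
  by (simp add: antideriv0_def)

lemma system_operator_mean:
  assumes "(x, z) \<in> system_operator \<sigma>"
  shows "mean_L2 (fst z) = 0"
  using assms weak_derivative_mean bounded_linear.linear[OF bounded_linear_mean_L2]
  by (auto simp: system_operator_def linear_neg)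

lemma has_vector_derivative_fst_snd:
  assumes "(y has_vector_derivative z) F"
  shows "((\<lambda>t. fst (y t)) has_vector_derivative fst z) F" "((\<lambda>t. snd (y t)) has_vector_derivative snd z) F"
  using bounded_linear.has_vector_derivative[OF bounded_linear_fst assms]
    bounded_linear.has_vector_derivative[OF bounded_linear_snd assms] by auto

text \<open>The derivative of the first component is a weak derivative up to sign and has mean zero.
  The squared norm of the drift of the mean thus has right derivative 0, which reduces the claim to
  scalar monotonicity.\<close>

lemma strict_solution_mean:
  assumes y: "strict_solution \<sigma> y" and t: "t \<ge> 0"
  shows "mean_L2 (fst (y t)) = mean_L2 (fst (y 0))"
proof -
  let ?d = "\<lambda>t. mean_L2 (fst (y t)) - mean_L2 (fst (y 0))"
  have "inner (?d t) (?d t) \<le> inner (?d 0) (?d 0)"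
  proof (rule right_derivative_nonincreasing[where f = "\<lambda>t. inner (?d t) (?d t)" and f' = "\<lambda>_. 0"])
    have "continuous_on {0..} y" using y by (simp add: strict_solution_def)
    then show "continuous_on {0..} (\<lambda>t. inner (?d t) (?d t))"
      by (intro continuous_intros bounded_linear.continuous_on[OF bounded_linear_mean_L2])
    fix t :: real assume "t \<ge> 0"
    then obtain z where z: "(y t, z) \<in> system_operator \<sigma>" "(y has_vector_derivative z) (at t within {t..})"
      using y by (auto simp: strict_solution_def)
    have "((\<lambda>t. mean_L2 (fst (y t))) has_vector_derivative 0) (at t within {t..})"
      using bounded_linear.has_vector_derivative[OF bounded_linear_mean_L2 has_vector_derivative_fst_snd(1)[OF z(2)]]
      by (simp add: system_operator_mean[OF z(1)])
    then have d: "(?d has_vector_derivative 0) (at t within {t..})"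
      by (auto intro!: derivative_eq_intros)
    show "((\<lambda>t. inner (?d t) (?d t)) has_real_derivative 0) (at t within {t..})"
      using bounded_bilinear.has_vector_derivative[OF bounded_bilinear_inner d d]
      by (simp add: has_real_derivative_iff_has_vector_derivative)
  qed (use t in auto)
  then have "inner (?d t) (?d t) \<le> 0" by simp
  then show ?thesis by (metis inner_gt_zero_iff not_less right_minus_eq)
qed

text \<open>The left side is the time derivative of the energy, with a and b the space derivatives
  of u and v. It is kept free of time, so only identities between fixed vectors remain.\<close>

lemma energy_derivative_bound:
  assumes \<sigma>: "\<sigma> \<in> Linfty" and rate: "AE x in torus. rate_condition \<theta> \<alpha> (\<sigma> x)"
    and "0 \<le> \<theta>" "\<alpha> \<le> \<theta>"
    and a: "has_weak_derivative u a" and b: "has_weak_derivative v b"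
    and U: "U = u - mean_L2 u"
  shows "2 * inner U (- b) + 2 * inner v (- a - multiply \<sigma> v)
      - \<theta> * (inner (antideriv_L2 (- b)) v + inner (antideriv_L2 U) (- a - multiply \<sigma> v))
    \<le> - \<alpha> * (inner U U + inner v v - \<theta> * inner (antideriv_L2 U) v)"
proof -
  let ?m = "multiply \<sigma> v"
  note lin = bounded_linear.linear[OF bounded_linear_antideriv_L2] bounded_linear.linear[OF bounded_linear_mean_L2]
  have Ma: "mean_L2 a = 0" and Mb: "mean_L2 b = 0"
    using weak_derivative_mean a b by auto
  have MU: "mean_L2 U = 0" using lin by (simp add: U linear_diff mean_L2_idem)
  have Ua: "U = antideriv0 a" using weak_derivative_antideriv0[OF a] by (simp add: U diff_eq_eq add.commute)
  have vb: "v = mean_L2 v + antideriv0 b" by (rule weak_derivative_antideriv0[OF b])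
  have "inner (mean_L2 v) a = 0"
    using inner_mean_L2[of v a] Ma by simp
  then have va: "inner v a = inner (antideriv0 b) a"
    by (subst vb) (simp add: inner_add_left)
  \<comment> \<open>Integration by parts by skewness: the two transport terms of the system cancel
    in the derivative of the squared norms.\<close>
  have "inner U b = - inner a (antideriv0 b)"
    by (subst Ua) (rule antideriv0_skew)
  then have Ub: "inner U b = - inner v a"
    unfolding va by (simp add: inner_commute)
  have Qbv: "inner (antideriv0 b) v = inner v v - inner (mean_L2 v) (mean_L2 v)"
    using vb inner_mean_L2[of v v] by (metis add_diff_cancel_left' inner_diff_left)
  have QUa: "inner (antideriv0 U) a = - inner U U"
    unfolding antideriv0_skew by (simp add: Ua[symmetric])
  have P: "antideriv_L2 U = antideriv0 U" "antideriv_L2 (- b) = - antideriv0 b"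
    using lin by (simp_all add: mean_zero_antideriv MU Mb linear_neg)
  have "inner (antideriv0 U) (antideriv0 U) \<le> inner U U"
    using norm_antideriv0_le[of U] by (simp add: norm_le)
  \<comment> \<open>Wirtinger's inequality trades the centred u for its antiderivative w, the
    variable in which the quadratic form is posed; the factor \<theta> - \<alpha> has to be
    nonnegative.\<close>
  then have "(\<theta> - \<alpha>) * inner (antideriv0 U) (antideriv0 U) \<le> (\<theta> - \<alpha>) * inner U U"
    using \<open>\<alpha> \<le> \<theta>\<close> by (intro mult_left_mono) auto
  moreover have "0 \<le> \<theta> * inner (mean_L2 v) (mean_L2 v)" using \<open>0 \<le> \<theta>\<close> by simp
  moreover note rate_condition_inner[OF \<sigma> rate \<open>\<alpha> \<le> \<theta>\<close>, of "antideriv0 U" v]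
  ultimately show ?thesis
    by (simp add: P inner_diff_right Ub QUa Qbv) (simp add: algebra_simps)
qed

lemma strict_solution_energy_decay:
  assumes \<sigma>: "\<sigma> \<in> Linfty" and rate: "AE x in torus. rate_condition \<theta> \<alpha> (\<sigma> x)"
    and \<theta>: "0 \<le> \<theta>" "\<alpha> \<le> \<theta>"
    and y: "strict_solution \<sigma> y" and t: "t \<ge> 0"
  shows "energy \<theta> (fst (y t) - mean_L2 (fst (y 0))) (snd (y t))
    \<le> energy \<theta> (fst (y 0) - mean_L2 (fst (y 0))) (snd (y 0)) * exp (- \<alpha> * t)"
proof -
  let ?U = "\<lambda>t. fst (y t) - mean_L2 (fst (y 0))" and ?v = "\<lambda>t. snd (y t)"
  let ?E = "\<lambda>t. inner (?U t) (?U t) + inner (?v t) (?v t) - \<theta> * inner (antideriv_L2 (?U t)) (?v t)"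
  have cont: "continuous_on {0..} y" using y by (simp add: strict_solution_def)
  have "\<exists>e. (?E has_real_derivative e) (at t within {t..}) \<and> e \<le> - \<alpha> * ?E t" if t: "t \<ge> 0" for t
  proof -
    obtain z where z: "(y t, z) \<in> system_operator \<sigma>" "(y has_vector_derivative z) (at t within {t..})"
      using y t by (auto simp: strict_solution_def)
    then obtain a b where ab: "has_weak_derivative (fst (y t)) a" "has_weak_derivative (snd (y t)) b"
      "z = (- b, - a - multiply \<sigma> (snd (y t)))"
      by (auto simp: system_operator_def)
    have U: "(?U has_vector_derivative - b) (at t within {t..})"
      using has_vector_derivative_fst_snd(1)[OF z(2)] by (auto intro!: derivative_eq_intros simp: ab(3))
    have v: "(?v has_vector_derivative - a - multiply \<sigma> (snd (y t))) (at t within {t..})"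
      using has_vector_derivative_fst_snd(2)[OF z(2)] by (simp add: ab(3))
    have PU: "((\<lambda>t. antideriv_L2 (?U t)) has_vector_derivative antideriv_L2 (- b)) (at t within {t..})"
      by (rule bounded_linear.has_vector_derivative[OF bounded_linear_antideriv_L2 U])
    note inner_der = bounded_bilinear.has_vector_derivative[OF bounded_bilinear_inner]
    let ?e = "2 * inner (?U t) (- b) + 2 * inner (?v t) (- a - multiply \<sigma> (?v t))
        - \<theta> * (inner (antideriv_L2 (- b)) (?v t) + inner (antideriv_L2 (?U t)) (- a - multiply \<sigma> (?v t)))"
    have "(?E has_real_derivative ?e) (at t within {t..})"
      using inner_der[OF U U] inner_der[OF v v] inner_der[OF PU v]
      unfolding has_real_derivative_iff_has_vector_derivative[symmetric]
      by (auto intro!: derivative_eq_intros simp: inner_commute)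
    \<comment> \<open>The subtracted mean is frozen at time 0, so it does not contribute to the
      derivative; its conservation identifies it with the mean at time t.\<close>
    moreover have "?e \<le> - \<alpha> * ?E t"
      by (rule energy_derivative_bound[OF \<sigma> rate \<theta> ab(1,2)]) (simp add: strict_solution_mean[OF y t])
    ultimately show ?thesis by blast
  qed
  then have "\<forall>t. \<exists>e. t \<ge> 0 \<longrightarrow> (?E has_real_derivative e) (at t within {t..}) \<and> e \<le> - \<alpha> * ?E t"
    by blast
  from choice[OF this] obtain e where e: "\<And>t. t \<ge> 0 \<Longrightarrow> (?E has_real_derivative e t) (at t within {t..})"
    "\<And>t. t \<ge> 0 \<Longrightarrow> e t \<le> - \<alpha> * ?E t" by blast
  have "continuous_on {0..} ?E"
    by (intro continuous_intros cont bounded_linear.continuous_on[OF bounded_linear_antideriv_L2])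
  then have "?E t \<le> ?E 0 * exp (- \<alpha> * t)"
    by (rule right_derivative_exp_decay[where f = ?E and f' = e, OF _ e t])
  then show ?thesis by (simp only: energy_eq)
qed

section \<open>Strongly continuous semigroups on Banach spaces\<close>

text \<open>Banach-Steinhaus via Baire: the closed sets \<open>A k\<close> cover the space, so one
  of them contains a ball, and linearity carries the bound on that ball to the whole space.\<close>

lemma uniform_boundedness:
  fixes F :: "nat \<Rightarrow> 'a::banach \<Rightarrow> 'b::real_normed_vector"
  assumes lin: "\<And>n. bounded_linear (F n)" and bdd: "\<And>x. bounded (range (\<lambda>n. F n x))"
  shows "\<exists>M. \<forall>n x. norm (F n x) \<le> M * norm x"
proof -
  define A where "A k = {x. \<forall>n. norm (F n x) \<le> real k}" for k :: nat
  have closed: "closed (A k)" for k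
  proof -
    have "closed {x. norm (F n x) \<le> real k}" for n
      by (intro closed_Collect_le continuous_on_norm linear_continuous_on lin continuous_on_const)
    then have "closed (\<Inter>n. {x. norm (F n x) \<le> real k})" by auto
    also have "(\<Inter>n. {x. norm (F n x) \<le> real k}) = A k" by (auto simp: A_def)
    finally show ?thesis .
  qed
  have "(\<Union>k. A k) = UNIV"
  proof (intro set_eqI iffI UNIV_I)
    fix x
    obtain B where "\<And>n. norm (F n x) \<le> B" using bdd[of x] by (auto simp: bounded_iff)
    moreover obtain k :: nat where "B \<le> real k" using real_arch_simple by blast
    ultimately show "x \<in> (\<Union>k. A k)" by (auto simp: A_def intro: order_trans)
  qed
  have "\<exists>k. interior (A k) \<noteq> {}"
  proof (rule ccontr)
    assume "\<nexists>k. interior (A k) \<noteq> {}"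
    then have "interior (\<Union>(range A)) = {}"
      using Met_TC.metric_Baire_category_alt[where ?'a='a, of "range A"] closed
      by (auto simp: complete_UNIV)
    then show False using \<open>(\<Union>k. A k) = UNIV\<close> by simp
  qed
  then obtain k x0 where "x0 \<in> interior (A k)" by blast
  then obtain r where r: "r > 0" "cball x0 r \<subseteq> A k"
    unfolding mem_interior_cball by blast
  have "norm (F n x) \<le> 2 * real k / r * norm x" for n x
  proof (cases "x = 0")
    case True
    then show ?thesis using linear_0[OF bounded_linear.linear[OF lin]] by simp
  next
    case False
    \<comment> \<open>This scales x to the radius of the ball; the factor 2 arises because the value
      at the scaled vector is a difference of values at two points of the ball.\<close>
    define c where "c = r / norm x"
    have c: "c > 0" using r False by (simp add: c_def)
    have "x0 + c *\<^sub>R x \<in> A k" "x0 \<in> A k"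
      using r False by (auto simp: dist_norm c_def)
    then have "norm (F n (x0 + c *\<^sub>R x)) \<le> real k" "norm (F n x0) \<le> real k"
      by (auto simp: A_def)
    moreover have "c *\<^sub>R F n x = F n (x0 + c *\<^sub>R x) - F n x0"
      using bounded_linear.linear[OF lin] by (simp add: linear_add linear_scale)
    then have "norm (c *\<^sub>R F n x) \<le> norm (F n (x0 + c *\<^sub>R x)) + norm (F n x0)"
      using norm_triangle_ineq4 by metis
    ultimately have "c * norm (F n x) \<le> 2 * real k" using c by simp
    then show ?thesis using c False r by (simp add: c_def field_simps)
  qed
  then show ?thesis by blast
qed

context
  fixes T :: "real \<Rightarrow> 'a::banach \<Rightarrow> 'a"
  assumes T: "C0_semigroup T"
begin

lemma C0_linear: "t \<ge> 0 \<Longrightarrow> bounded_linear (T t)"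
  using T by (simp add: C0_semigroup_def)

lemma C0_zero: "T 0 x = x"
  using T by (simp add: C0_semigroup_def)

lemma C0_add: "s \<ge> 0 \<Longrightarrow> t \<ge> 0 \<Longrightarrow> T (s + t) x = T s (T t x)"
  using T by (simp add: C0_semigroup_def o_def fun_eq_iff)

lemma C0_tendsto: "((\<lambda>t. T t x) \<longlongrightarrow> x) (at 0 within {0..})"
  using T by (simp add: C0_semigroup_def at_within_Ici_at_right)

text \<open>
  Local boundedness, and with it left continuity of orbits, may fail for a \<^const>\<open>C0_semigroup\<close> on
  an incomplete space.
\<close>

lemma C0_bounded_near_zero: "\<exists>\<delta>>0. \<exists>M. \<forall>t\<in>{0..\<delta>}. \<forall>x. norm (T t x) \<le> M * norm x"
proof (rule ccontr)
  assume "\<not> ?thesis"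
  \<comment> \<open>Failure of the bound gives times tending to 0 with operator bounds above every
    n, while each single orbit converges along these times: a contradiction to uniform
    boundedness.\<close>
  then have "\<exists>t\<in>{0..1 / real (Suc n)}. \<exists>x. real n * norm x < norm (T t x)" for n
    by (metis not_le of_nat_0_less_iff zero_less_Suc zero_less_divide_1_iff)
  then obtain s z where s: "\<And>n. s n \<in> {0..1 / real (Suc n)}" and z: "\<And>n. real n * norm (z n) < norm (T (s n) (z n))"
    by metis
  have s0: "s \<longlonglongrightarrow> 0"
    by (rule tendsto_sandwich[OF _ _ tendsto_const LIMSEQ_inverse_real_of_nat])
      (use s in \<open>auto simp: inverse_eq_divide\<close>)
  have "(\<lambda>n. T (s n) x) \<longlonglongrightarrow> x" for x
  proof -
    have "continuous (at 0 within {0..}) (\<lambda>t. T t x)"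
      using C0_tendsto[of x] by (simp add: continuous_within C0_zero)
    from continuous_within_tendsto_compose'[OF this _ s0] s show ?thesis
      by (simp add: C0_zero)
  qed
  then have "bounded (range (\<lambda>n. T (s n) x))" for x
    by (rule convergent_imp_bounded)
  then obtain M where M: "\<And>n x. norm (T (s n) x) \<le> M * norm x"
    using uniform_boundedness[of "\<lambda>n. T (s n)"] C0_linear s by auto
  obtain n :: nat where "M \<le> real n" using real_arch_simple by blast
  then have "M * norm (z n) \<le> real n * norm (z n)" by (rule mult_right_mono) simp
  with M[of n "z n"] z[of n] show False by simp
qed

text \<open>The bound on [0, \<delta>] propagates by the semigroup law, one factor per step of
  length \<delta>.\<close>

lemma C0_locally_bounded: "\<exists>M. \<forall>t\<in>{0..b}. \<forall>x. norm (T t x) \<le> M * norm x"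
proof -
  obtain \<delta> M where \<delta>: "\<delta> > 0" and M: "\<And>t x. t \<in> {0..\<delta>} \<Longrightarrow> norm (T t x) \<le> M * norm x"
    using C0_bounded_near_zero by blast
  have "\<exists>K\<ge>0. \<forall>t\<in>{0..real n * \<delta>}. \<forall>x. norm (T t x) \<le> K * norm x" for n
  proof (induction n)
    case 0
    then show ?case by (auto simp: C0_zero intro!: exI[of _ 1])
  next
    case (Suc n)
    then obtain K where K: "K \<ge> 0" "\<And>t x. t \<in> {0..real n * \<delta>} \<Longrightarrow> norm (T t x) \<le> K * norm x" by blast
    have "norm (T t x) \<le> max \<bar>M\<bar> (K * \<bar>M\<bar>) * norm x" if t: "t \<in> {0..real (Suc n) * \<delta>}" for t x
    proof (cases "t \<le> \<delta>")
      case True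
      then have "norm (T t x) \<le> M * norm x" using M[of t x] t by simp
      also have "\<dots> \<le> max \<bar>M\<bar> (K * \<bar>M\<bar>) * norm x" by (intro mult_right_mono) auto
      finally show ?thesis .
    next
      case False
      have "norm (T t x) = norm (T (t - \<delta>) (T \<delta> x))"
        using C0_add[of "t - \<delta>" \<delta> x] \<delta> False by simp
      also have "\<dots> \<le> K * norm (T \<delta> x)" using K(2)[of "t - \<delta>"] t False by (simp add: algebra_simps)
      also have "\<dots> \<le> K * (\<bar>M\<bar> * norm x)"
        using M[of \<delta> x] \<delta> K(1) by (intro mult_left_mono) (auto intro: order_trans[OF _ mult_right_mono])
      also have "\<dots> \<le> max \<bar>M\<bar> (K * \<bar>M\<bar>) * norm x"
        unfolding mult.assoc[symmetric] by (intro mult_right_mono) auto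
      finally show ?thesis .
    qed
    then show ?case by (intro exI[of _ "max \<bar>M\<bar> (K * \<bar>M\<bar>)"]) auto
  qed
  moreover obtain n :: nat where "b / \<delta> \<le> real n" using real_arch_simple by blast
  then have "b \<le> real n * \<delta>" using \<delta> by (simp add: divide_le_eq)
  ultimately show ?thesis by (meson atLeastAtMost_iff order_trans)
qed

text \<open>For s and t0 in either order, the difference of orbit values is, up to sign,
  \<open>T\<close> at the smaller time applied to T |s - t0| x - x. Continuity at 0 controls the
  argument; the local bound controls the operator, whose time varies with s when s < t0.\<close>

lemma C0_continuous_on: "continuous_on {0..} (\<lambda>t. T t x)"
  unfolding continuous_on_def
proof
  fix t0 :: real assume t0: "t0 \<in> {0..}"
  obtain M where M: "\<And>t x. t \<in> {0..t0} \<Longrightarrow> norm (T t x) \<le> M * norm x"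
    using C0_locally_bounded[of t0] by blast
  have "((\<lambda>s. T \<bar>s - t0\<bar> x) \<longlongrightarrow> x) (at t0 within {0..})"
  proof -
    have "continuous_on {0..} (\<lambda>s. \<bar>s - t0\<bar>)" by (intro continuous_intros)
    then have "((\<lambda>s. \<bar>s - t0\<bar>) \<longlongrightarrow> \<bar>t0 - t0\<bar>) (at t0 within {0..})"
      using t0 by (simp only: continuous_on_def)
    then have *: "((\<lambda>s. \<bar>s - t0\<bar>) \<longlongrightarrow> 0) (at t0 within {0..})" by simp
    have "continuous (at 0 within {0..}) (\<lambda>t. T t x)"
      using C0_tendsto[of x] by (simp add: continuous_within C0_zero)
    from continuous_within_tendsto_compose[OF this _ *] show ?thesis
      by (simp add: C0_zero)
  qed
  then have "((\<lambda>s. M * norm (T \<bar>s - t0\<bar> x - x)) \<longlongrightarrow> M * norm (x - x)) (at t0 within {0..})"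
    by (intro tendsto_intros)
  then have lim: "((\<lambda>s. M * norm (T \<bar>s - t0\<bar> x - x)) \<longlongrightarrow> 0) (at t0 within {0..})" by simp
  have "norm (T s x - T t0 x) \<le> M * norm (T \<bar>s - t0\<bar> x - x)" if s: "s \<ge> 0" for s
  proof (cases "s \<ge> t0")
    case True
    have "T s x - T t0 x = T t0 (T \<bar>s - t0\<bar> x - x)"
      using C0_add[of t0 "s - t0" x] True t0 C0_linear[of t0]
      by (simp add: linear_diff bounded_linear.linear)
    then show ?thesis using M[of t0] t0 by simp
  next
    case False
    have "T t0 x - T s x = T s (T \<bar>s - t0\<bar> x - x)"
      using C0_add[of s "t0 - s" x] False s C0_linear[of s]
      by (simp add: linear_diff bounded_linear.linear)
    then have "norm (T s x - T t0 x) = norm (T s (T \<bar>s - t0\<bar> x - x))"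
      by (metis norm_minus_commute)
    then show ?thesis using M[of s] False s by simp
  qed
  then have "\<forall>\<^sub>F s in at t0 within {0..}. norm (T s x - T t0 x) \<le> M * norm (T \<bar>s - t0\<bar> x - x)"
    by (auto simp: eventually_at_filter)
  from Lim_null_comparison[OF this lim]
  have "((\<lambda>s. T s x - T t0 x) \<longlongrightarrow> 0) (at t0 within {0..})" .
  then show "((\<lambda>t. T t x) \<longlongrightarrow> T t0 x) (at t0 within {0..})"
    by (rule LIM_zero_cancel)
qed

text \<open>T t is bounded and commutes with the difference quotients at 0. The resulting limit can
  be read as membership of T t x in the domain or as a right derivative of the orbit.\<close>

lemma generator_orbit:
  assumes xy: "(x, y) \<in> generator T" and t: "t \<ge> 0"
  shows "(T t x, T t y) \<in> generator T"
    and "((\<lambda>t. T t x) has_vector_derivative T t y) (at t within {t..})"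
proof -
  note lin = bounded_linear.linear[OF C0_linear[OF t]]
  have lim: "((\<lambda>h. (T h x - x) /\<^sub>R h) \<longlongrightarrow> y) (at_right 0)"
    using xy by (simp add: generator_def)
  have "((\<lambda>h. T t ((T h x - x) /\<^sub>R h)) \<longlongrightarrow> T t y) (at_right 0)"
    by (rule bounded_linear.tendsto[OF C0_linear[OF t] lim])
  moreover have "\<forall>\<^sub>F h in at_right 0. T t ((T h x - x) /\<^sub>R h) = (T (t + h) x - T t x) /\<^sub>R h"
    unfolding eventually_at_filter using t lin
    by (auto simp: linear_scale linear_diff C0_add)
  ultimately have lim2: "((\<lambda>h. (T (t + h) x - T t x) /\<^sub>R h) \<longlongrightarrow> T t y) (at_right 0)"
    by (rule Lim_transform_eventually)
  moreover have "\<forall>\<^sub>F h in at_right 0. (T (t + h) x - T t x) /\<^sub>R h = (T h (T t x) - T t x) /\<^sub>R h"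
    unfolding eventually_at_filter using t C0_add[of _ t x] by (auto simp: add.commute)
  ultimately have "((\<lambda>h. (T h (T t x) - T t x) /\<^sub>R h) \<longlongrightarrow> T t y) (at_right 0)"
    by (rule Lim_transform_eventually)
  then show "(T t x, T t y) \<in> generator T" by (simp add: generator_def)
  have "((\<lambda>h. (T (t + h) x - T t x) /\<^sub>R h - T t y) \<longlongrightarrow> 0) (at_right 0)"
    using lim2 by (rule LIM_zero)
  moreover have "\<forall>\<^sub>F h in at_right 0. (T (t + h) x - T t x) /\<^sub>R h - T t y
      = (1 / norm (h + t - t)) *\<^sub>R (T (h + t) x - (T t x + (h + t - t) *\<^sub>R T t y))"
    unfolding eventually_at_filter by (auto simp: algebra_simps inverse_eq_divide)
  ultimately have "((\<lambda>h. (1 / norm (h + t - t)) *\<^sub>R (T (h + t) x - (T t x + (h + t - t) *\<^sub>R T t y))) \<longlongrightarrow> 0) (at_right 0)"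
    by (rule Lim_transform_eventually)
  then have "((\<lambda>s. (1 / norm (s - t)) *\<^sub>R (T s x - (T t x + (s - t) *\<^sub>R T t y))) \<longlongrightarrow> 0) (at_right t)"
    by (subst filterlim_at_right_to_0)
  then show "((\<lambda>t. T t x) has_vector_derivative T t y) (at t within {t..})"
    by (simp add: has_vector_derivative_def has_derivative_within at_within_Ici_at_right bounded_linear_scaleR_left)
qed

end

section \<open>From the semigroup to arbitrary data\<close>

lemma system_semigroup_strict_solution:
  assumes "system_semigroup \<sigma> S" "(x, y) \<in> system_operator \<sigma>"
  shows "strict_solution \<sigma> (\<lambda>t. S t x)"
proof -
  have S: "C0_semigroup S" "generator S = system_operator \<sigma>"
    using assms by (simp_all add: system_semigroup_def)
  then have "(S t x, S t y) \<in> system_operator \<sigma> \<and> ((\<lambda>t. S t x) has_vector_derivative S t y) (at t within {t..})"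
    if "t \<ge> 0" for t
    using assms(2) generator_orbit[OF S(1) _ that] by simp
  then show ?thesis
    using C0_continuous_on[OF S(1)] unfolding strict_solution_def by blast
qed

text \<open>The zeroth-order damping term does not affect the domain, which therefore contains
  trigonometric polynomials for every \<sigma>.\<close>

lemma trig_system_operator:
  assumes "u \<in> trig_L2" "v \<in> trig_L2"
  shows "\<exists>z. ((u, v), z) \<in> system_operator \<sigma>"
  using trig_L2_weak_derivative[OF assms(1)] trig_L2_weak_derivative[OF assms(2)]
  by (auto simp: system_operator_def H1_def)

text \<open>Both energies are continuous functions of the initial pair, because S t,
  \<open>mean_L2\<close> and \<open>antideriv_L2\<close> are bounded; hence the inequality defines a
  closed set.\<close>

lemma semigroup_energy_decay:
  assumes \<sigma>: "\<sigma> \<in> Linfty" and rate: "AE x in torus. rate_condition \<theta> \<alpha> (\<sigma> x)"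
    and \<theta>: "0 \<le> \<theta>" "\<alpha> \<le> \<theta>"
    and S: "system_semigroup \<sigma> S" and t: "t \<ge> 0"
  shows "energy \<theta> (fst (S t x) - mean_L2 (fst x)) (snd (S t x))
    \<le> energy \<theta> (fst x - mean_L2 (fst x)) (snd x) * exp (- \<alpha> * t)" (is "?l x \<le> ?r x")
proof -
  have C0: "C0_semigroup S" using S by (simp add: system_semigroup_def)
  have St: "continuous_on UNIV (S t)" by (rule linear_continuous_on[OF C0_linear[OF C0 t]])
  have "closed {x. ?l x \<le> ?r x}"
    unfolding energy_eq
    by (intro closed_Collect_le continuous_intros St bounded_linear.continuous_on[OF bounded_linear_antideriv_L2]
        bounded_linear.continuous_on[OF bounded_linear_mean_L2])
  moreover have "trig_L2 \<times> trig_L2 \<subseteq> {x. ?l x \<le> ?r x}"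
  proof (clarsimp)
    fix u v assume "u \<in> trig_L2" "v \<in> trig_L2"
    then obtain z where "((u, v), z) \<in> system_operator \<sigma>" using trig_system_operator by blast
    from strict_solution_energy_decay[OF \<sigma> rate \<theta> system_semigroup_strict_solution[OF S this] t]
    show "energy \<theta> (fst (S t (u, v)) - mean_L2 u) (snd (S t (u, v))) \<le> energy \<theta> (u - mean_L2 u) v * exp (- (\<alpha> * t))"
      by (simp add: C0_zero[OF C0])
  qed
  ultimately have "closure (trig_L2 \<times> trig_L2) \<subseteq> {x. ?l x \<le> ?r x}" by (intro closure_minimal)
  then show ?thesis by (auto simp: closure_Times closure_trig_L2)
qed

section \<open>Decay of mild solutions and the rates\<close>

lemma semigroup_mean:
  assumes S: "system_semigroup \<sigma> S" and t: "t \<ge> 0"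
  shows "mean_L2 (fst (S t x)) = mean_L2 (fst x)"
proof -
  have C0: "C0_semigroup S" using S by (simp add: system_semigroup_def)
  have St: "continuous_on UNIV (S t)" by (rule linear_continuous_on[OF C0_linear[OF C0 t]])
  have "closed {x. mean_L2 (fst (S t x)) = mean_L2 (fst x)}"
    by (intro closed_Collect_eq continuous_intros St bounded_linear.continuous_on[OF bounded_linear_mean_L2])
  moreover have "trig_L2 \<times> trig_L2 \<subseteq> {x. mean_L2 (fst (S t x)) = mean_L2 (fst x)}"
  proof (clarsimp)
    fix u v assume "u \<in> trig_L2" "v \<in> trig_L2"
    then obtain z where "((u, v), z) \<in> system_operator \<sigma>" using trig_system_operator by blast
    from strict_solution_mean[OF system_semigroup_strict_solution[OF S this] t]
    show "mean_L2 (fst (S t (u, v))) = mean_L2 u"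
      by (simp add: C0_zero[OF C0])
  qed
  ultimately have "closure (trig_L2 \<times> trig_L2) \<subseteq> {x. mean_L2 (fst (S t x)) = mean_L2 (fst x)}"
    by (intro closure_minimal)
  then show ?thesis by (auto simp: closure_Times closure_trig_L2)
qed

text \<open>Cauchy-Schwarz and Wirtinger bound the mixed term by \<theta> times the product of the
  norms, hence by \<theta>/2 times the sum of their squares.\<close>

lemma energy_bounds:
  assumes "mean_L2 f = 0" "0 \<le> \<theta>"
  shows "(1 - \<theta> / 2) * ((norm f)\<^sup>2 + (norm g)\<^sup>2) \<le> energy \<theta> f g"
    and "energy \<theta> f g \<le> (1 + \<theta> / 2) * ((norm f)\<^sup>2 + (norm g)\<^sup>2)"
proof -
  have "\<bar>inner (antideriv_L2 f) g\<bar> \<le> norm (antideriv_L2 f) * norm g" by (rule Cauchy_Schwarz_ineq2)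
  also have "\<dots> \<le> norm f * norm g"
    using norm_antideriv0_le[of f] by (intro mult_right_mono) (simp_all add: mean_zero_antideriv[OF assms(1)])
  also have "\<dots> \<le> ((norm f)\<^sup>2 + (norm g)\<^sup>2) / 2" using sum_squares_bound[of "norm f" "norm g"] by simp
  finally have "\<theta> * \<bar>inner (antideriv_L2 f) g\<bar> \<le> \<theta> * (((norm f)\<^sup>2 + (norm g)\<^sup>2) / 2)"
    using assms(2) by (rule mult_left_mono)
  moreover have "\<bar>\<theta> * inner (antideriv_L2 f) g\<bar> = \<theta> * \<bar>inner (antideriv_L2 f) g\<bar>"
    using assms(2) by (simp add: abs_mult)
  ultimately have "\<bar>\<theta> * inner (antideriv_L2 f) g\<bar> \<le> \<theta> * (((norm f)\<^sup>2 + (norm g)\<^sup>2) / 2)" by simp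
  then show "(1 - \<theta> / 2) * ((norm f)\<^sup>2 + (norm g)\<^sup>2) \<le> energy \<theta> f g"
    "energy \<theta> f g \<le> (1 + \<theta> / 2) * ((norm f)\<^sup>2 + (norm g)\<^sup>2)"
    unfolding energy_eq power2_norm_eq_inner[symmetric] abs_le_iff by (simp_all add: algebra_simps)
qed

text \<open>The parallelogram law: passing to the characteristic variables halves the squared norm,
  a factor that cancels when two times are compared.\<close>

lemma norm_f_vec_diff_equil:
  "(norm (f_vec u v - f_equil w))\<^sup>2 = ((norm (u - mean_L2 w))\<^sup>2 + (norm v)\<^sup>2) / 2"
proof -
  have "const_L2 (avg w / 2) = (1 / 2) *\<^sub>R mean_L2 w"
    using linear_scale[OF bounded_linear.linear[OF bounded_linear_const_L2], of "1/2" "avg w"]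
    by (simp add: mean_L2_def scaleR_conv_of_real)
  then have "f_vec u v - f_equil w = ((1/2) *\<^sub>R ((u - mean_L2 w) + v), (1/2) *\<^sub>R ((u - mean_L2 w) - v))"
    by (simp add: f_vec_def f_equil_def algebra_simps)
  then have "(norm (f_vec u v - f_equil w))\<^sup>2 = (norm ((1/2) *\<^sub>R ((u - mean_L2 w) + v)))\<^sup>2 + (norm ((1/2) *\<^sub>R ((u - mean_L2 w) - v)))\<^sup>2"
    by (simp only: norm_Pair) simp
  also have "\<dots> = ((norm (u - mean_L2 w))\<^sup>2 + (norm v)\<^sup>2) / 2"
  proof -
    have "(norm ((1/2) *\<^sub>R (a + b)))\<^sup>2 + (norm ((1/2) *\<^sub>R (a - b)))\<^sup>2 = ((norm a)\<^sup>2 + (norm b)\<^sup>2) / 2" for a b :: L2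
      unfolding power2_norm_eq_inner by (simp add: inner_add_left inner_add_right inner_diff_left inner_diff_right inner_commute field_simps)
    then show ?thesis .
  qed
  finally show ?thesis .
qed

text \<open>The constant is the root of the ratio of the two energy bounds, and taking the root
  halves the energy rate \<alpha>.\<close>

lemma semigroup_norm_decay:
  assumes \<sigma>: "\<sigma> \<in> Linfty" and rate: "AE x in torus. rate_condition \<theta> \<alpha> (\<sigma> x)"
    and \<theta>: "0 \<le> \<theta>" "\<alpha> \<le> \<theta>" "\<theta> < 2"
    and S: "system_semigroup \<sigma> S" and t: "t \<ge> 0" and uv: "S t (u0, v0) = (u, v)"
  shows "energy \<theta> (u - const_L2 (avg u0)) v \<le> energy \<theta> (u0 - const_L2 (avg u0)) v0 * exp (- \<alpha> * t)"
    and "norm (f_vec u v - f_equil u0)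
      \<le> sqrt ((2 + \<theta>) / (2 - \<theta>)) * norm (f_vec u0 v0 - f_equil u0) * exp (- \<alpha> / 2 * t)"
proof -
  show E: "energy \<theta> (u - const_L2 (avg u0)) v \<le> energy \<theta> (u0 - const_L2 (avg u0)) v0 * exp (- \<alpha> * t)"
    using semigroup_energy_decay[OF \<sigma> rate \<theta>(1,2) S t, of "(u0, v0)"] by (simp add: uv mean_L2_def)
  let ?N = "norm (f_vec u v - f_equil u0)" and ?L = "norm (f_vec u0 v0 - f_equil u0)"
  let ?e = "exp (- \<alpha> / 2 * t)"
  have M: "mean_L2 (u - mean_L2 u0) = 0" "mean_L2 (u0 - mean_L2 u0) = 0"
    using semigroup_mean[OF S t, of "(u0, v0)"] bounded_linear.linear[OF bounded_linear_mean_L2]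
    by (simp_all add: uv linear_diff mean_L2_idem)
  have "(2 - \<theta>) * ?N\<^sup>2 \<le> energy \<theta> (u - mean_L2 u0) v"
    using energy_bounds(1)[OF M(1) \<theta>(1), of v] unfolding norm_f_vec_diff_equil by (simp add: algebra_simps)
  also have "\<dots> \<le> energy \<theta> (u0 - mean_L2 u0) v0 * exp (- \<alpha> * t)"
    using E by (simp add: mean_L2_def)
  also have "\<dots> \<le> ((2 + \<theta>) * ?L\<^sup>2) * exp (- \<alpha> * t)"
    using energy_bounds(2)[OF M(2) \<theta>(1), of v0] unfolding norm_f_vec_diff_equil
    by (intro mult_right_mono) (simp_all add: algebra_simps)
  also have "exp (- \<alpha> * t) = ?e\<^sup>2" by (simp add: exp_double[symmetric])
  finally have "?N\<^sup>2 \<le> (2 + \<theta>) / (2 - \<theta>) * (?L\<^sup>2 * ?e\<^sup>2)"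
    using \<theta>(3) by (simp add: field_simps)
  also have "\<dots> = (sqrt ((2 + \<theta>) / (2 - \<theta>)) * ?L * ?e)\<^sup>2"
    using \<theta> by (simp add: power_mult_distrib)
  finally show "?N \<le> sqrt ((2 + \<theta>) / (2 - \<theta>)) * ?L * ?e"
    by (rule power2_le_imp_le) (use \<theta> in simp)
qed

section \<open>Algebra of the admissible rates\<close>

lemma rate_condition_convex:
  assumes p: "rate_condition \<theta> \<alpha> p" and q: "rate_condition \<theta> \<alpha> q" and "p \<le> s" "s \<le> q"
  shows "rate_condition \<theta> \<alpha> s"
proof (cases "p = q")
  case True
  then show ?thesis using assms by simp
next
  case False
  define g where "g s = (\<theta> * (s - \<alpha>))\<^sup>2 - 4 * (\<theta> - \<alpha>) * (2 * s - \<theta> - \<alpha>)" for s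
  have "g p \<le> 0" "g q \<le> 0" using p q by (simp_all add: g_def rate_condition_def)
  then have "(q - s) * g p \<le> 0" "(s - p) * g q \<le> 0" "0 \<le> \<theta>\<^sup>2 * (q - p) * (q - s) * (s - p)"
    using assms by (auto simp: mult_le_0_iff)
  \<comment> \<open>Exact chord formula for a quadratic with leading coefficient \<theta>^2: the
    last term is the distance below the chord.\<close>
  moreover have "(q - p) * g s = (q - s) * g p + (s - p) * g q - \<theta>\<^sup>2 * (q - p) * (q - s) * (s - p)"
    unfolding g_def by algebra
  ultimately have "(q - p) * g s \<le> 0" by linarith
  then have "g s \<le> 0" using False assms by (auto simp: mult_le_0_iff)
  then show ?thesis using p \<open>p \<le> s\<close> by (auto simp: rate_condition_def g_def)
qed

lemma rate_condition_diag:
  assumes "0 \<le> \<theta>" "\<theta> \<le> 2" "\<alpha> \<le> \<theta>"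
  shows "rate_condition \<theta> \<alpha> \<theta>"
proof -
  have "\<theta>\<^sup>2 * (\<theta> - \<alpha>)\<^sup>2 \<le> 2\<^sup>2 * (\<theta> - \<alpha>)\<^sup>2"
    using assms by (intro mult_right_mono power_mono) auto
  then show ?thesis using assms by (simp add: rate_condition_def power_mult_distrib) (simp add: power2_eq_square algebra_simps)
qed

lemma rate_condition_large:
  assumes s: "s > 2" and \<theta>: "\<theta> = 4 / s" and \<alpha>: "\<alpha> = s - sqrt (s\<^sup>2 - 4)"
  shows "\<alpha> \<le> \<theta>" "rate_condition \<theta> \<alpha> s"
proof -
  define r where "r = sqrt (s\<^sup>2 - 4)"
  have "s\<^sup>2 > 2\<^sup>2" using s by (intro power_strict_mono) auto
  then have r2: "r\<^sup>2 = s\<^sup>2 - 4" and r0: "0 \<le> r" by (simp_all add: r_def)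
  have rs: "r \<le> s" using r2 s by (intro power2_le_imp_le[of r s]) auto
  \<comment> \<open>Replacing 4 by s^2 - r^2 makes \<theta> - \<alpha> and 2 s - \<theta> - \<alpha>
    factor, and the discriminant condition becomes an equality.\<close>
  have th: "\<theta> = (s\<^sup>2 - r\<^sup>2) / s" using r2 \<theta> by simp
  have a: "\<alpha> = s - r" by (simp add: \<alpha> r_def)
  have 1: "\<theta> - \<alpha> = r * (s - r) / s" "2 * s - \<theta> - \<alpha> = r * (s + r) / s"
    unfolding th a using s by (simp_all add: field_simps power2_eq_square)
  have nn: "0 \<le> r * (s - r) / s" "0 \<le> r * (s + r) / s"
    using r0 rs s by auto
  have "(\<theta> * (s - \<alpha>))\<^sup>2 = 16 * r\<^sup>2 / s\<^sup>2"
    by (simp add: \<theta> a power_mult_distrib power_divide)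
  also have "\<dots> = 4 * r\<^sup>2 * (s\<^sup>2 - r\<^sup>2) / s\<^sup>2" by (simp add: r2)
  also have "\<dots> = 4 * (\<theta> - \<alpha>) * (2 * s - \<theta> - \<alpha>)"
    unfolding 1 using s by (simp add: field_simps power2_eq_square)
  finally show "\<alpha> \<le> \<theta>" "rate_condition \<theta> \<alpha> s"
    using nn 1 by (simp_all add: rate_condition_def)
qed

text \<open>\<theta> is the solution of (2 + \<theta>) / (2 - \<theta>) = 2 / \<epsilon>^2, which
  fixes the constant sqrt 2 / \<epsilon>. The largest rate for this \<theta> is 2 - sqrt 2
  \<epsilon>, so \<alpha> = 2 (1 - \<epsilon>) lies strictly inside the admissible range.\<close>

lemma rate_condition_two:
  assumes e: "0 < \<epsilon>" "\<epsilon> < 1" and \<theta>: "\<theta> = 2 * (2 - \<epsilon>\<^sup>2) / (2 + \<epsilon>\<^sup>2)" and \<alpha>: "\<alpha> = 2 * (1 - \<epsilon>)"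
  shows "\<alpha> \<le> \<theta>" "rate_condition \<theta> \<alpha> 2" "0 \<le> \<theta>" "\<theta> < 2" "(2 + \<theta>) / (2 - \<theta>) = 2 / \<epsilon>\<^sup>2"
proof -
  define D where "D = 2 + \<epsilon>\<^sup>2"
  have D: "D > 0" "D \<noteq> 0" using zero_le_power2[of \<epsilon>] unfolding D_def by linarith+
  have e2: "\<epsilon>\<^sup>2 < 1" "0 < \<epsilon>\<^sup>2" using e by (auto simp: power_less_one_iff)
  have 1: "2 - \<theta> = 4 * \<epsilon>\<^sup>2 / D" "2 + \<theta> = 8 / D"
    using D by (simp_all add: \<theta> D_def[symmetric] field_simps) (simp_all add: D_def)
  have 2: "\<theta> - \<alpha> = 2 * \<epsilon> * (2 + \<epsilon>\<^sup>2 - 2 * \<epsilon>) / D"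
    "2 * 2 - \<theta> - \<alpha> = 2 * \<epsilon> * (2 + \<epsilon>\<^sup>2 + 2 * \<epsilon>) / D"
    using D unfolding \<theta> \<alpha> D_def[symmetric]
    by (simp_all add: field_simps) (simp_all add: D_def power2_eq_square algebra_simps)
  have pos: "0 \<le> 2 + \<epsilon>\<^sup>2 - 2 * \<epsilon>" "0 \<le> 2 + \<epsilon>\<^sup>2 + 2 * \<epsilon>" using e e2 by linarith+
  then have nn: "0 \<le> \<theta> - \<alpha>" "0 \<le> 2 * 2 - \<theta> - \<alpha>"
    unfolding 2 using e D by simp_all
  have "\<theta> * (2 - \<alpha>) = 4 * \<epsilon> * (2 - \<epsilon>\<^sup>2) / D"
    unfolding \<theta> \<alpha> D_def[symmetric] by simp
  then have "(\<theta> * (2 - \<alpha>))\<^sup>2 = 16 * \<epsilon>\<^sup>2 * (2 - \<epsilon>\<^sup>2)\<^sup>2 / D\<^sup>2"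
    by (simp only: power_mult_distrib power_divide) simp
  also have "\<dots> \<le> 16 * \<epsilon>\<^sup>2 * ((2 + \<epsilon>\<^sup>2 - 2 * \<epsilon>) * (2 + \<epsilon>\<^sup>2 + 2 * \<epsilon>)) / D\<^sup>2"
  proof (intro divide_right_mono mult_left_mono)
    \<comment> \<open>The slack 4 \<epsilon>^2 reflects that \<alpha> is not the extremal rate
      here.\<close>
    have "(2 + \<epsilon>\<^sup>2 - 2 * \<epsilon>) * (2 + \<epsilon>\<^sup>2 + 2 * \<epsilon>) - (2 - \<epsilon>\<^sup>2)\<^sup>2 = 4 * \<epsilon>\<^sup>2"
      by algebra
    then show "(2 - \<epsilon>\<^sup>2)\<^sup>2 \<le> (2 + \<epsilon>\<^sup>2 - 2 * \<epsilon>) * (2 + \<epsilon>\<^sup>2 + 2 * \<epsilon>)" using e2 by linarith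
  qed auto
  also have "\<dots> = 4 * (\<theta> - \<alpha>) * (2 * 2 - \<theta> - \<alpha>)"
    unfolding 2 by (simp add: power2_eq_square)
  finally show "\<alpha> \<le> \<theta>" "rate_condition \<theta> \<alpha> 2"
    using nn by (simp_all add: rate_condition_def)
  show "0 \<le> \<theta>" unfolding \<theta> using e2 D by (simp add: D_def)
  have "0 < 4 * \<epsilon>\<^sup>2 / D" using D e2 by simp
  with 1(1) show "\<theta> < 2" by linarith
  show "(2 + \<theta>) / (2 - \<theta>) = 2 / \<epsilon>\<^sup>2" unfolding 1 using D e2 by (simp add: field_simps)
qed

text \<open>With r = sqrt (4 - m^2) the denominator is r (r + 2), and \<alpha> simplifies to M - 2
  (M - m) / r, the largest rate at damping M for \<theta> = m. The discriminant condition holds with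
  equality.\<close>

lemma rate_condition_mixed:
  assumes m: "0 < m" "m < M" "m * M < 4"
    and \<alpha>: "\<alpha> = m * (4 + 2 * sqrt (4 - m\<^sup>2) - m * M) / (4 + 2 * sqrt (4 - m\<^sup>2) - m\<^sup>2)"
  shows "m < 2" "\<alpha> \<le> m" "rate_condition m \<alpha> M"
proof -
  have "m\<^sup>2 < m * M" using m by (simp add: power2_eq_square)
  then have m2: "m\<^sup>2 < 2\<^sup>2" using m by simp
  then show "m < 2" by (rule power2_less_imp_less) simp
  define r where "r = sqrt (4 - m\<^sup>2)"
  have r2: "r\<^sup>2 = 4 - m\<^sup>2" and r0: "0 < r" using m2 by (simp_all add: r_def)
  define D where "D = 4 + 2 * r - m\<^sup>2"
  have D: "D > 0" "D \<noteq> 0" using m2 r0 by (simp_all add: D_def)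
  \<comment> \<open>M - \<alpha>, m - \<alpha> and 2 M - m - \<alpha> are all multiples of k, so k^2
    drops out of the condition.\<close>
  define k where "k = (M - m) / D"
  have k: "0 \<le> k" "k * D = M - m" using D m by (simp_all add: k_def)
  have "\<alpha> = m * (D - (m * M - m\<^sup>2)) / D" by (simp add: \<alpha> D_def r_def)
  also have "\<dots> = m - m\<^sup>2 * k" unfolding k_def using D by (simp add: field_simps power2_eq_square)
  finally have a: "\<alpha> = m - m\<^sup>2 * k" .
  then show "\<alpha> \<le> m" using k by simp
  have 1: "M - \<alpha> = k * (4 + 2 * r)"
    using k(2) unfolding a D_def by (simp add: algebra_simps)
  have 2: "2 * M - m - \<alpha> = k * (8 + 4 * r - m\<^sup>2)"
    using k(2) unfolding a D_def by (simp add: algebra_simps)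
  have 3: "(4 + 2 * r)\<^sup>2 = 4 * (8 + 4 * r - m\<^sup>2)"
    using r2 by (simp add: power2_eq_square algebra_simps)
  have "0 \<le> 2 * M - m - \<alpha>" unfolding 2 using k m2 r0 by (intro mult_nonneg_nonneg) auto
  moreover have "(m * (M - \<alpha>))\<^sup>2 = 4 * (m - \<alpha>) * (2 * M - m - \<alpha>)"
    unfolding 1 2 unfolding a power_mult_distrib 3 by (simp add: power2_eq_square)
  ultimately show "rate_condition m \<alpha> M" by (simp add: rate_condition_def)
qed

lemma rate_condition_star:
  assumes m: "0 < m" "m < M"
  shows "0 \<le> \<theta>_star m M" "\<theta>_star m M < 2" "\<alpha>_star m M \<le> \<theta>_star m M"
    and "\<And>s. m \<le> s \<Longrightarrow> s \<le> M \<Longrightarrow> rate_condition (\<theta>_star m M) (\<alpha>_star m M) s"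
proof -
  let ?\<theta> = "\<theta>_star m M" and ?\<alpha> = "\<alpha>_star m M"
  have *: "0 \<le> ?\<theta> \<and> ?\<theta> < 2 \<and> ?\<alpha> \<le> ?\<theta> \<and> ?\<theta> \<le> m \<and> rate_condition ?\<theta> ?\<alpha> M"
  proof (cases "m < 4 / M")
    case True
    then have "m * M < 4" using m by (simp add: field_simps)
    from rate_condition_mixed[OF m this refl] show ?thesis
      using True m by (simp add: \<theta>_star_def \<alpha>_star_def)
  next
    case False
    then have "4 \<le> m * M" using m by (simp add: field_simps)
    also have "\<dots> < M * M" using m by (intro mult_strict_right_mono) auto
    finally have "2\<^sup>2 < M\<^sup>2" by (simp add: power2_eq_square)
    then have "2 < M" by (rule power2_less_imp_less) (use m in simp)
    with rate_condition_large[OF this refl refl] show ?thesis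
      using False m \<open>2 < M\<close> by (simp add: \<theta>_star_def \<alpha>_star_def divide_less_eq)
  qed
  then show "0 \<le> ?\<theta>" "?\<theta> < 2" "?\<alpha> \<le> ?\<theta>" by auto
  \<comment> \<open>Convexity is used on the interval from \<theta>* to M, not from m to M:
    \<theta>* \<le> m, and at the value \<theta>* the condition is free.\<close>
  show "rate_condition ?\<theta> ?\<alpha> s" if "m \<le> s" "s \<le> M" for s
    by (rule rate_condition_convex[of _ _ ?\<theta> M]) (use * that rate_condition_diag in auto)
qed

section \<open>Essential bounds of the damping\<close>

lemma AE_le_ess_sup:
  assumes "\<sigma> \<in> Linfty"
  shows "AE x in torus. \<sigma> x \<le> ess_sup \<sigma>"
proof -
  let ?e = "esssup torus (\<lambda>x. ereal (\<sigma> x))"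
  have AE: "AE x in torus. ereal (\<sigma> x) \<le> ?e" by (rule esssup_AE)
  obtain K where K: "AE x in torus. \<bar>\<sigma> x\<bar> \<le> K" using Linfty_bound[OF assms] .
  have \<sigma>: "\<sigma> \<in> borel_measurable torus" using assms by (simp add: Linfty_def)
  have "?e \<le> ereal K"
    by (rule esssup_I) (use \<sigma> K in \<open>auto elim!: eventually_mono\<close>)
  \<comment> \<open>The value minus infinity would force the torus to be a null set; finiteness is
    what makes \<open>real_of_ereal\<close> faithful.\<close>
  moreover have "?e \<noteq> - \<infinity>"
  proof
    assume "?e = - \<infinity>"
    with AE have "AE x in torus. False" by (auto elim!: eventually_mono)
    then have "emeasure torus (space torus) = 0" by (simp add: eventually_False ae_filter_eq_bot_iff)
    then show False by (simp add: emeasure_restrict_space)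
  qed
  ultimately have "ereal (ess_sup \<sigma>) = ?e" unfolding ess_sup_def by (cases ?e) auto
  with AE have "AE x in torus. ereal (\<sigma> x) \<le> ereal (ess_sup \<sigma>)" by simp
  then show ?thesis by simp
qed

lemma AE_ess_inf_le:
  assumes "\<sigma> \<in> Linfty"
  shows "AE x in torus. ess_inf \<sigma> \<le> \<sigma> x"
proof -
  have "(\<lambda>x. - \<sigma> x) \<in> Linfty" using assms by (simp add: Linfty_def)
  from AE_le_ess_sup[OF this] show ?thesis
    by (simp add: ess_sup_def ess_inf_def minus_le_iff)
qed

section \<open>Sharpness\<close>

lemma system_operatorI:
  "has_weak_derivative u u' \<Longrightarrow> has_weak_derivative v v' \<Longrightarrow>
    ((u, v), (- v', - u' - multiply \<sigma> v)) \<in> system_operator \<sigma>"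
  unfolding system_operator_def H1_def by blast

text \<open>The difference of two strict solutions with equal data is a strict solution starting at
  0. This identifies an orbit of the abstractly given semigroup with an explicitly computed
  solution.\<close>

lemma strict_solution_unique:
  assumes \<sigma>: "\<sigma> \<in> Linfty" "AE x in torus. 0 \<le> \<sigma> x"
    and S: "system_semigroup \<sigma> S" and y: "strict_solution \<sigma> y" and t: "t \<ge> 0"
  shows "S t (y 0) = y t"
proof -
  have C0: "C0_semigroup S" using S by (simp add: system_semigroup_def)
  obtain z where "(y 0, z) \<in> system_operator \<sigma>" using y by (auto simp: strict_solution_def)
  then have x: "strict_solution \<sigma> (\<lambda>t. S t (y 0))" by (rule system_semigroup_strict_solution[OF S])
  have "strict_solution \<sigma> (\<lambda>t. S t (y 0) - y t)"
    unfolding strict_solution_def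
  proof (intro conjI allI impI)
    show "continuous_on {0..} (\<lambda>t. S t (y 0) - y t)"
      using x y by (auto simp: strict_solution_def intro: continuous_on_diff)
    fix t :: real assume t: "t \<ge> 0"
    obtain z where z: "(S t (y 0), z) \<in> system_operator \<sigma>" "((\<lambda>t. S t (y 0)) has_vector_derivative z) (at t within {t..})"
      using x t by (auto simp: strict_solution_def)
    obtain w where w: "(y t, w) \<in> system_operator \<sigma>" "(y has_vector_derivative w) (at t within {t..})"
      using y t by (auto simp: strict_solution_def)
    obtain u u' v v' where 1: "S t (y 0) = (u, v)" "z = (- v', - u' - multiply \<sigma> v)" "has_weak_derivative u u'" "has_weak_derivative v v'"
      using z(1) by (auto simp: system_operator_def)
    obtain a a' b b' where 2: "y t = (a, b)" "w = (- b', - a' - multiply \<sigma> b)" "has_weak_derivative a a'" "has_weak_derivative b b'"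
      using w(1) by (auto simp: system_operator_def)
    have "multiply \<sigma> (v - b) = multiply \<sigma> v - multiply \<sigma> b"
      using multiply_add_scaleR[OF \<sigma>(1), of "-1" b v] by simp
    then have "z - w = (- (v' - b'), - (u' - a') - multiply \<sigma> (v - b))" "S t (y 0) - y t = (u - a, v - b)"
      by (simp_all add: 1(1,2) 2(1,2))
    moreover have "has_weak_derivative (u - a) (u' - a')" "has_weak_derivative (v - b) (v' - b')"
      by (rule has_weak_derivative_diff 1 2)+
    ultimately have "(S t (y 0) - y t, z - w) \<in> system_operator \<sigma>"
      by (simp only: system_operatorI)
    then show "\<exists>z. (S t (y 0) - y t, z) \<in> system_operator \<sigma> \<and> ((\<lambda>t. S t (y 0) - y t) has_vector_derivative z) (at t within {t..})"
      using has_vector_derivative_diff[OF z(2) w(2)] by blast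
  qed
  \<comment> \<open>For \<theta> = \<alpha> = 0 the energy is the squared norm, and the condition
    says only that the damping is nonnegative.\<close>
  moreover have "AE x in torus. rate_condition 0 0 (\<sigma> x)"
    using \<sigma>(2) by (simp add: rate_condition_def)
  ultimately have "energy 0 (fst (S t (y 0) - y t) - mean_L2 (fst (S 0 (y 0) - y 0))) (snd (S t (y 0) - y t))
      \<le> energy 0 (fst (S 0 (y 0) - y 0) - mean_L2 (fst (S 0 (y 0) - y 0))) (snd (S 0 (y 0) - y 0)) * exp (- 0 * t)"
    using strict_solution_energy_decay[OF \<sigma>(1), of 0 0 "\<lambda>t. S t (y 0) - y t" t] t by simp
  moreover have "S 0 (y 0) - y 0 = 0" "mean_L2 0 = 0"
    using linear_0[OF bounded_linear.linear[OF bounded_linear_mean_L2]] by (simp_all add: C0_zero[OF C0])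
  ultimately have "(norm (fst (S t (y 0) - y t)))\<^sup>2 + (norm (snd (S t (y 0) - y t)))\<^sup>2 \<le> 0"
    by (simp add: energy_def)
  then have "fst (S t (y 0) - y t) = 0" "snd (S t (y 0) - y t) = 0"
    by (simp_all add: sum_power2_le_zero_iff)
  then have "S t (y 0) - y t = 0" by (metis prod.collapse zero_prod_def)
  then show ?thesis by simp
qed

section \<open>An explicit solution in the first Fourier mode\<close>

definition cos_L2 :: L2 where
  "cos_L2 = harmonic 1 (1 / 2) + harmonic (- 1) (1 / 2)"

definition sin_L2 :: L2 where
  "sin_L2 = harmonic 1 (- \<i> / 2) + harmonic (- 1) (\<i> / 2)"

lemma harmonic_uminus: "harmonic k (- c) = - harmonic k c"
  by (rule linear_neg[OF bounded_linear.linear[OF bounded_linear_harmonic]])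

lemma has_weak_derivative_add:
  "has_weak_derivative f f' \<Longrightarrow> has_weak_derivative g g' \<Longrightarrow> has_weak_derivative (f + g) (f' + g')"
  using has_weak_derivative_add_scaleR[of f f' g g' 1] by simp

lemma has_weak_derivative_scaleR:
  "has_weak_derivative f f' \<Longrightarrow> has_weak_derivative (r *\<^sub>R f) (r *\<^sub>R f')"
  using has_weak_derivative_add_scaleR[OF _ has_weak_derivative_zero, of f f' r] by simp

lemma has_weak_derivative_cos: "has_weak_derivative cos_L2 (- sin_L2)"
  using has_weak_derivative_add[OF has_weak_derivative_harmonic[of 1 "1/2"] has_weak_derivative_harmonic[of "-1" "1/2"]]
  by (simp add: cos_L2_def sin_L2_def harmonic_uminus)

lemma has_weak_derivative_sin: "has_weak_derivative sin_L2 cos_L2"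
  using has_weak_derivative_add[OF has_weak_derivative_harmonic[of 1 "- \<i>/2"] has_weak_derivative_harmonic[of "-1" "\<i>/2"]]
  by (simp add: cos_L2_def sin_L2_def)

lemma real_valued_abs_L2:
  assumes "sq_integrable (\<lambda>x. complex_of_real (f x))"
  shows "real_valued (abs_L2 (\<lambda>x. complex_of_real (f x)))"
  using rep_L2_abs_L2[OF assms] unfolding real_valued_def by eventually_elim simp

lemma real_valued_scaleR: "real_valued f \<Longrightarrow> real_valued (r *\<^sub>R f)"
  unfolding real_valued_def using rep_L2_scaleR[of r f] by (auto elim: eventually_elim2 simp: scaleR_conv_of_real)

lemma real_valued_cos: "real_valued cos_L2"
proof -
  have "(\<lambda>x. (1/2) * cis (of_int 1 * x) + (1/2) * cis (of_int (- 1) * x)) = (\<lambda>x. complex_of_real (cos x))"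
    by (simp add: fun_eq_iff complex_eq_iff)
  then have "cos_L2 = abs_L2 (\<lambda>x. complex_of_real (cos x))"
    unfolding cos_L2_def harmonic_def by (subst abs_L2_add[OF sq_integrable_cis sq_integrable_cis, symmetric]) (simp only:)
  also have "real_valued \<dots>"
    by (intro real_valued_abs_L2 sq_integrable_of_real_continuous continuous_intros)
  finally show ?thesis .
qed

lemma real_valued_sin: "real_valued sin_L2"
proof -
  have "(\<lambda>x. (- \<i>/2) * cis (of_int 1 * x) + (\<i>/2) * cis (of_int (- 1) * x)) = (\<lambda>x. complex_of_real (sin x))"
    by (simp add: fun_eq_iff complex_eq_iff)
  then have "sin_L2 = abs_L2 (\<lambda>x. complex_of_real (sin x))"
    unfolding sin_L2_def harmonic_def by (subst abs_L2_add[OF sq_integrable_cis sq_integrable_cis, symmetric]) (simp only:)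
  also have "real_valued \<dots>"
    by (intro real_valued_abs_L2 sq_integrable_of_real_continuous continuous_intros)
  finally show ?thesis .
qed

lemma cos_L2_nonzero: "cos_L2 \<noteq> 0"
proof
  assume "cos_L2 = 0"
  then have "inner cos_L2 (harmonic 1 1) = 0" by simp
  then show False by (simp add: cos_L2_def inner_add_left inner_harmonic)
qed

text \<open>The amplitude satisfies a'' + s a' + a = 0. An underdamped mode oscillates, so exact
  decay by exp (- \<mu> t) is claimed only at arbitrarily late times; this form covers the
  non-oscillating case as well and suffices to refute faster decay.\<close>

lemma mode_solution:
  assumes s: "s > 0" "s \<noteq> 2"
  shows "\<exists>a b :: real \<Rightarrow> real. a 0 = 1 \<and> (\<forall>t. (a has_real_derivative - b t) (at t)) \<and>
    (\<forall>t. (b has_real_derivative a t - s * b t) (at t)) \<and>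
    (\<forall>t0. \<exists>t\<ge>t0. a t = exp (- \<mu>_of s * t) * a 0 \<and> b t = exp (- \<mu>_of s * t) * b 0)"
proof (cases "s < 2")
  case True
  \<comment> \<open>The imaginary part of the characteristic roots; after n full periods, at time 2
    \<pi> n / \<omega>, only the factor exp (- s t / 2) is left.\<close>
  define \<omega> where "\<omega> = sqrt (1 - s\<^sup>2 / 4)"
  have "s\<^sup>2 < 2\<^sup>2" using s True by (intro power_strict_mono) auto
  then have \<omega>: "\<omega>\<^sup>2 = 1 - s\<^sup>2 / 4" "\<omega> > 0" by (simp_all add: \<omega>_def)
  define a where "a t = exp (- (s / 2) * t) * cos (\<omega> * t)" for t
  define b where "b t = exp (- (s / 2) * t) * (s / 2 * cos (\<omega> * t) + \<omega> * sin (\<omega> * t))" for t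
  show ?thesis
  proof (rule exI[of _ a], rule exI[of _ b], intro conjI allI)
    show "a 0 = 1" by (simp add: a_def)
    fix t :: real
    show "(a has_real_derivative - b t) (at t)"
      unfolding a_def b_def by (auto intro!: derivative_eq_intros simp: algebra_simps)
    have "\<omega> * \<omega> = 1 - s * s / 4" using \<omega>(1) by (simp add: power2_eq_square)
    then have square: "\<omega> * (\<omega> * X) = X - s * (s * X) / 4" for X
      unfolding mult.assoc[symmetric] by (simp add: left_diff_distrib)
    show "(b has_real_derivative a t - s * b t) (at t)"
      unfolding a_def b_def
      by (auto intro!: derivative_eq_intros simp: algebra_simps square diff_divide_distrib add_divide_distrib)
    fix t0 :: real
    obtain n :: nat where n: "t0 * \<omega> / (2 * pi) \<le> real n" using real_arch_simple by blast
    define t where "t = 2 * pi * real n / \<omega>"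
    have "t \<ge> t0" using n \<omega>(2) by (simp add: t_def field_simps)
    moreover have "\<omega> * t = 2 * pi * real n" using \<omega>(2) by (simp add: t_def)
    then have "cos (\<omega> * t) = 1" "sin (\<omega> * t) = 0"
      using cos_2npi[of n] sin_2npi[of n] by (simp_all add: mult.commute mult.left_commute)
    ultimately show "\<exists>t\<ge>t0. a t = exp (- \<mu>_of s * t) * a 0 \<and> b t = exp (- \<mu>_of s * t) * b 0"
      using True by (intro exI[of _ t]) (simp add: a_def b_def \<mu>_of_def)
  qed
next
  case False
  with s have s2: "s > 2" by simp
  \<comment> \<open>The smaller root of \<mu>^2 - s \<mu> + 1 = 0, giving an eigenvector that decays
    without oscillation.\<close>
  define \<mu> where "\<mu> = s / 2 - sqrt (s\<^sup>2 / 4 - 1)"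
  have "s\<^sup>2 > 2\<^sup>2" using s2 by (intro power_strict_mono) auto
  then have "(sqrt (s\<^sup>2 / 4 - 1))\<^sup>2 = s\<^sup>2 / 4 - 1" by simp
  moreover have "sqrt (s\<^sup>2 / 4 - 1) = s / 2 - \<mu>" by (simp add: \<mu>_def)
  ultimately have "(s / 2 - \<mu>)\<^sup>2 = s\<^sup>2 / 4 - 1" by simp
  then have \<mu>: "\<mu> * \<mu> = s * \<mu> - 1" by (simp add: power2_eq_square algebra_simps)
  define a where "a t = exp (- \<mu> * t)" for t
  define b where "b t = \<mu> * exp (- \<mu> * t)" for t
  show ?thesis
  proof (rule exI[of _ a], rule exI[of _ b], intro conjI allI)
    show "a 0 = 1" by (simp add: a_def)
    fix t :: real
    show "(a has_real_derivative - b t) (at t)"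
      unfolding a_def b_def by (auto intro!: derivative_eq_intros)
    have square: "\<mu> * (\<mu> * X) = s * (\<mu> * X) - X" for X
      unfolding mult.assoc[symmetric] \<mu> by (simp add: left_diff_distrib)
    show "(b has_real_derivative a t - s * b t) (at t)"
      unfolding a_def b_def
      by (auto intro!: derivative_eq_intros simp: algebra_simps square diff_divide_distrib add_divide_distrib)
    fix t0
    show "\<exists>t\<ge>t0. a t = exp (- \<mu>_of s * t) * a 0 \<and> b t = exp (- \<mu>_of s * t) * b 0"
      using False by (intro exI[of _ t0]) (simp add: a_def b_def \<mu>_of_def \<mu>_def)
  qed
qed

text \<open>At the return times of the mode the distance to equilibrium is exactly exp (- \<mu> t)
  times its initial value, so a bound C exp (- l t) would keep exp ((l - \<mu>) t) below C at
  arbitrarily late t.\<close>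

lemma decay_rate_sharp:
  assumes \<sigma>: "\<sigma> \<in> Linfty" "AE x in torus. \<sigma> x = s" and s: "s > 0" "s \<noteq> 2"
    and S: "system_semigroup \<sigma> S"
    and l: "l > \<mu>_of s" and C: "C > 0"
    and decay: "\<And>w0 z0 w z t. real_mild_solution S w0 z0 w z \<Longrightarrow> t \<ge> 0 \<Longrightarrow>
      norm (f_vec (w t) (z t) - f_equil w0) \<le> C * norm (f_vec w0 z0 - f_equil w0) * exp (- l * t)"
  shows False
proof -
  obtain a b :: "real \<Rightarrow> real" where a0: "a 0 = 1"
    and a: "\<And>t. (a has_real_derivative - b t) (at t)"
    and b: "\<And>t. (b has_real_derivative a t - s * b t) (at t)"
    and return: "\<And>t0. \<exists>t\<ge>t0. a t = exp (- \<mu>_of s * t) * a 0 \<and> b t = exp (- \<mu>_of s * t) * b 0"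
    using mode_solution[OF s] by blast
  let ?w = "\<lambda>t. a t *\<^sub>R cos_L2" and ?z = "\<lambda>t. b t *\<^sub>R sin_L2"
  define y where "y t = (?w t, ?z t)" for t
  have cont: "continuous_on A a" "continuous_on A b" for A
    by (intro continuous_at_imp_continuous_on ballI, rule DERIV_isCont[OF a] DERIV_isCont[OF b])+
  have strict: "strict_solution \<sigma> y"
    unfolding strict_solution_def
  proof (intro conjI allI impI)
    show "continuous_on {0..} y" unfolding y_def by (intro continuous_intros cont)
    fix t :: real
    have "(- (b t *\<^sub>R cos_L2), - (a t *\<^sub>R (- sin_L2)) - multiply \<sigma> (?z t)) = ((- b t) *\<^sub>R cos_L2, (a t - s * b t) *\<^sub>R sin_L2)"
      by (simp add: multiply_const[OF \<sigma>] scaleR_diff_left)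
    moreover have "has_weak_derivative (?w t) (a t *\<^sub>R (- sin_L2))" "has_weak_derivative (?z t) (b t *\<^sub>R cos_L2)"
      by (intro has_weak_derivative_scaleR has_weak_derivative_cos has_weak_derivative_sin)+
    ultimately have "(y t, ((- b t) *\<^sub>R cos_L2, (a t - s * b t) *\<^sub>R sin_L2)) \<in> system_operator \<sigma>"
      using system_operatorI[of "?w t" "a t *\<^sub>R (- sin_L2)" "?z t" "b t *\<^sub>R cos_L2" \<sigma>] by (simp only: y_def)
    moreover have "(y has_vector_derivative ((- b t) *\<^sub>R cos_L2, (a t - s * b t) *\<^sub>R sin_L2)) (at t within {t..})"
    proof -
      have ab: "(a has_real_derivative - b t) (at t within {t..})" "(b has_real_derivative a t - s * b t) (at t within {t..})"
        using a b by (auto intro: has_field_derivative_at_within)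
      have "(?w has_vector_derivative (- b t) *\<^sub>R cos_L2) (at t within {t..})"
        "(?z has_vector_derivative (a t - s * b t) *\<^sub>R sin_L2) (at t within {t..})"
        using has_vector_derivative_scaleR[OF ab(1) has_vector_derivative_const]
          has_vector_derivative_scaleR[OF ab(2) has_vector_derivative_const] by simp_all
      then show ?thesis unfolding y_def by (rule has_vector_derivative_Pair)
    qed
    ultimately show "\<exists>z. (y t, z) \<in> system_operator \<sigma> \<and> (y has_vector_derivative z) (at t within {t..})"
      by blast
  qed
  have nonneg: "AE x in torus. 0 \<le> \<sigma> x" using \<sigma>(2) s(1) by (auto elim: eventually_mono)
  have Sy: "S t (y 0) = y t" if "t \<ge> 0" for t
    by (rule strict_solution_unique[OF \<sigma>(1) nonneg S strict that])
  have mild: "real_mild_solution S (?w 0) (?z 0) ?w ?z"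
    unfolding real_mild_solution_def using Sy
    by (auto simp: y_def intro!: real_valued_scaleR real_valued_cos real_valued_sin continuous_intros cont)
  \<comment> \<open>The cosine is the weak derivative of the sine, hence the equilibrium of this
    solution is 0.\<close>
  have "mean_L2 cos_L2 = 0" by (rule weak_derivative_mean[OF has_weak_derivative_sin])
  then have mean: "mean_L2 (?w 0) = 0"
    using linear_scale[OF bounded_linear.linear[OF bounded_linear_mean_L2]] by simp
  let ?N = "\<lambda>t. norm (f_vec (?w t) (?z t) - f_equil (?w 0))"
  have N: "(?N t)\<^sup>2 = ((a t)\<^sup>2 * (norm cos_L2)\<^sup>2 + (b t)\<^sup>2 * (norm sin_L2)\<^sup>2) / 2" for t
    unfolding norm_f_vec_diff_equil mean by (simp add: power_mult_distrib)
  have pos: "?N 0 > 0"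
  proof -
    have "(?N 0)\<^sup>2 > 0" unfolding N using cos_L2_nonzero by (simp add: a0 add_pos_nonneg)
    then show ?thesis by (simp add: zero_less_power2)
  qed
  \<comment> \<open>Beyond this time exp ((l - \<mu>) t) is at least 2 C; the maximum with 0 keeps
    the time admissible.\<close>
  define t0 where "t0 = max 0 (ln (2 * C) / (l - \<mu>_of s))"
  obtain t where t: "t \<ge> t0" "a t = exp (- \<mu>_of s * t) * a 0" "b t = exp (- \<mu>_of s * t) * b 0"
    using return by blast
  have "(?N t)\<^sup>2 = (exp (- \<mu>_of s * t) * ?N 0)\<^sup>2"
    unfolding N power_mult_distrib unfolding N t by (simp add: power_mult_distrib algebra_simps add_divide_distrib)
  then have "?N t = exp (- \<mu>_of s * t) * ?N 0"
    by (simp only: power2_eq_iff_nonneg norm_ge_zero mult_nonneg_nonneg exp_ge_zero)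
  moreover have "?N t \<le> C * ?N 0 * exp (- l * t)"
    by (rule decay[OF mild]) (use t in \<open>simp add: t0_def\<close>)
  ultimately have "?N 0 * exp (- \<mu>_of s * t) \<le> ?N 0 * (C * exp (- l * t))"
    by (simp add: mult_ac)
  then have "exp (- \<mu>_of s * t) \<le> C * exp (- l * t)"
    using pos by (simp only: mult_le_cancel_left_pos)
  then have "exp (- \<mu>_of s * t) * exp (l * t) \<le> C * exp (- l * t) * exp (l * t)"
    by (intro mult_right_mono) auto
  then have "exp ((l - \<mu>_of s) * t) \<le> C"
    by (simp add: exp_add[symmetric] mult.assoc algebra_simps)
  moreover have "2 * C \<le> exp ((l - \<mu>_of s) * t)"
  proof -
    have "ln (2 * C) / (l - \<mu>_of s) \<le> t" using t by (simp add: t0_def)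
    then have "ln (2 * C) \<le> (l - \<mu>_of s) * t" using l by (simp add: divide_le_eq mult.commute)
    then have "exp (ln (2 * C)) \<le> exp ((l - \<mu>_of s) * t)" by simp
    then show ?thesis using C by simp
  qed
  ultimately show False using C by simp
qed

theorem theorem2p2:
  fixes \<sigma> :: "real \<Rightarrow> real"
    and S :: "real \<Rightarrow> L2 \<times> L2 \<Rightarrow> L2 \<times> L2"
    and u0 v0 :: L2
    and u v :: "real \<Rightarrow> L2"
  assumes "\<sigma> \<in> Linfty"
    and "ess_inf \<sigma> > 0"
    and "system_semigroup \<sigma> S"
    and "real_mild_solution S u0 v0 u v"
  shows
    "(\<forall>s>0. (AE x in torus. \<sigma> x = s) \<longrightarrow>
       (s \<noteq> 2 \<longrightarrow>
          (\<forall>t\<ge>0. energy (\<theta>_of s) (u t - const_L2 (avg u0)) (v t)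
                  \<le> energy (\<theta>_of s) (u0 - const_L2 (avg u0)) v0 * exp (- 2 * \<mu>_of s * t)) \<and>
          (\<forall>t\<ge>0. norm (f_vec (u t) (v t) - f_equil u0)
                  \<le> C_of s * norm (f_vec u0 v0 - f_equil u0) * exp (- \<mu>_of s * t)) \<and>
          \<not> (\<exists>l>\<mu>_of s. \<exists>C>0. \<forall>w0 z0 w z. real_mild_solution S w0 z0 w z \<longrightarrow>
                (\<forall>t\<ge>0. norm (f_vec (w t) (z t) - f_equil w0)
                        \<le> C * norm (f_vec w0 z0 - f_equil w0) * exp (- l * t)))) \<and>
       (s = 2 \<longrightarrow>
          (\<forall>\<epsilon>. 0 < \<epsilon> \<and> \<epsilon> < 1 \<longrightarrow>
             (\<forall>t\<ge>0. energy (2 * (2 - \<epsilon>\<^sup>2) / (2 + \<epsilon>\<^sup>2)) (u t - const_L2 (avg u0)) (v t)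
                     \<le> energy (2 * (2 - \<epsilon>\<^sup>2) / (2 + \<epsilon>\<^sup>2)) (u0 - const_L2 (avg u0)) v0
                        * exp (- 2 * (1 - \<epsilon>) * t)) \<and>
             (\<forall>t\<ge>0. norm (f_vec (u t) (v t) - f_equil u0)
                     \<le> sqrt 2 / \<epsilon> * norm (f_vec u0 v0 - f_equil u0) * exp (- (1 - \<epsilon>) * t)))))
     \<and>
     (0 < ess_inf \<sigma> \<and> ess_inf \<sigma> < ess_sup \<sigma> \<longrightarrow>
        (\<forall>t\<ge>0. energy (\<theta>_star (ess_inf \<sigma>) (ess_sup \<sigma>)) (u t - const_L2 (avg u0)) (v t)
                \<le> energy (\<theta>_star (ess_inf \<sigma>) (ess_sup \<sigma>)) (u0 - const_L2 (avg u0)) v0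
                   * exp (- \<alpha>_star (ess_inf \<sigma>) (ess_sup \<sigma>) * t)) \<and>
        (\<forall>t\<ge>0. norm (f_vec (u t) (v t) - f_equil u0)
                \<le> sqrt ((2 + \<theta>_star (ess_inf \<sigma>) (ess_sup \<sigma>)) / (2 - \<theta>_star (ess_inf \<sigma>) (ess_sup \<sigma>)))
                   * norm (f_vec u0 v0 - f_equil u0)
                   * exp (- \<alpha>_star (ess_inf \<sigma>) (ess_sup \<sigma>) / 2 * t)))"
proof -
  note \<sigma> = assms(1) and S = assms(3)
  have uv: "S t (u0, v0) = (u t, v t)" if "t \<ge> 0" for t
    using assms(4) that by (simp add: real_mild_solution_def)
  note decay = semigroup_norm_decay[OF \<sigma> _ _ _ _ S _ uv]
  have const: "energy (\<theta>_of s) (u t - const_L2 (avg u0)) (v t)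
        \<le> energy (\<theta>_of s) (u0 - const_L2 (avg u0)) v0 * exp (- 2 * \<mu>_of s * t)"
    "norm (f_vec (u t) (v t) - f_equil u0)
        \<le> C_of s * norm (f_vec u0 v0 - f_equil u0) * exp (- \<mu>_of s * t)"
    if s: "s > 0" "s \<noteq> 2" "AE x in torus. \<sigma> x = s" and t: "t \<ge> 0" for s t
  proof -
    \<comment> \<open>The energy rate is \<alpha> = 2 \<mu>. Below 2 this is the diagonal pair
      \<theta> = \<alpha> = s, above 2 the optimal choice \<theta> = 4 / s; \<open>C_of\<close> is
      in both cases the ratio constant of \<theta>.\<close>
    have *: "0 \<le> \<theta>_of s \<and> \<theta>_of s < 2 \<and> 2 * \<mu>_of s \<le> \<theta>_of s \<and> rate_condition (\<theta>_of s) (2 * \<mu>_of s) s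
      \<and> C_of s = sqrt ((2 + \<theta>_of s) / (2 - \<theta>_of s))"
    proof (cases "s < 2")
      case True
      then show ?thesis
        using s rate_condition_diag[of s s] by (simp add: \<theta>_of_def \<mu>_of_def C_of_def)
    next
      case False
      then have s2: "s > 2" using s by simp
      have "2 * sqrt (s\<^sup>2 / 4 - 1) = sqrt (s\<^sup>2 - 4)"
      proof -
        have "2 * sqrt (s\<^sup>2 / 4 - 1) = sqrt (2\<^sup>2 * (s\<^sup>2 / 4 - 1))" by (simp only: real_sqrt_mult) simp
        also have "2\<^sup>2 * (s\<^sup>2 / 4 - 1) = s\<^sup>2 - 4" by simp
        finally show ?thesis .
      qed
      then have "2 * \<mu>_of s = s - sqrt (s\<^sup>2 - 4)" using False by (simp add: \<mu>_of_def right_diff_distrib)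
      moreover have "(2 + 4 / s) / (2 - 4 / s) = (s + 2) / (s - 2)" using s2 by (simp add: field_simps)
      ultimately show ?thesis
        using rate_condition_large[OF s2 refl refl] False s2
        by (simp add: \<theta>_of_def C_of_def divide_less_eq)
    qed
    have "AE x in torus. rate_condition (\<theta>_of s) (2 * \<mu>_of s) (\<sigma> x)"
      using s(3) * by (auto elim: eventually_mono)
    from decay[OF this _ _ _ t t] * show "energy (\<theta>_of s) (u t - const_L2 (avg u0)) (v t)
        \<le> energy (\<theta>_of s) (u0 - const_L2 (avg u0)) v0 * exp (- 2 * \<mu>_of s * t)"
      "norm (f_vec (u t) (v t) - f_equil u0)
        \<le> C_of s * norm (f_vec u0 v0 - f_equil u0) * exp (- \<mu>_of s * t)"
      by auto
  qed
  have two: "energy (2 * (2 - \<epsilon>\<^sup>2) / (2 + \<epsilon>\<^sup>2)) (u t - const_L2 (avg u0)) (v t)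
        \<le> energy (2 * (2 - \<epsilon>\<^sup>2) / (2 + \<epsilon>\<^sup>2)) (u0 - const_L2 (avg u0)) v0 * exp (- 2 * (1 - \<epsilon>) * t)"
    "norm (f_vec (u t) (v t) - f_equil u0)
        \<le> sqrt 2 / \<epsilon> * norm (f_vec u0 v0 - f_equil u0) * exp (- (1 - \<epsilon>) * t)"
    if s: "AE x in torus. \<sigma> x = 2" and \<epsilon>: "0 < \<epsilon>" "\<epsilon> < 1" and t: "t \<ge> 0" for \<epsilon> t
  proof -
    note * = rate_condition_two[OF \<epsilon> refl refl]
    have "AE x in torus. rate_condition (2 * (2 - \<epsilon>\<^sup>2) / (2 + \<epsilon>\<^sup>2)) (2 * (1 - \<epsilon>)) (\<sigma> x)"
      using s *(2) by (auto elim: eventually_mono)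
    note decay = decay[OF this *(3,1,4) t t]
    show "energy (2 * (2 - \<epsilon>\<^sup>2) / (2 + \<epsilon>\<^sup>2)) (u t - const_L2 (avg u0)) (v t)
        \<le> energy (2 * (2 - \<epsilon>\<^sup>2) / (2 + \<epsilon>\<^sup>2)) (u0 - const_L2 (avg u0)) v0 * exp (- 2 * (1 - \<epsilon>) * t)"
      using decay(1) by simp
    have "sqrt (2 / \<epsilon>\<^sup>2) = sqrt 2 / \<epsilon>" "- (2 * (1 - \<epsilon>)) / 2 = - (1 - \<epsilon>)"
      using \<epsilon> by (simp_all add: real_sqrt_divide)
    then show "norm (f_vec (u t) (v t) - f_equil u0)
        \<le> sqrt 2 / \<epsilon> * norm (f_vec u0 v0 - f_equil u0) * exp (- (1 - \<epsilon>) * t)"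
      using decay(2) by (simp only: *(5))
  qed
  have star: "energy (\<theta>_star (ess_inf \<sigma>) (ess_sup \<sigma>)) (u t - const_L2 (avg u0)) (v t)
        \<le> energy (\<theta>_star (ess_inf \<sigma>) (ess_sup \<sigma>)) (u0 - const_L2 (avg u0)) v0
           * exp (- \<alpha>_star (ess_inf \<sigma>) (ess_sup \<sigma>) * t)"
    "norm (f_vec (u t) (v t) - f_equil u0)
        \<le> sqrt ((2 + \<theta>_star (ess_inf \<sigma>) (ess_sup \<sigma>)) / (2 - \<theta>_star (ess_inf \<sigma>) (ess_sup \<sigma>)))
           * norm (f_vec u0 v0 - f_equil u0) * exp (- \<alpha>_star (ess_inf \<sigma>) (ess_sup \<sigma>) / 2 * t)"
    if m: "0 < ess_inf \<sigma>" "ess_inf \<sigma> < ess_sup \<sigma>" and t: "t \<ge> 0" for t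
  proof -
    note * = rate_condition_star[OF m]
    have "AE x in torus. rate_condition (\<theta>_star (ess_inf \<sigma>) (ess_sup \<sigma>)) (\<alpha>_star (ess_inf \<sigma>) (ess_sup \<sigma>)) (\<sigma> x)"
      using AE_ess_inf_le[OF \<sigma>] AE_le_ess_sup[OF \<sigma>] by eventually_elim (rule *(4))
    from decay[OF this *(1,3,2) t t]
    show "energy (\<theta>_star (ess_inf \<sigma>) (ess_sup \<sigma>)) (u t - const_L2 (avg u0)) (v t)
        \<le> energy (\<theta>_star (ess_inf \<sigma>) (ess_sup \<sigma>)) (u0 - const_L2 (avg u0)) v0
           * exp (- \<alpha>_star (ess_inf \<sigma>) (ess_sup \<sigma>) * t)"
      "norm (f_vec (u t) (v t) - f_equil u0)
        \<le> sqrt ((2 + \<theta>_star (ess_inf \<sigma>) (ess_sup \<sigma>)) / (2 - \<theta>_star (ess_inf \<sigma>) (ess_sup \<sigma>)))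
           * norm (f_vec u0 v0 - f_equil u0) * exp (- \<alpha>_star (ess_inf \<sigma>) (ess_sup \<sigma>) / 2 * t)" .
  qed
  have sharp: "\<not> (\<exists>l>\<mu>_of s. \<exists>C>0. \<forall>w0 z0 w z. real_mild_solution S w0 z0 w z \<longrightarrow>
      (\<forall>t\<ge>0. norm (f_vec (w t) (z t) - f_equil w0) \<le> C * norm (f_vec w0 z0 - f_equil w0) * exp (- l * t)))"
    if "s > 0" "s \<noteq> 2" "AE x in torus. \<sigma> x = s" for s
    using decay_rate_sharp[OF \<sigma> that(3,1,2) S] by blast
  show ?thesis
  proof (intro conjI allI impI, goal_cases)
    case (1 s t)
    then show ?case by (intro const)
  next
    case (2 s t)
    then show ?case by (intro const)
  next
    case (3 s)
    then show ?case by (intro sharp)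
  next
    case (4 s \<epsilon> t)
    then show ?case by (intro two) auto
  next
    case (5 s \<epsilon> t)
    then show ?case by (intro two) auto
  next
    case (6 t)
    then show ?case by (intro star) auto
  next
    case (7 t)
    then show ?case by (intro star) auto
  qed
qed

end
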